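(* Let $(W,S)$ be a Coxeter system. Let $\mathcal{W}_{\mathrm{diag}}$ be the diagrammatic monoidal category of unoriented diagrams defined in the context, and let $\Omega W$ be the monoidal category with object set $W$, only identity morphisms, and tensor product given by multiplication in $W$. Then the obvious monoidal functor $\mathcal{W}_{\mathrm{diag}}\to\Omega W$, sending a word in $S$ to the element of $W$ it represents and every morphism to the corresponding identity morphism, is an equivalence of categories.
   Context: Setup. $S$ is a finite set; for $s\neq t$ in $S$, $m_{st}=m_{ts}\in\{2,3,\dots\}\cup\{\infty\}$. $W$ is the group with generators $S$ and relations $s^2=1$ and $sts\cdots=tst\cdots$ ($m_{st}$ letters on each side, no relation if $m_{st}=\infty$). For $I\subset S$, $W_I$ is the parabolic subgroup generated by $I$; if it is finite, $w_I$ is its longest element. The category $\mathcal{W}_{\mathrm{diag}}$. It is the (strict) monoidal category presented as follows. Objects: words in $S$; the tensor product is concatenation; the unit $\mathbf 1$ is the empty word. Morphisms: planar graphs in the strip $\mathbb R\times[0,1]$, with unoriented edges colored by $S$ (edges may run to the boundary lines, where they give the source word at the bottom and the target word at the top, or form circles), all of whose interior vertices are $2m_{st}$-valent with adjacent edges alternately colored $s$ and $t$, for some $s\neq t$ with $m_{st}<\infty$. Vertices carry no further decoration. Diagrams are considered up to planar isotopy. Composition is vertical stacking; tensor product is horizontal juxtaposition. Equivalently, the generators are caps $ss\to\mathbf 1$, cups $\mathbf 1\to ss$, and vertices $v_{s,t}:\underbrace{sts\cdots}_{m_{st}}\to\underbrace{tst\cdots}_{m_{st}}$; isotopy means that cups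 and caps satisfy the zigzag identities (making $s$ biadjoint to itself) and that rotating $v_{s,t}$ by one strand, clockwise or counterclockwise, gives $v_{t,s}$. Relations (for all colors for which they make sense): (1) Standard relations: cap and cup are mutually inverse, i.e. the composites $\mathbf 1\to ss\to\mathbf 1$ and $ss\to\mathbf 1\to ss$ are identities; and $v_{t,s}\circ v_{s,t}=\mathrm{id}$. (2) Generalized Zamolodzhikov relations: one for each $I\subset S$ with $|I|=3$ and $W_I$ finite (so $W_I$ is of type $A_1\times I_2(m)$ with $m<\infty$, $A_3$, $B_3$ or $H_3$). Consider the graph $\Gamma_I$ whose vertices are reduced expressions of $w_I$ and whose edges are braid moves replacing a consecutive subword $sts\cdots$ of length $m_{st}$ by $tst\cdots$. A braid move from $a\cdot(sts\cdots)\cdot b$ to $a\cdot(tst\cdots)\cdot b$ gives the morphism $\mathrm{id}_a\otimes v_{s,t}\otimes\mathrm{id}_b$, and is said to cross the coset $yW_{\{s,t\}}$, where $y\in W_I$ is the element expressed by $a$. A Zamolodzhikov cycle is a closed path in $\Gamma_I$ crossing each coset $yW_J\subset W_I$ with $J\subset I$, $|J|=2$, exactly once. The relation says that the composite of the morphisms along a Zamolodzhikov cycle is the identity; equivalently, the two morphisms obtained by following the two arcs of the cycle between two of its vertices are equal. (Such a cycle is unique up to starting point, direction and exchange of braid moves on disjoint subwords, so the relation does not depend on the choice, given the other relations.) *)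

theory Defs
  imports "HOL-Algebra.Generated_Groups" "HOL-Library.Extended_Nat"
begin

section \<open>Strict monoidal categories\<close>

text \<open>Categories are given by hom-sets. Hom-sets of different pairs of objects need not be
  disjoint, so the morphism part of a functor takes source and target as arguments.\<close>

record ('o, 'm) cat =
  Obj :: "'o set"
  Hom :: "'o \<Rightarrow> 'o \<Rightarrow> 'm set"
  Idn :: "'o \<Rightarrow> 'm"
  Cmp :: "'m \<Rightarrow> 'm \<Rightarrow> 'm"  \<comment> \<open>\<open>Cmp C g f\<close> is ``\<open>g\<close> after \<open>f\<close>''\<close>

record ('o, 'm) mon_cat = "('o, 'm) cat" +
  Unit :: "'o"
  TObj :: "'o \<Rightarrow> 'o \<Rightarrow> 'o"
  TMor :: "'m \<Rightarrow> 'm \<Rightarrow> 'm"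

locale category =
  fixes C :: "('o, 'm, 'r) cat_scheme"
  assumes Idn_Hom: "a \<in> Obj C \<Longrightarrow> Idn C a \<in> Hom C a a"
    and Cmp_Hom: "\<lbrakk>a \<in> Obj C; b \<in> Obj C; c \<in> Obj C; f \<in> Hom C a b; g \<in> Hom C b c\<rbrakk>
      \<Longrightarrow> Cmp C g f \<in> Hom C a c"
    and Cmp_Idn: "\<lbrakk>a \<in> Obj C; b \<in> Obj C; f \<in> Hom C a b\<rbrakk> \<Longrightarrow> Cmp C f (Idn C a) = f"
    and Idn_Cmp: "\<lbrakk>a \<in> Obj C; b \<in> Obj C; f \<in> Hom C a b\<rbrakk> \<Longrightarrow> Cmp C (Idn C b) f = f"
    and Cmp_assoc: "\<lbrakk>a \<in> Obj C; b \<in> Obj C; c \<in> Obj C; d \<in> Obj C;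
        f \<in> Hom C a b; g \<in> Hom C b c; h \<in> Hom C c d\<rbrakk>
      \<Longrightarrow> Cmp C h (Cmp C g f) = Cmp C (Cmp C h g) f"

locale strict_monoidal_category = category C
  for C :: "('o, 'm, 'r) mon_cat_scheme" +
  assumes Unit_Obj: "Unit C \<in> Obj C"
    and TObj_Obj: "\<lbrakk>a \<in> Obj C; b \<in> Obj C\<rbrakk> \<Longrightarrow> TObj C a b \<in> Obj C"
    and TObj_Unit_left: "a \<in> Obj C \<Longrightarrow> TObj C (Unit C) a = a"
    and TObj_Unit_right: "a \<in> Obj C \<Longrightarrow> TObj C a (Unit C) = a"
    and TObj_assoc: "\<lbrakk>a \<in> Obj C; b \<in> Obj C; c \<in> Obj C\<rbrakk>
      \<Longrightarrow> TObj C (TObj C a b) c = TObj C a (TObj C b c)"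
    and TMor_Hom: "\<lbrakk>a \<in> Obj C; b \<in> Obj C; a' \<in> Obj C; b' \<in> Obj C; f \<in> Hom C a b; g \<in> Hom C a' b'\<rbrakk>
      \<Longrightarrow> TMor C f g \<in> Hom C (TObj C a a') (TObj C b b')"
    and TMor_Idn: "\<lbrakk>a \<in> Obj C; b \<in> Obj C\<rbrakk>
      \<Longrightarrow> TMor C (Idn C a) (Idn C b) = Idn C (TObj C a b)"
    and TMor_Cmp: "\<lbrakk>a \<in> Obj C; b \<in> Obj C; c \<in> Obj C; a' \<in> Obj C; b' \<in> Obj C; c' \<in> Obj C;
        f \<in> Hom C a b; g \<in> Hom C b c; f' \<in> Hom C a' b'; g' \<in> Hom C b' c'\<rbrakk>
      \<Longrightarrow> TMor C (Cmp C g f) (Cmp C g' f') = Cmp C (TMor C g g') (TMor C f f')"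
    and TMor_Unit_left: "\<lbrakk>a \<in> Obj C; b \<in> Obj C; f \<in> Hom C a b\<rbrakk>
      \<Longrightarrow> TMor C (Idn C (Unit C)) f = f"
    and TMor_Unit_right: "\<lbrakk>a \<in> Obj C; b \<in> Obj C; f \<in> Hom C a b\<rbrakk>
      \<Longrightarrow> TMor C f (Idn C (Unit C)) = f"
    and TMor_assoc: "\<lbrakk>a \<in> Obj C; b \<in> Obj C; a' \<in> Obj C; b' \<in> Obj C; a'' \<in> Obj C; b'' \<in> Obj C;
        f \<in> Hom C a b; g \<in> Hom C a' b'; h \<in> Hom C a'' b''\<rbrakk>
      \<Longrightarrow> TMor C (TMor C f g) h = TMor C f (TMor C g h)"

locale cat_functor = C: category C + D: category D
  for C :: "('o, 'm, 'r) cat_scheme" and D :: "('p, 'n, 's) cat_scheme"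
    and F\<^sub>0 :: "'o \<Rightarrow> 'p" and F\<^sub>1 :: "'o \<Rightarrow> 'o \<Rightarrow> 'm \<Rightarrow> 'n" +
  assumes F_Obj: "a \<in> Obj C \<Longrightarrow> F\<^sub>0 a \<in> Obj D"
    and F_Hom: "\<lbrakk>a \<in> Obj C; b \<in> Obj C; f \<in> Hom C a b\<rbrakk> \<Longrightarrow> F\<^sub>1 a b f \<in> Hom D (F\<^sub>0 a) (F\<^sub>0 b)"
    and F_Idn: "a \<in> Obj C \<Longrightarrow> F\<^sub>1 a a (Idn C a) = Idn D (F\<^sub>0 a)"
    and F_Cmp: "\<lbrakk>a \<in> Obj C; b \<in> Obj C; c \<in> Obj C; f \<in> Hom C a b; g \<in> Hom C b c\<rbrakk>
      \<Longrightarrow> F\<^sub>1 a c (Cmp C g f) = Cmp D (F\<^sub>1 b c g) (F\<^sub>1 a b f)"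

locale strict_monoidal_functor =
  C: strict_monoidal_category C + D: strict_monoidal_category D + cat_functor C D F\<^sub>0 F\<^sub>1
  for C :: "('o, 'm, 'r) mon_cat_scheme" and D :: "('p, 'n, 's) mon_cat_scheme"
    and F\<^sub>0 :: "'o \<Rightarrow> 'p" and F\<^sub>1 :: "'o \<Rightarrow> 'o \<Rightarrow> 'm \<Rightarrow> 'n" +
  assumes F_Unit: "F\<^sub>0 (Unit C) = Unit D"
    and F_TObj: "\<lbrakk>a \<in> Obj C; b \<in> Obj C\<rbrakk> \<Longrightarrow> F\<^sub>0 (TObj C a b) = TObj D (F\<^sub>0 a) (F\<^sub>0 b)"
    and F_TMor: "\<lbrakk>a \<in> Obj C; b \<in> Obj C; a' \<in> Obj C; b' \<in> Obj C; f \<in> Hom C a b; g \<in> Hom C a' b'\<rbrakk>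
      \<Longrightarrow> F\<^sub>1 (TObj C a a') (TObj C b b') (TMor C f g) = TMor D (F\<^sub>1 a b f) (F\<^sub>1 a' b' g)"

definition is_iso_mor :: "('o, 'm, 'r) cat_scheme \<Rightarrow> 'o \<Rightarrow> 'o \<Rightarrow> 'm \<Rightarrow> bool" where
  "is_iso_mor C a b f \<longleftrightarrow> f \<in> Hom C a b \<and>
     (\<exists>g \<in> Hom C b a. Cmp C g f = Idn C a \<and> Cmp C f g = Idn C b)"

locale natural_iso = F: cat_functor C D F\<^sub>0 F\<^sub>1 + G: cat_functor C D G\<^sub>0 G\<^sub>1
  for C :: "('o, 'm, 'r) cat_scheme" and D :: "('p, 'n, 's) cat_scheme"
    and F\<^sub>0 :: "'o \<Rightarrow> 'p" and F\<^sub>1 :: "'o \<Rightarrow> 'o \<Rightarrow> 'm \<Rightarrow> 'n"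
    and G\<^sub>0 :: "'o \<Rightarrow> 'p" and G\<^sub>1 :: "'o \<Rightarrow> 'o \<Rightarrow> 'm \<Rightarrow> 'n" and \<eta> :: "'o \<Rightarrow> 'n" +
  assumes component_iso: "a \<in> Obj C \<Longrightarrow> is_iso_mor D (F\<^sub>0 a) (G\<^sub>0 a) (\<eta> a)"
    and natural: "\<lbrakk>a \<in> Obj C; b \<in> Obj C; f \<in> Hom C a b\<rbrakk>
      \<Longrightarrow> Cmp D (\<eta> b) (F\<^sub>1 a b f) = Cmp D (G\<^sub>1 a b f) (\<eta> a)"

definition equivalence_of_categories ::
  "('o, 'm, 'r) cat_scheme \<Rightarrow> ('p, 'n, 's) cat_scheme \<Rightarrow>
   ('o \<Rightarrow> 'p) \<Rightarrow> ('o \<Rightarrow> 'o \<Rightarrow> 'm \<Rightarrow> 'n) \<Rightarrow> bool" where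
  "equivalence_of_categories C D F\<^sub>0 F\<^sub>1 \<longleftrightarrow> cat_functor C D F\<^sub>0 F\<^sub>1 \<and>
     (\<exists>G\<^sub>0 G\<^sub>1 \<eta> \<epsilon>. cat_functor D C G\<^sub>0 G\<^sub>1 \<and>
        natural_iso C C (\<lambda>a. a) (\<lambda>a b f. f)
          (\<lambda>a. G\<^sub>0 (F\<^sub>0 a)) (\<lambda>a b f. G\<^sub>1 (F\<^sub>0 a) (F\<^sub>0 b) (F\<^sub>1 a b f)) \<eta> \<and>
        natural_iso D D (\<lambda>x. F\<^sub>0 (G\<^sub>0 x)) (\<lambda>x y f. F\<^sub>1 (G\<^sub>0 x) (G\<^sub>0 y) (G\<^sub>1 x y f))
          (\<lambda>x. x) (\<lambda>x y f. f) \<epsilon>)"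

text \<open>The discrete monoidal category on a monoid; the identity morphism of \<open>x\<close> is encoded by \<open>x\<close>.\<close>

definition Omega :: "('g, 'r) monoid_scheme \<Rightarrow> ('g, 'g) mon_cat" where
  "Omega G = \<lparr> Obj = carrier G,
     Hom = (\<lambda>x y. if x = y then {x} else {}),
     Idn = (\<lambda>x. x),
     Cmp = (\<lambda>g f. f),
     Unit = \<one>\<^bsub>G\<^esub>,
     TObj = (\<otimes>\<^bsub>G\<^esub>),
     TMor = (\<otimes>\<^bsub>G\<^esub>) \<rparr>"

section \<open>Groups given by generators and relations\<close>

text \<open>A letter \<open>(x, True)\<close> stands for the generator \<open>x\<close> and \<open>(x, False)\<close> for its formal inverse;
  a pair \<open>(l, r)\<close> in \<open>R\<close> is the relation \<open>l = r\<close>.\<close>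

inductive pres_eq ::
  "'a set \<Rightarrow> (('a \<times> bool) list \<times> ('a \<times> bool) list) set \<Rightarrow>
   ('a \<times> bool) list \<Rightarrow> ('a \<times> bool) list \<Rightarrow> bool"
  for X R where
  refl: "u \<in> lists (X \<times> UNIV) \<Longrightarrow> pres_eq X R u u"
| sym: "pres_eq X R u v \<Longrightarrow> pres_eq X R v u"
| trans: "\<lbrakk>pres_eq X R u v; pres_eq X R v w\<rbrakk> \<Longrightarrow> pres_eq X R u w"
| cancel: "\<lbrakk>u \<in> lists (X \<times> UNIV); v \<in> lists (X \<times> UNIV); x \<in> X\<rbrakk>
    \<Longrightarrow> pres_eq X R (u @ [(x, b), (x, \<not> b)] @ v) (u @ v)"
| rel: "\<lbrakk>u \<in> lists (X \<times> UNIV); v \<in> lists (X \<times> UNIV); (l, r) \<in> R;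
      l \<in> lists (X \<times> UNIV); r \<in> lists (X \<times> UNIV)\<rbrakk>
    \<Longrightarrow> pres_eq X R (u @ l @ v) (u @ r @ v)"

definition presented_group ::
  "'a set \<Rightarrow> (('a \<times> bool) list \<times> ('a \<times> bool) list) set \<Rightarrow> ('a \<times> bool) list set monoid" where
  "presented_group X R = \<lparr> carrier = lists (X \<times> UNIV) // {(u, v). pres_eq X R u v},
     mult = (\<lambda>A B. {w. \<exists>u\<in>A. \<exists>v\<in>B. pres_eq X R (u @ v) w}),
     one = {w. pres_eq X R [] w} \<rparr>"

section \<open>Coxeter groups\<close>

text \<open>The values \<open>m s s\<close> are irrelevant.\<close>

definition coxeter_matrix :: "'a set \<Rightarrow> ('a \<Rightarrow> 'a \<Rightarrow> enat) \<Rightarrow> bool" where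
  "coxeter_matrix S m \<longleftrightarrow> finite S \<and>
     (\<forall>s\<in>S. \<forall>t\<in>S. s \<noteq> t \<longrightarrow> m s t = m t s \<and> m s t \<ge> 2)"

text \<open>\<open>alt s t k\<close> is the word \<open>sts\<dots>\<close> with \<open>k\<close> letters.\<close>

fun alt :: "'a \<Rightarrow> 'a \<Rightarrow> nat \<Rightarrow> 'a list" where
  "alt s t 0 = []"
| "alt s t (Suc k) = s # alt t s k"

text \<open>Diagrams are represented by formal expressions in the generators, with \<open>g \<bullet> f\<close> the vertical
  composition (\<open>g\<close> on top of \<open>f\<close>), \<open>f \<star> g\<close> the horizontal juxtaposition and \<open>Ident u\<close> the identity of
  the word \<open>u\<close>. \<open>Vert s t\<close> is the vertex from \<open>sts\<dots>\<close> to \<open>tst\<dots>\<close>.\<close>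

datatype 'a diag =
    Ident "'a list"
  | Cap 'a
  | Cup 'a
  | Vert 'a 'a
  | Comp "'a diag" "'a diag" (infixr "\<bullet>" 55)
  | Tensor "'a diag" "'a diag" (infixr "\<star>" 60)

context
  fixes S :: "'a set" and m :: "'a \<Rightarrow> 'a \<Rightarrow> enat"
begin

definition coxeter_relations :: "(('a \<times> bool) list \<times> ('a \<times> bool) list) set" where
  "coxeter_relations =
     {(map (\<lambda>x. (x, True)) [s, s], []) | s. s \<in> S} \<union>
     {(map (\<lambda>x. (x, True)) (alt s t k), map (\<lambda>x. (x, True)) (alt t s k)) | s t k.
        s \<in> S \<and> t \<in> S \<and> s \<noteq> t \<and> m s t = enat k}"

definition coxeter_group :: "('a \<times> bool) list set monoid" where
  "coxeter_group = presented_group S coxeter_relations"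

definition generator :: "'a \<Rightarrow> ('a \<times> bool) list set" where
  "generator s = {w. pres_eq S coxeter_relations [(s, True)] w}"

definition word_elt :: "'a list \<Rightarrow> ('a \<times> bool) list set" where
  "word_elt u = foldr (\<lambda>s x. generator s \<otimes>\<^bsub>coxeter_group\<^esub> x) u \<one>\<^bsub>coxeter_group\<^esub>"

definition parabolic :: "'a set \<Rightarrow> ('a \<times> bool) list set set" where
  "parabolic I = generate coxeter_group (generator ` I)"

definition cox_length :: "('a \<times> bool) list set \<Rightarrow> nat" where
  "cox_length w = (LEAST n. \<exists>u \<in> lists S. word_elt u = w \<and> length u = n)"

definition longest_elt :: "'a set \<Rightarrow> ('a \<times> bool) list set" where
  "longest_elt I = (ARG_MAX cox_length w. w \<in> parabolic I)"

definition reduced_exprs :: "('a \<times> bool) list set \<Rightarrow> 'a list set" where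
  "reduced_exprs w = {u \<in> lists S. word_elt u = w \<and> length u = cox_length w}"

section \<open>The diagrammatic category\<close>

inductive diag_type :: "'a diag \<Rightarrow> 'a list \<Rightarrow> 'a list \<Rightarrow> bool" where
  Ident: "u \<in> lists S \<Longrightarrow> diag_type (Ident u) u u"
| Cap: "s \<in> S \<Longrightarrow> diag_type (Cap s) [s, s] []"
| Cup: "s \<in> S \<Longrightarrow> diag_type (Cup s) [] [s, s]"
| Vert: "\<lbrakk>s \<in> S; t \<in> S; s \<noteq> t; m s t = enat k\<rbrakk> \<Longrightarrow> diag_type (Vert s t) (alt s t k) (alt t s k)"
| Comp: "\<lbrakk>diag_type f u v; diag_type g v w\<rbrakk> \<Longrightarrow> diag_type (g \<bullet> f) u w"
| Tensor: "\<lbrakk>diag_type f u v; diag_type g u' v'\<rbrakk> \<Longrightarrow> diag_type (f \<star> g) (u @ u') (v @ v')"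

text \<open>A braid move \<open>(a, s, t, b)\<close> replaces \<open>a \<cdot> sts\<dots> \<cdot> b\<close> by \<open>a \<cdot> tst\<dots> \<cdot> b\<close>; it is an edge of
  \<open>\<Gamma>\<^sub>I\<close> if both words are reduced expressions of \<open>w\<^sub>I\<close>.\<close>

fun move_src :: "'a list \<times> 'a \<times> 'a \<times> 'a list \<Rightarrow> 'a list" where
  "move_src (a, s, t, b) = a @ alt s t (the_enat (m s t)) @ b"

fun move_tgt :: "'a list \<times> 'a \<times> 'a \<times> 'a list \<Rightarrow> 'a list" where
  "move_tgt (a, s, t, b) = a @ alt t s (the_enat (m s t)) @ b"

fun move_diag :: "'a list \<times> 'a \<times> 'a \<times> 'a list \<Rightarrow> 'a diag" where
  "move_diag (a, s, t, b) = Ident a \<star> Vert s t \<star> Ident b"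

fun move_coset :: "'a list \<times> 'a \<times> 'a \<times> 'a list \<Rightarrow> ('a \<times> bool) list set set" where
  "move_coset (a, s, t, b) = word_elt a <#\<^bsub>coxeter_group\<^esub> parabolic {s, t}"

fun gamma_edge :: "'a set \<Rightarrow> 'a list \<times> 'a \<times> 'a \<times> 'a list \<Rightarrow> bool" where
  "gamma_edge I (a, s, t, b) \<longleftrightarrow> s \<in> S \<and> t \<in> S \<and> s \<noteq> t \<and> m s t \<noteq> \<infinity> \<and>
     move_src (a, s, t, b) \<in> reduced_exprs (longest_elt I) \<and>
     move_tgt (a, s, t, b) \<in> reduced_exprs (longest_elt I)"

fun gamma_path :: "'a set \<Rightarrow> 'a list \<Rightarrow> ('a list \<times> 'a \<times> 'a \<times> 'a list) list \<Rightarrow> 'a list \<Rightarrow> bool" where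
  "gamma_path I u [] v \<longleftrightarrow> u \<in> reduced_exprs (longest_elt I) \<and> u = v"
| "gamma_path I u (e # es) v \<longleftrightarrow> gamma_edge I e \<and> move_src e = u \<and> gamma_path I (move_tgt e) es v"

fun path_diag :: "'a list \<Rightarrow> ('a list \<times> 'a \<times> 'a \<times> 'a list) list \<Rightarrow> 'a diag" where
  "path_diag u [] = Ident u"
| "path_diag u (e # es) = path_diag (move_tgt e) es \<bullet> move_diag e"

definition zam_cycle :: "'a set \<Rightarrow> 'a list \<Rightarrow> ('a list \<times> 'a \<times> 'a \<times> 'a list) list \<Rightarrow> bool" where
  "zam_cycle I u es \<longleftrightarrow> gamma_path I u es u \<and>
     (\<forall>J y. J \<subseteq> I \<and> card J = 2 \<and> y \<in> parabolic I \<longrightarrow>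
        (\<exists>!i. i < length es \<and> move_coset (es ! i) = y <#\<^bsub>coxeter_group\<^esub> parabolic J))"

text \<open>The rules up to \<open>rotate_ccw\<close> express planar isotopy; \<open>rotate_cw\<close> bends the leftmost bottom strand
  to the top and the rightmost top strand to the bottom, \<open>rotate_ccw\<close> the other two. The Zamolodzhikov
  relation is imposed for every choice of the cycle.\<close>

inductive diag_rel :: "'a diag \<Rightarrow> 'a diag \<Rightarrow> bool" where
  zigzag_left: "s \<in> S \<Longrightarrow> diag_rel ((Cap s \<star> Ident [s]) \<bullet> (Ident [s] \<star> Cup s)) (Ident [s])"
| zigzag_right: "s \<in> S \<Longrightarrow> diag_rel ((Ident [s] \<star> Cap s) \<bullet> (Cup s \<star> Ident [s])) (Ident [s])"
| rotate_cw: "\<lbrakk>s \<in> S; t \<in> S; s \<noteq> t; m s t = enat k; x = last (alt t s k)\<rbrakk> \<Longrightarrow>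
    diag_rel ((Ident (s # alt t s (k - 1)) \<star> Cap x) \<bullet> (Ident [s] \<star> Vert s t \<star> Ident [x]) \<bullet>
              (Cup s \<star> Ident (alt t s (k - 1) @ [x])))
             (Vert t s)"
| rotate_ccw: "\<lbrakk>s \<in> S; t \<in> S; s \<noteq> t; m s t = enat k; x = last (alt s t k)\<rbrakk> \<Longrightarrow>
    diag_rel ((Cap t \<star> Ident (alt s t (k - 1) @ [x])) \<bullet> (Ident [t] \<star> Vert s t \<star> Ident [x]) \<bullet>
              (Ident (t # alt s t (k - 1)) \<star> Cup x))
             (Vert t s)"
| cap_cup: "s \<in> S \<Longrightarrow> diag_rel (Cap s \<bullet> Cup s) (Ident [])"
| cup_cap: "s \<in> S \<Longrightarrow> diag_rel (Cup s \<bullet> Cap s) (Ident [s, s])"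
| vert_vert: "\<lbrakk>s \<in> S; t \<in> S; s \<noteq> t; m s t = enat k\<rbrakk> \<Longrightarrow>
    diag_rel (Vert t s \<bullet> Vert s t) (Ident (alt s t k))"
| zamolodzhikov: "\<lbrakk>I \<subseteq> S; card I = 3; finite (parabolic I); zam_cycle I u es\<rbrakk> \<Longrightarrow>
    diag_rel (path_diag u es) (Ident u)"

text \<open>The congruence generated by \<open>diag_rel\<close> and the axioms of a strict monoidal category.\<close>

inductive diag_eq :: "'a diag \<Rightarrow> 'a diag \<Rightarrow> bool" where
  rel: "\<lbrakk>diag_rel f g; diag_type f u v; diag_type g u v\<rbrakk> \<Longrightarrow> diag_eq f g"
| refl: "diag_type f u v \<Longrightarrow> diag_eq f f"
| sym: "diag_eq f g \<Longrightarrow> diag_eq g f"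
| trans: "\<lbrakk>diag_eq f g; diag_eq g h\<rbrakk> \<Longrightarrow> diag_eq f h"
| Comp_cong: "\<lbrakk>diag_eq f f'; diag_eq g g'; diag_type f u v; diag_type g v w\<rbrakk>
    \<Longrightarrow> diag_eq (g \<bullet> f) (g' \<bullet> f')"
| Tensor_cong: "\<lbrakk>diag_eq f f'; diag_eq g g'\<rbrakk> \<Longrightarrow> diag_eq (f \<star> g) (f' \<star> g')"
| Comp_Id: "diag_type f u v \<Longrightarrow> diag_eq (f \<bullet> Ident u) f"
| Id_Comp: "diag_type f u v \<Longrightarrow> diag_eq (Ident v \<bullet> f) f"
| Comp_assoc: "\<lbrakk>diag_type f u v; diag_type g v w; diag_type h w x\<rbrakk>
    \<Longrightarrow> diag_eq (h \<bullet> (g \<bullet> f)) ((h \<bullet> g) \<bullet> f)"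
| Tensor_Id: "\<lbrakk>u \<in> lists S; v \<in> lists S\<rbrakk> \<Longrightarrow> diag_eq (Ident u \<star> Ident v) (Ident (u @ v))"
| interchange: "\<lbrakk>diag_type f u v; diag_type g v w; diag_type f' u' v'; diag_type g' v' w'\<rbrakk>
    \<Longrightarrow> diag_eq ((g \<bullet> f) \<star> (g' \<bullet> f')) ((g \<star> g') \<bullet> (f \<star> f'))"
| Unit_Tensor: "diag_type f u v \<Longrightarrow> diag_eq (Ident [] \<star> f) f"
| Tensor_Unit: "diag_type f u v \<Longrightarrow> diag_eq (f \<star> Ident []) f"
| Tensor_assoc: "\<lbrakk>diag_type f u v; diag_type g u' v'; diag_type h u'' v''\<rbrakk>
    \<Longrightarrow> diag_eq ((f \<star> g) \<star> h) (f \<star> (g \<star> h))"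

definition W_diag :: "('a list, 'a diag set) mon_cat" where
  "W_diag = \<lparr> Obj = lists S,
     Hom = (\<lambda>u v. {f. diag_type f u v} // {(f, g). diag_eq f g}),
     Idn = (\<lambda>u. {f. diag_eq (Ident u) f}),
     Cmp = (\<lambda>A B. {h. \<exists>g\<in>A. \<exists>f\<in>B. diag_eq (g \<bullet> f) h}),
     Unit = [],
     TObj = (@),
     TMor = (\<lambda>A B. {h. \<exists>f\<in>A. \<exists>g\<in>B. diag_eq (f \<star> g) h}) \<rparr>"

end

end

theory Submission
  imports Defs Complex_Main
begin

text \<open>Choose for every \<open>w\<close> a reduced word \<open>N w\<close> and for every \<open>w\<close> and \<open>s\<close> a morphism from \<open>N w \<cdot> s\<close> to
  \<open>N (ws)\<close>. Composing them gives a morphism \<open>E w u\<close> from \<open>N w \<cdot> u\<close> to \<open>N (wu)\<close> for every word \<open>u\<close>, and a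
  diagram \<open>f\<close> from \<open>u\<close> to \<open>v\<close> is coherent at \<open>w\<close> if \<open>E w v \<circ> (N w \<otimes> f) = E w u\<close>. As all morphisms are
  invertible, coherence of all diagrams at \<open>w = 1\<close> determines them by source and target, and it
  suffices to treat the generators. Cups and caps hold by the choice of the morphisms for descending steps,
  and rotation reduces the vertices to the case where \<open>w\<close> is minimal in its coset \<open>wW\<^sub>J\<close>. There one
  inducts on the length of the top element \<open>z\<close> of the coset: the morphisms into \<open>N z\<close> are chosen such that
  the vertices involving one fixed descent \<open>r\<close> of \<open>z\<close> are coherent; for two other descents \<open>s\<close>, \<open>t\<close>, the
  parabolic subgroup of \<open>{r, s, t}\<close> is finite, and in a Zamolodzhikov cycle all edges but one are
  already known to be coherent, hence so is the last one.

  Zamolodzhikov cycles are found without classification by sweeping: the Cayley graph of a finite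
  rank 3 Coxeter group is drawn on a sphere, and a path from the identity to the longest element
  that is pushed to the right across faces not crossed before can always be pushed further until all faces
  are crossed.\<close>

text \<open>Three descents \<open>r\<close>, \<open>s\<close>, \<open>t\<close> of \<open>z\<close>
  force finiteness because the component of \<open>z\<close> in that parabolic subgroup then has
  every generator as a descent, and such an element is the longest one. That a cycle crosses each
  coset only once is what leaves a single edge unknown. The sweep contains no topology. Planarity
  enters through the cyclic order of the three labels around a vertex and through a counting
  identity, edge by edge, saying that the moved path differs from the initial one by the boundary of
  the crossed faces; this identity prevents the sweep from getting stuck. The geometric
  representation enters because the presentation alone only bounds the order of \<open>st\<close>
  from above. Were it smaller than \<open>m s t\<close>, the two sides of a vertex would not be
  reduced words and the faces of the Cayley graph would have too few sides.\<close>

text \<open>Groups are written additively: \<open>group_add\<close> is the library's class of possibly non-commutative groups.\<close>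

typedef 'x permutation = "{f :: 'x \<Rightarrow> 'x. bij f}"
  morphisms apply_perm Perm
  by (rule exI[of _ id]) simp

setup_lifting type_definition_permutation

instantiation permutation :: (type) group_add
begin
lift_definition zero_permutation :: "'a permutation" is id by simp
lift_definition plus_permutation :: "'a permutation \<Rightarrow> 'a permutation \<Rightarrow> 'a permutation" is "(\<circ>)"
  by (simp add: bij_comp)
lift_definition uminus_permutation :: "'a permutation \<Rightarrow> 'a permutation" is "inv_into UNIV"
  by (simp add: bij_imp_bij_inv)
definition minus_permutation :: "'a permutation \<Rightarrow> 'a permutation \<Rightarrow> 'a permutation" where
  "minus_permutation a b = a + - b"
instance
  by standard (transfer; simp add: comp_assoc bij_is_inj minus_permutation_def)+
end

section \<open>Alternating words\<close>

lemma length_alt [simp]: "length (alt s t k) = k"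
  by (induction k arbitrary: s t) auto

lemma alt_add: "alt s t (j + k) = alt s t j @ (if even j then alt s t k else alt t s k)"
  by (induction j arbitrary: s t) auto

lemma alt_Suc_snoc: "alt s t (Suc k) = alt s t k @ [if even k then s else t]"
  using alt_add[of s t k 1] by simp

lemma rev_alt: "rev (alt s t k) = (if odd k then alt s t k else alt t s k)"
proof (induction k arbitrary: s t)
  case (Suc k)
  have "rev (alt s t (Suc k)) = (if odd k then alt t s k else alt s t k) @ [s]"
    by (simp add: Suc)
  also have "\<dots> = (if odd (Suc k) then alt s t (Suc k) else alt t s (Suc k))"
    using alt_Suc_snoc[of s t k] alt_Suc_snoc[of t s k] by auto
  finally show ?case .
qed simp

lemma set_alt: "set (alt s t k) \<subseteq> {s, t}"
  by (induction k arbitrary: s t) (use insert_commute in auto)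

lemma nth_alt: "i < k \<Longrightarrow> alt s t k ! i = (if even i then s else t)"
  by (induction k arbitrary: s t i) (auto simp: nth_Cons split: nat.splits)

text \<open>Conjugating a letter by an alternating word is how the reflections of a dihedral group
  arise; they become alternating words of odd length.\<close>

lemma alt_palindrome:
  "alt s t k @ (if even k then s else t) # rev (alt s t k) = alt s t (2 * k + 1)"
proof -
  have "(if even k then s else t) # rev (alt s t k) = rev (alt s t (Suc k))"
    by (simp only: alt_Suc_snoc rev_append) simp
  also have "\<dots> = (if even k then alt s t (Suc k) else alt t s (Suc k))"
    by (simp only: rev_alt) simp
  finally show ?thesis
    using alt_add[of s t k "Suc k"] by (simp add: mult_2)
qed

section \<open>Coxeter groups\<close>

text \<open>Words carry no inverse letters, since \<open>ss = 1\<close> makes each letter its own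
  inverse. Letters range over the whole type, which is why a given \<open>m\<close> is later
  replaced by \<open>mS\<close>.\<close>

inductive cox_eq :: "('a \<Rightarrow> 'a \<Rightarrow> enat) \<Rightarrow> 'a list \<Rightarrow> 'a list \<Rightarrow> bool" for m where
  refl: "cox_eq m u u"
| sym: "cox_eq m u v \<Longrightarrow> cox_eq m v u"
| trans: "\<lbrakk>cox_eq m u v; cox_eq m v w\<rbrakk> \<Longrightarrow> cox_eq m u w"
| cancel: "cox_eq m (u @ [s, s] @ v) (u @ v)"
| braid: "\<lbrakk>s \<noteq> t; m s t = enat k\<rbrakk> \<Longrightarrow> cox_eq m (u @ alt s t k @ v) (u @ alt t s k @ v)"

text \<open>\<open>g\<close> may be any map into an additive group for which products of letters
  coincide exactly when the congruence says so. The type may be larger than the group generated by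
  the letters, hence \<open>W\<close>.\<close>

locale coxeter =
  fixes m :: "'a \<Rightarrow> 'a \<Rightarrow> enat" and g :: "'a \<Rightarrow> 'w::group_add"
  assumes m_sym: "s \<noteq> t \<Longrightarrow> m s t = m t s"
    and m_ge2: "s \<noteq> t \<Longrightarrow> m s t \<ge> 2"
    and pr_iff: "sum_list (map g u) = sum_list (map g v) \<longleftrightarrow> cox_eq m u v"
begin

abbreviation pr :: "'a list \<Rightarrow> 'w" where
  "pr u \<equiv> sum_list (map g u)"

definition W :: "'w set" where
  "W = range pr"

lemma pr_W [simp, intro]: "pr u \<in> W"
  by (simp add: W_def)

lemma g_g [simp]: "g s + g s = 0"
  using cox_eq.cancel[of m "[]" s "[]"] pr_iff[of "[s, s]" "[]"] by simp

lemma g_g_assoc [simp]: "g s + (g s + x) = x"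
  by (simp flip: add.assoc)

lemma uminus_g [simp]: "- g s = g s"
  by (rule minus_unique) simp

lemma pr_rev: "pr (rev u) = - pr u"
  by (induction u) (simp_all add: minus_add del: add_uminus_conv_diff)

lemma pr_braid: "\<lbrakk>s \<noteq> t; m s t = enat k\<rbrakk> \<Longrightarrow> pr (alt s t k) = pr (alt t s k)"
  using cox_eq.braid[of s t m k "[]" "[]"] pr_iff by simp

lemma W_add [simp, intro]: "x \<in> W \<Longrightarrow> y \<in> W \<Longrightarrow> x + y \<in> W"
  by (auto simp: W_def simp flip: sum_list_append map_append)

lemma W_g [simp, intro]: "g s \<in> W"
  using pr_W[of "[s]"] by simp

lemma W_uminus [simp, intro]: "x \<in> W \<Longrightarrow> - x \<in> W"
  by (auto simp: W_def simp flip: pr_rev)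

text \<open>Cancellation and braiding preserve the parity of the number of letters. This is the sign
  character; it ensures that every generator changes \<open>len\<close>.\<close>

lemma pr_eq_parity: "pr u = pr v \<Longrightarrow> even (length u) = even (length v)"
  unfolding pr_iff by (induction rule: cox_eq.induct) auto

subsection \<open>Length, reflections and the exchange condition\<close>

definition len :: "'w \<Rightarrow> nat" where
  "len w = (LEAST n. \<exists>u. pr u = w \<and> length u = n)"

definition red :: "'a list \<Rightarrow> bool" where
  "red u \<longleftrightarrow> length u = len (pr u)"

lemma len_le: "len (pr u) \<le> length u"
  unfolding len_def by (rule Least_le) auto

lemma red_word: assumes "w \<in> W" obtains u where "pr u = w" "red u"
proof -
  from assms obtain v where v: "pr v = w" unfolding W_def by blast
  have "\<exists>u. pr u = w \<and> length u = len w"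
    unfolding len_def by (rule LeastI_ex) (use v in blast)
  then show ?thesis using that by (auto simp: red_def)
qed

lemma len_parity: "even (len (pr u)) = even (length u)"
proof -
  obtain v where "pr v = pr u" "red v" using red_word[of "pr u"] by auto
  then show ?thesis using pr_eq_parity[of v u] by (simp add: red_def)
qed

lemma len_0 [simp]: "len 0 = 0"
  using len_le[of "[]"] by simp

lemma len_eq_0: assumes "w \<in> W" shows "len w = 0 \<longleftrightarrow> w = 0"
proof -
  obtain v where "pr v = w" "red v" using red_word[OF assms] by auto
  then show ?thesis by (auto simp: red_def)
qed

lemma len_add_le: assumes "x \<in> W" "y \<in> W" shows "len (x + y) \<le> len x + len y"
proof -
  obtain u where "pr u = x" "red u" using red_word[OF assms(1)] by blast
  moreover obtain v where "pr v = y" "red v" using red_word[OF assms(2)] by blast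
  ultimately show ?thesis using len_le[of "u @ v"] by (simp add: red_def)
qed

lemma len_add_parity:
  assumes "x \<in> W" "y \<in> W" shows "even (len (x + y)) \<longleftrightarrow> (even (len x) \<longleftrightarrow> even (len y))"
proof -
  obtain u v where "pr u = x" "pr v = y"
    using assms unfolding W_def by blast
  then show ?thesis using len_parity[of "u @ v"] len_parity[of u] len_parity[of v] by auto
qed

lemma len_g [simp]: "len (g s) = 1"
  using len_parity[of "[s]"] len_le[of "[s]"] by (cases "len (g s)") auto

lemma len_uminus: assumes "w \<in> W" shows "len (- w) = len w"
proof -
  have le: "len (- x) \<le> len x" if x: "x \<in> W" for x
  proof -
    obtain u where "pr u = x" "red u" using red_word[OF x] by auto
    then show ?thesis using len_le[of "rev u"] by (simp add: red_def pr_rev)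
  qed
  show ?thesis using le[of w] le[of "- w"] assms by simp
qed

lemma len_g_parity [simp]: "w \<in> W \<Longrightarrow> even (len (w + g s)) \<longleftrightarrow> odd (len w)"
  by (simp add: len_add_parity)

lemma len_add_g:
  assumes "w \<in> W" shows "len (w + g s) = Suc (len w) \<or> len w = Suc (len (w + g s))"
proof -
  have "len (w + g s) \<le> len w + 1" using len_add_le[OF assms W_g] by simp
  moreover have "len ((w + g s) + g s) \<le> len (w + g s) + 1"
    using len_add_le[of "w + g s" "g s"] assms by auto
  moreover have "len (w + g s) \<noteq> len w" using len_g_parity[OF assms, of s] by auto
  ultimately show ?thesis by (simp add: add.assoc) linarith
qed

lemma red_append: "red (u @ v) \<Longrightarrow> red u \<and> red v"
  using len_le[of u] len_le[of v] len_add_le[of "pr u" "pr v"] by (auto simp: red_def)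

lemma red_snoc: "red (u @ [s]) \<longleftrightarrow> red u \<and> len (pr u) < len (pr u + g s)"
  using len_add_g[of "pr u" s] red_append[of u "[s]"] by (auto simp: red_def)

lemma red_rev: "red (rev u) \<longleftrightarrow> red u"
  by (simp add: red_def pr_rev len_uminus)

text \<open>The inversion sequence: each letter is conjugated by the part of the word to its right.
  Multiplying \<open>pr u\<close> on the right by an entry deletes the corresponding letter, see
  \<open>pr_delete\<close>.\<close>

fun rr :: "'a list \<Rightarrow> 'w list" where
  "rr [] = []"
| "rr (s # u) = (- pr u + g s + pr u) # rr u"

lemma rr_append: "rr (u @ v) = map (\<lambda>x. - pr v + x + pr v) (rr u) @ rr v"
  by (induction u) (simp_all add: add.assoc minus_add del: add_uminus_conv_diff)

lemma length_rr [simp]: "length (rr u) = length u"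
  by (induction u) auto

lemma in_rr: "x \<in> set (rr u) \<longleftrightarrow> (\<exists>a s b. u = a @ s # b \<and> x = - pr b + g s + pr b)"
proof (induction u)
  case (Cons t u)
  show ?case
  proof
    assume "x \<in> set (rr (t # u))"
    then consider "x = - pr u + g t + pr u" | "x \<in> set (rr u)" by auto
    then show "\<exists>a s b. t # u = a @ s # b \<and> x = - pr b + g s + pr b"
    proof cases
      case 1 then show ?thesis by blast
    next
      case 2
      then obtain a s b where "u = a @ s # b" "x = - pr b + g s + pr b" using Cons by blast
      then have "t # u = (t # a) @ s # b \<and> x = - pr b + g s + pr b" by simp
      then show ?thesis by blast
    qed
  next
    assume "\<exists>a s b. t # u = a @ s # b \<and> x = - pr b + g s + pr b"
    then obtain a s b where *: "t # u = a @ s # b" "x = - pr b + g s + pr b" by blast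
    then show "x \<in> set (rr (t # u))"
      using Cons by (cases a) auto
  qed
qed simp

lemma pr_delete: "pr (a @ s # b) + (- pr b + g s + pr b) = pr (a @ b)"
proof -
  have "pr b + (- pr b + (g s + pr b)) = g s + pr b" by (simp flip: add.assoc)
  then show ?thesis by (simp add: add.assoc)
qed

text \<open>If a reflection occurred twice, deleting both letters concerned would leave the product
  unchanged and shorten the word.\<close>

lemma red_distinct_rr: "red u \<Longrightarrow> distinct (rr u)"
proof (induction u)
  case (Cons s u)
  have "red u" using Cons.prems red_append[of "[s]" u] by simp
  moreover have "- pr u + g s + pr u \<notin> set (rr u)"
  proof
    assume "- pr u + g s + pr u \<in> set (rr u)"
    then obtain a t b where u: "u = a @ t # b" and x: "- pr u + g s + pr u = - pr b + g t + pr b"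
      unfolding in_rr by blast
    define y where "y = - pr u + g s + pr u"
    have "pr (s # u) + y = pr u"
      using pr_delete[of "[]" s u] by (simp add: y_def)
    then have "pr (s # u) = pr u + - y"
      by (simp add: eq_diff_eq)
    also have "- y = y"
      by (simp add: y_def minus_add add.assoc del: add_uminus_conv_diff)
    finally have "pr (s # u) = pr (a @ b)"
      using pr_delete[of a t b] u x by (simp add: y_def)
    then have "len (pr (s # u)) \<le> length (a @ b)" using len_le[of "a @ b"] by simp
    then show False using Cons.prems u by (simp add: red_def)
  qed
  ultimately show ?case using Cons.IH by simp
qed simp

text \<open>The parity with which a reflection occurs in \<open>rr u\<close> depends only on the element represented by \<open>u\<close>;
  this gives the exchange condition.\<close>

definition odd_refl :: "'a list \<Rightarrow> 'w \<Rightarrow> bool" where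
  "odd_refl u x \<longleftrightarrow> odd (count_list (rr u) x)"

lemma count_list_distinct: "distinct xs \<Longrightarrow> count_list xs x = of_bool (x \<in> set xs)"
  by (induction xs) auto

lemma count_map_conj:
  fixes c :: 'w
  shows "count_list (map (\<lambda>x. - c + x + c) xs) x = count_list xs (c + x + - c)"
proof (induction xs)
  case (Cons y xs)
  have "- c + y + c = x \<longleftrightarrow> y = c + x + - c"
  proof
    assume h: "- c + y + c = x"
    show "y = c + x + - c"
      unfolding h[symmetric] by (simp add: add.assoc add.right_inverse del: add_uminus_conv_diff)
  next
    assume h: "y = c + x + - c"
    show "- c + y + c = x"
      unfolding h by (simp add: add.assoc del: add_uminus_conv_diff)
  qed
  then show ?case using Cons by auto
qed simp

lemma odd_refl_context:
  assumes "pr l = pr r" "\<And>x. odd_refl l x = odd_refl r x"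
  shows "odd_refl (a @ l @ b) x = odd_refl (a @ r @ b) x"
  using assms by (simp add: odd_refl_def rr_append count_map_conj)

lemma rr_rev_alt: "rr (rev (alt s t k)) = rev (map (\<lambda>i. pr (alt s t (2 * i + 1))) [0..<k])"
proof (induction k)
  case (Suc k)
  have "- pr (rev (alt s t k)) + g (if even k then s else t) + pr (rev (alt s t k)) = pr (alt s t (2 * k + 1))"
    unfolding pr_rev minus_minus alt_palindrome[symmetric]
    by (simp add: pr_rev add.assoc del: add_uminus_conv_diff)
  moreover have "rev (alt s t (Suc k)) = (if even k then s else t) # rev (alt s t k)"
    by (simp only: alt_Suc_snoc rev_append) simp
  ultimately show ?case using Suc by (simp del: alt.simps)
qed simp

text \<open>An alternating word of odd length is a palindrome, hence an involution, and can be moved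
  to the other side of the equation unchanged.\<close>

lemma pr_alt_odd: assumes "pr (alt s t (j + k)) = 0" "odd j" "odd k"
  shows "pr (alt s t j) = pr (alt t s k)"
proof -
  have "pr (alt s t j) + pr (alt t s k) = 0" using assms by (simp add: alt_add)
  then have "pr (alt s t j) = - pr (alt t s k)" by (simp add: eq_neg_iff_add_eq_0)
  also have "\<dots> = pr (alt t s k)"
    using assms(3) pr_rev[of "alt t s k"] by (simp add: rev_alt)
  finally show ?thesis .
qed

lemma pr_alt_double: "pr (alt s t (2 * k)) = 0 \<longleftrightarrow> pr (alt s t k) = pr (alt t s k)"
proof -
  have "pr (alt s t (2 * k)) = pr (alt s t k) + pr (if even k then alt s t k else alt t s k)"
    using alt_add[of s t k k] by (simp add: mult_2)
  also have "(if even k then alt s t k else alt t s k) = rev (alt t s k)"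
    by (simp add: rev_alt)
  also have "pr \<dots> = - pr (alt t s k)" by (rule pr_rev)
  finally show ?thesis by simp
qed

text \<open>For a cancellation the two equal letters contribute the same reflection twice. For a
  braid relation the two sides list the same reflections in opposite orders.\<close>

lemma odd_refl_cong: "cox_eq m u v \<Longrightarrow> odd_refl u x = odd_refl v x"
proof (induction arbitrary: x rule: cox_eq.induct)
  case (cancel u s v)
  show ?case
    using odd_refl_context[of "[s, s]" "[]" u v x] by (auto simp: odd_refl_def add.assoc)
next
  case (braid s t k u v)
  have *: "count_list (rr (rev (alt s t k))) x = count_list (rr (rev (alt t s k))) x" for x
  proof -
    have z: "pr (alt s t (2 * k)) = 0" using pr_alt_double pr_braid braid by blast
    have "map (\<lambda>i. pr (alt s t (2 * i + 1))) [0..<k] = rev (map (\<lambda>i. pr (alt t s (2 * i + 1))) [0..<k])"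
    proof (rule nth_equalityI)
      fix i assume "i < length (map (\<lambda>i. pr (alt s t (2 * i + 1))) [0..<k])"
      then have i: "i < k" by simp
      \<comment> \<open>Entries are matched by complementary odd lengths: together they spell the
        alternating word of length \<open>2 * k\<close>, which is trivial.\<close>
      then have "2 * k = (2 * i + 1) + (2 * (k - Suc i) + 1)" by simp
      then have "pr (alt s t (2 * i + 1)) = pr (alt t s (2 * (k - Suc i) + 1))"
        using z by (intro pr_alt_odd) simp_all
      then show "map (\<lambda>i. pr (alt s t (2 * i + 1))) [0..<k] ! i
        = rev (map (\<lambda>i. pr (alt t s (2 * i + 1))) [0..<k]) ! i"
        using i by (simp add: rev_nth)
    qed simp
    then show ?thesis by (simp only: rr_rev_alt count_list_rev)
  qed
  have c: "odd_refl (rev (alt s t k)) x = odd_refl (rev (alt t s k)) x" for x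
    using * by (simp add: odd_refl_def)
  have "odd_refl (alt s t k) x = odd_refl (alt t s k) x" for x
    using c[of x] by (auto simp: rev_alt split: if_splits)
  then show ?case using pr_braid[OF braid] by (intro odd_refl_context) auto
qed auto

lemma red_odd_refl: "red u \<Longrightarrow> odd_refl u x \<longleftrightarrow> x \<in> set (rr u)"
  using red_distinct_rr[of u] by (auto simp: odd_refl_def count_list_distinct)

text \<open>The set of reflections occurring an odd number of times depends only on the element. A
  word without repetitions has as many of them as letters, and so does a reduced word for the same
  element, so the two have equal length.\<close>

lemma distinct_rr_red: assumes "distinct (rr u)" shows "red u"
proof -
  obtain v where v: "pr v = pr u" "red v" using red_word[of "pr u"] by auto
  have "set (rr u) = set (rr v)"
    using odd_refl_cong[of v u] v pr_iff assms red_odd_refl[OF v(2)]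
    by (auto simp: odd_refl_def count_list_distinct set_eq_iff)
  then have "length u = length v"
    using distinct_card[OF assms] distinct_card[OF red_distinct_rr[OF v(2)]] by simp
  then show ?thesis using v by (simp add: red_def)
qed

text \<open>A reduced word for \<open>pr u + g s\<close>, followed by \<open>s\<close>, is a reduced
  word for \<open>pr u\<close> whose last reflection is \<open>g s\<close>. By invariance
  \<open>g s\<close> also occurs in \<open>rr u\<close>, and its position there is the letter to
  delete.\<close>

lemma exchange:
  assumes "red u" "len (pr u + g s) < len (pr u)"
  obtains a t b where "u = a @ t # b" "pr u + g s = pr (a @ b)"
proof -
  obtain v where v: "pr v = pr u + g s" "red v" using red_word[of "pr u + g s"] by auto
  have p: "pr (v @ [s]) = pr u" using v by (simp add: add.assoc)
  then have "red (v @ [s])" using v assms(2) by (simp add: red_snoc add.assoc)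
  then have "odd_refl (v @ [s]) (g s)" by (simp add: red_odd_refl rr_append)
  then have "g s \<in> set (rr u)"
    using odd_refl_cong p pr_iff red_odd_refl[OF assms(1)] by blast
  then obtain a t b where "u = a @ t # b" "g s = - pr b + g t + pr b"
    unfolding in_rr by blast
  then show ?thesis using that[of a t b] pr_delete[of a t b] by simp
qed

subsection \<open>Parabolic subgroups\<close>

definition WP :: "'a set \<Rightarrow> 'w set" where
  "WP J = pr ` lists J"

lemma WP_pr [intro]: "u \<in> lists J \<Longrightarrow> pr u \<in> WP J"
  by (simp add: WP_def)

lemma WP_0 [simp, intro]: "0 \<in> WP J"
  using WP_pr[of "[]" J] by simp

lemma WP_g [intro]: "s \<in> J \<Longrightarrow> g s \<in> WP J"
  using WP_pr[of "[s]" J] by simp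

lemma WP_add [intro]: assumes "x \<in> WP J" "y \<in> WP J" shows "x + y \<in> WP J"
proof -
  obtain u v where "u \<in> lists J" "v \<in> lists J" "x = pr u" "y = pr v"
    using assms unfolding WP_def by blast
  then show ?thesis using WP_pr[of "u @ v" J] by simp
qed

lemma WP_uminus [intro]: assumes "x \<in> WP J" shows "- x \<in> WP J"
proof -
  obtain u where "u \<in> lists J" "x = pr u"
    using assms unfolding WP_def by blast
  then show ?thesis using WP_pr[of "rev u" J] by (simp add: pr_rev in_lists_conv_set)
qed

lemma WP_W [intro]: "x \<in> WP J \<Longrightarrow> x \<in> W"
  unfolding WP_def W_def by blast

lemma WP_mono: "J \<subseteq> K \<Longrightarrow> x \<in> WP J \<Longrightarrow> x \<in> WP K"
  unfolding WP_def by blast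

text \<open>Shortening by exchange only deletes letters, so it never leaves the alphabet
  \<open>J\<close>.\<close>

lemma WP_red: assumes "x \<in> WP J" obtains u where "u \<in> lists J" "red u" "pr u = x"
proof -
  have "\<exists>u \<in> lists J. red u \<and> pr u = pr v" if "v \<in> lists J" for v
    using that
  proof (induction v rule: rev_induct)
    case Nil
    then show ?case by (intro bexI[of _ "[]"]) (simp_all add: red_def)
  next
    case (snoc s v)
    then obtain u where u: "u \<in> lists J" "red u" "pr u = pr v" by auto
    show ?case
    proof (cases "red (u @ [s])")
      case True
      then show ?thesis using u snoc.prems by (intro bexI[of _ "u @ [s]"]) auto
    next
      case False
      then have l: "len (pr u) = Suc (len (pr u + g s))"
        using len_add_g[of "pr u" s] u by (simp add: red_snoc)
      then obtain a t b where ab: "u = a @ t # b" "pr u + g s = pr (a @ b)"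
        using exchange[OF u(2), of s] by auto
      then have "red (a @ b)" using l u(2) by (simp add: red_def)
      moreover have "pr (a @ b) = pr (v @ [s])" using ab(2) u(3) by simp
      moreover have "a @ b \<in> lists J" using u(1) ab(1) by simp
      ultimately show ?thesis by blast
    qed
  qed
  then show ?thesis using assms that unfolding WP_def by blast
qed

definition is_min :: "'a set \<Rightarrow> 'w \<Rightarrow> bool" where
  "is_min J y \<longleftrightarrow> y \<in> W \<and> (\<forall>s\<in>J. len y < len (y + g s))"

lemma append_eq_append_Cons:
  assumes "u @ v = a @ t # b"
  obtains (left) c where "u = a @ t # c" "b = c @ v" | (right) c where "v = c @ t # b" "a = u @ c"
proof -
  from assms obtain us where "u = a @ us \<and> us @ v = t # b \<or> u @ us = a \<and> v = us @ t # b"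
    by (auto simp: append_eq_append_conv2)
  then show ?thesis
  proof
    assume h: "u = a @ us \<and> us @ v = t # b"
    then show ?thesis using left[of "tl us"] right[of "[]"] by (cases us) auto
  next
    assume "u @ us = a \<and> v = us @ t # b"
    then show ?thesis using right[of us] by auto
  qed
qed

lemma red_delete: assumes "red (v @ [s])" "v = c @ t # b" shows "pr v + g s \<noteq> pr (c @ b)"
proof
  assume "pr v + g s = pr (c @ b)"
  then have "len (pr (v @ [s])) \<le> length (c @ b)" using len_le[of "c @ b"] by simp
  then show False using assms by (simp add: red_def)
qed

text \<open>If appending \<open>s\<close> destroyed reducedness, exchange would delete a letter. A
  letter of \<open>v\<close> contradicts that \<open>v @ [s]\<close> is reduced; a letter of
  \<open>u\<close> produces a shorter element of the same coset.\<close>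

lemma coset_least_red:
  assumes least: "\<And>x. x \<in> WP J \<Longrightarrow> len (pr u) \<le> len (pr u + x)" and u: "red u"
    and "v \<in> lists J" "red v"
  shows "red (u @ v)"
  using assms(3,4)
proof (induction v rule: rev_induct)
  case (snoc s v)
  then have IH: "red (u @ v)" using red_append[of v "[s]"] by simp
  show ?case
  proof (rule ccontr)
    assume "\<not> ?case"
    then have "len (pr (u @ v) + g s) < len (pr (u @ v))"
      using IH red_snoc[of "u @ v" s] len_add_g[of "pr (u @ v)" s] by auto
    then obtain a t b where ab: "u @ v = a @ t # b" "pr (u @ v) + g s = pr (a @ b)"
      using exchange[OF IH] by blast
    from ab(1) show False
    proof (cases rule: append_eq_append_Cons)
      case (right c)
      then show False using ab(2) red_delete[OF snoc.prems(2) right(1)] by (simp add: add.assoc)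
    next
      case (left c)
      have "pr u + pr v + g s = pr (a @ c) + pr v" using ab(2) left by (simp add: add.assoc)
      then have "pr u + pr (v @ [s] @ rev v) = pr (a @ c)"
        unfolding map_append sum_list_append pr_rev
        by (simp add: add.assoc[symmetric] del: add_uminus_conv_diff)
           (simp add: add.assoc add.right_inverse del: add_uminus_conv_diff)
      moreover have "pr (v @ [s] @ rev v) \<in> WP J"
        using snoc.prems by (intro WP_pr) (auto simp: in_lists_conv_set)
      ultimately have "len (pr u) \<le> length (a @ c)"
        using least[of "pr (v @ [s] @ rev v)"] len_le[of "a @ c"] by simp
      then show False using u left by (simp add: red_def)
    qed
  qed
qed (use u in simp)

lemma ex_coset_least:
  obtains x0 where "x0 \<in> WP J" "\<And>x. x \<in> WP J \<Longrightarrow> len (w + x0) \<le> len (w + x0 + x)"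
proof -
  obtain x0 where x0: "x0 \<in> WP J" "\<And>x. x \<in> WP J \<Longrightarrow> len (w + x0) \<le> len (w + x)"
    using ex_has_least_nat[of "\<lambda>x. x \<in> WP J" 0 "\<lambda>x. len (w + x)"] by auto
  then show ?thesis using that[of x0] by (metis WP_add add.assoc)
qed

text \<open>\<open>is_min\<close> is a local condition, tested on single letters. Compare
  \<open>y\<close> with an element of globally least length in its coset, from which lengths add:
  were it different from \<open>y\<close>, the last letter of the reduced word leading from it to
  \<open>y\<close> would be a descent of \<open>y\<close> in \<open>J\<close>.\<close>

lemma min_add: assumes "is_min J y" "x \<in> WP J" shows "len (y + x) = len y + len x"
proof -
  obtain x0 where x0: "x0 \<in> WP J" "\<And>x. x \<in> WP J \<Longrightarrow> len (y + x0) \<le> len (y + x0 + x)"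
    using ex_coset_least by blast
  have "y + x0 \<in> W" using assms x0(1) by (auto simp: is_min_def)
  then obtain u where u: "pr u = y + x0" "red u" using red_word by blast
  have r: "red (u @ v)" if "v \<in> lists J" "red v" for v
    using coset_least_red[of J u v] that u x0(2) by simp
  have "x0 = 0"
  proof (rule ccontr)
    assume n: "x0 \<noteq> 0"
    obtain v where v: "v \<in> lists J" "red v" "pr v = - x0" using WP_red[OF WP_uminus[OF x0(1)]] by blast
    then have "v \<noteq> []" using n by auto
    then obtain v' s where v': "v = v' @ [s]" by (metis rev_exhaust)
    have y: "pr (u @ v) = y" using u v by (simp add: add.assoc add.right_inverse del: add_uminus_conv_diff)
    have "red (u @ v' @ [s])" using r v v' by simp
    then have "len (pr (u @ v')) < len (pr (u @ v') + g s)" using red_snoc[of "u @ v'" s] by simp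
    moreover have "pr (u @ v') + g s = y" using y v' by (simp add: add.assoc)
    moreover have "pr (u @ v') = y + g s" using y v' by (auto simp: add.assoc)
    moreover have "s \<in> J" using v v' by simp
    ultimately show False using assms(1) by (simp add: is_min_def) (meson less_asym)
  qed
  moreover obtain v where v: "v \<in> lists J" "red v" "pr v = x" using WP_red[OF assms(2)] by blast
  ultimately show ?thesis using r[of v] u by (simp add: red_def)
qed

lemma min_decomp:
  assumes "w \<in> W" obtains y x where "is_min J y" "x \<in> WP J" "w = y + x"
proof -
  obtain x0 where x0: "x0 \<in> WP J" "\<And>x. x \<in> WP J \<Longrightarrow> len (w + x0) \<le> len (w + x0 + x)"
    using ex_coset_least by blast
  have W: "w + x0 \<in> W" using assms x0 by auto
  have "is_min J (w + x0)"
    unfolding is_min_def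
  proof (intro conjI ballI)
    fix s assume "s \<in> J"
    then have "len (w + x0) \<le> len (w + x0 + g s)" using x0(2) by auto
    then show "len (w + x0) < len (w + x0 + g s)" using len_add_g[OF W, of s] by auto
  qed (use W in simp)
  then show ?thesis
    using that[of "w + x0" "- x0"] x0(1)
    by (auto simp: add.assoc add.right_inverse simp del: add_uminus_conv_diff)
qed

text \<open>Each of two minimal elements of one coset exceeds the other in length by the length of
  their difference, which is therefore trivial.\<close>

lemma min_unique:
  assumes "is_min J y" "is_min J y'" "x \<in> WP J" "x' \<in> WP J" "y + x = y' + x'"
  shows "y = y' \<and> x = x'"
proof -
  have z: "x + - x' \<in> WP J" using assms by (intro WP_add WP_uminus)
  have "y' = y + x + - x'" using assms(5) by (simp add: add.assoc add.right_inverse del: add_uminus_conv_diff)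
  then have y': "y' = y + (x + - x')" by (simp only: add.assoc)
  then have y: "y = y' + - (x + - x')" by (simp add: add.assoc add.right_inverse del: add_uminus_conv_diff)
  have "len y' = len y + len (x + - x')" using y' min_add[OF assms(1) z] by metis
  moreover have "len y = len y' + len (- (x + - x'))" using y min_add[OF assms(2) WP_uminus[OF z]] by metis
  ultimately have "len (x + - x') = 0" by simp
  then have "x + - x' = 0" using len_eq_0 WP_W[OF z] by blast
  then show ?thesis using y' by simp
qed

lemma min_desc_iff:
  assumes "is_min J y" "x \<in> WP J" "s \<in> J"
  shows "len (y + x + g s) < len (y + x) \<longleftrightarrow> len (x + g s) < len x"
  using min_add[OF assms(1) WP_add[OF assms(2) WP_g[OF assms(3)]]] min_add[OF assms(1,2)]
  by (simp add: add.assoc)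

lemma min_asc_iff:
  assumes "is_min J y" "x \<in> WP J" "s \<in> J"
  shows "len (y + x) < len (y + x + g s) \<longleftrightarrow> len x < len (x + g s)"
  using min_add[OF assms(1) WP_add[OF assms(2) WP_g[OF assms(3)]]] min_add[OF assms(1,2)]
  by (simp add: add.assoc)

text \<open>The word \<open>v\<close> is built up at the right end of a reduced word for
  \<open>x\<close>. As each letter of \<open>J\<close> is a descent of \<open>x\<close>, exchange
  appends the next letter of \<open>v\<close> and pays for it with a letter of the remaining prefix
  \<open>u\<close>; a letter of \<open>v\<close> itself cannot be lost because \<open>v\<close>
  stays reduced.\<close>

lemma longest_suffix:
  assumes x: "x \<in> WP J" "\<And>s. s \<in> J \<Longrightarrow> len (x + g s) < len x" and "v \<in> lists J" "red v"
  shows "\<exists>u. red (u @ v) \<and> pr (u @ v) = x"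
  using assms(3,4)
proof (induction v rule: rev_induct)
  case Nil
  then show ?case using red_word[of x] x(1) by (metis WP_W append_Nil2)
next
  case (snoc s v)
  then obtain u where u: "red (u @ v)" "pr (u @ v) = x"
    using red_append[of v "[s]"] by auto
  have "len (pr (u @ v) + g s) < len (pr (u @ v))"
    unfolding u(2) using x(2) snoc.prems by simp
  then obtain a t b where ab: "u @ v = a @ t # b" "x + g s = pr (a @ b)"
    using exchange[OF u(1)] unfolding u(2) by blast
  from ab(1) show ?case
  proof (cases rule: append_eq_append_Cons)
    case (right c)
    then show ?thesis
      using ab(2) u(2) red_delete[OF snoc.prems(2) right(1)] by (auto simp: add.assoc)
  next
    case (left c)
    have "x = pr (a @ b) + g s" using ab(2) by (metis add.assoc g_g add.right_neutral)
    then have p: "pr ((a @ c) @ v @ [s]) = x" using left by (simp add: add.assoc)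
    moreover have "red ((a @ c) @ v @ [s])"
      using u left p by (simp add: red_def)
    ultimately show ?thesis by blast
  qed
qed

lemma longest_max:
  assumes "x \<in> WP J" "\<And>s. s \<in> J \<Longrightarrow> len (x + g s) < len x" "z \<in> WP J"
  shows "len z \<le> len x" "len z = len x \<Longrightarrow> z = x"
proof -
  obtain v where v: "v \<in> lists J" "red v" "pr v = z" using WP_red[OF assms(3)] by blast
  then obtain u where u: "red (u @ v)" "pr (u @ v) = x" using longest_suffix assms by blast
  then have "len x = length u + len z" using v by (simp add: red_def)
  then show "len z \<le> len x" "len z = len x \<Longrightarrow> z = x" using u v by auto
qed

lemma longest_finite:
  assumes "x \<in> WP J" "\<And>s. s \<in> J \<Longrightarrow> len (x + g s) < len x" "finite J"
  shows "finite (WP J)"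
proof (rule finite_subset)
  show "WP J \<subseteq> pr ` {u. set u \<subseteq> J \<and> length u \<le> len x}"
  proof
    fix z assume z: "z \<in> WP J"
    then obtain v where "v \<in> lists J" "red v" "pr v = z" using WP_red by blast
    then show "z \<in> pr ` {u. set u \<subseteq> J \<and> length u \<le> len x}"
      using longest_max(1)[OF assms(1,2) z] by (auto simp: red_def in_lists_conv_set)
  qed
  show "finite (pr ` {u. set u \<subseteq> J \<and> length u \<le> len x})"
    using assms(3) by (intro finite_imageI finite_lists_length_le)
qed

subsection \<open>The geometric representation\<close>

text \<open>\<open>act\<close> is the contragredient of the geometric representation: \<open>f x\<close> is the value of a linear form at the
  simple root of \<open>x\<close>. It is only needed to see that \<open>st\<close> has order exactly \<open>m s t\<close>.\<close>

definition cth :: "'a \<Rightarrow> 'a \<Rightarrow> real" where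
  "cth s t = (case m s t of enat k \<Rightarrow> cos (pi / k) | \<infinity> \<Rightarrow> 1)"

text \<open>Twice the standard symmetric bilinear form evaluated at the simple roots of
  \<open>s\<close> and \<open>x\<close>; \<open>act\<close> subtracts the multiple of it that
  reflects a linear form.\<close>

definition bt :: "'a \<Rightarrow> 'a \<Rightarrow> real" where
  "bt s x = (if x = s then 2 else - 2 * cth s x)"

primrec act :: "'a list \<Rightarrow> ('a \<Rightarrow> real) \<Rightarrow> 'a \<Rightarrow> real" where
  "act [] f = f"
| "act (s # u) f = act u (\<lambda>x. f x - bt s x * f s)"

lemma act_append: "act (u @ v) f = act v (act u f)"
  by (induction u arbitrary: f) auto

lemma cth_sym: "s \<noteq> t \<Longrightarrow> cth s t = cth t s"
  using m_sym[of s t] by (simp add: cth_def)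

text \<open>A reflection replaces the older of the two coefficients by the next term of a three-term
  recurrence, while the part \<open>f0\<close> that vanishes on both roots stays fixed.\<close>

lemma act_alt_plane:
  assumes "s \<noteq> t" "f0 s = 0" "f0 t = 0" "\<And>i. D (Suc (Suc i)) = 2 * cth s t * D (Suc i) - D i"
  shows "act (alt s t k) (\<lambda>x. f0 x + D 0 * bt s x + D 1 * bt t x) =
    (\<lambda>x. f0 x + (if even k then D k * bt s x + D (Suc k) * bt t x else D (Suc k) * bt s x + D k * bt t x))"
proof (induction k)
  case (Suc k)
  have c: "bt s s = 2" "bt t t = 2" "bt s t = - 2 * cth s t" "bt t s = - 2 * cth s t"
    using assms(1) cth_sym[OF assms(1)] by (auto simp: bt_def)
  show ?case
    unfolding alt_Suc_snoc act_append Suc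
    by (auto simp: assms(2-4) c fun_eq_iff algebra_simps)
qed auto

text \<open>Both alternating words walk along the same solution \<open>E\<close> of the recurrence,
  one upwards and one downwards. Since \<open>E\<close> has period \<open>2k\<close>, they meet
  after \<open>k\<close> steps.\<close>

lemma act_braid: assumes "s \<noteq> t" "m s t = enat k" shows "act (alt s t k) f = act (alt t s k) f"
proof -
  define \<theta> where "\<theta> = pi / k"
  have k: "k \<ge> 2" using m_ge2[OF assms(1)] assms(2) by (simp add: numeral_eq_enat)
  then have "0 < \<theta>" "\<theta> < pi" by (auto simp: \<theta>_def field_simps)
  then have sn: "sin \<theta> > 0" by (simp add: sin_gt_zero)
  define c where "c = cth s t"
  have c: "c = cos \<theta>" by (simp add: c_def cth_def assms(2) \<theta>_def)
  define d where "d = 1 - c\<^sup>2"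
  have d: "d \<noteq> 0" using sn sin_squared_eq[of \<theta>] c by (auto simp: d_def)
  \<comment> \<open>\<open>p\<close> and \<open>q\<close> solve the linear system saying that
    \<open>f0\<close> below vanishes at \<open>s\<close> and \<open>t\<close>; its determinant is a
    multiple of \<open>d\<close>, the square of the sine. \<open>E\<close> is then the solution of
    the recurrence with initial values \<open>p\<close> and \<open>q\<close>.\<close>
  define p where "p = (f s + c * f t) / (2 * d)"
  define q where "q = (f t + c * f s) / (2 * d)"
  have pq: "f s = 2 * p - 2 * c * q" "f t = 2 * q - 2 * c * p"
    using d by (simp_all add: p_def q_def field_simps) (simp_all add: d_def algebra_simps power2_eq_square)
  define E where "E x = (q * sin (x * \<theta>) - p * sin ((x - 1) * \<theta>)) / sin \<theta>" for x
  have rec: "E (x + 1) + E (x - 1) = 2 * c * E x" for x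
  proof -
    define y z where "y = x * \<theta>" and "z = (x - 1) * \<theta>"
    have *: "(x + 1) * \<theta> = y + \<theta>" "(x - 1) * \<theta> = y - \<theta>" "(x + 1 - 1) * \<theta> = z + \<theta>"
      "(x - 1 - 1) * \<theta> = z - \<theta>"
      by (simp_all add: y_def z_def algebra_simps)
    have e: "E (x + 1) = (q * sin (y + \<theta>) - p * sin (z + \<theta>)) / sin \<theta>"
      "E (x - 1) = (q * sin (y - \<theta>) - p * sin (z - \<theta>)) / sin \<theta>"
      by (simp_all only: E_def *)
    have e': "E x = (q * sin y - p * sin z) / sin \<theta>"
      by (simp only: E_def y_def z_def)
    have s: "sin \<theta> \<noteq> 0" using sn by simp
    show ?thesis
      unfolding e unfolding e' sin_add sin_diff c using s by (simp add: field_simps)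
  qed
  have E01: "E 0 = p" "E 1 = q" using sn by (simp_all add: E_def)
  have per: "E (x + 2 * k) = E x" for x :: real
  proof -
    have "(x + 2 * k) * \<theta> = x * \<theta> + 2 * pi" "(x + 2 * k - 1) * \<theta> = (x - 1) * \<theta> + 2 * pi"
      using k by (simp_all add: \<theta>_def field_simps)
    then show ?thesis by (simp only: E_def sin_periodic)
  qed
  define f0 where "f0 x = f x - p * bt s x - q * bt t x" for x
  have f0: "f0 s = 0" "f0 t = 0"
    using assms(1) cth_sym[OF assms(1)] pq by (simp_all add: f0_def bt_def flip: c_def)
  have f: "f = (\<lambda>x. f0 x + E 0 * bt s x + E 1 * bt t x)"
    "f = (\<lambda>x. f0 x + E 1 * bt t x + E 0 * bt s x)"
    by (simp_all add: fun_eq_iff f0_def E01)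
  define D where "D i = E (real i)" for i
  define D' where "D' i = E (1 - real i)" for i
  have D: "D (Suc (Suc i)) = 2 * cth s t * D (Suc i) - D i" for i
    using rec[of "real i + 1"] by (simp add: D_def c_def algebra_simps)
  have D': "D' (Suc (Suc i)) = 2 * cth t s * D' (Suc i) - D' i" for i
    using rec[of "- real i"] cth_sym[OF assms(1)] diff_minus_eq_add[of "- real i" 1]
    by (simp add: D'_def c_def minus_diff_commute algebra_simps)
  have "D k = D' (Suc k)" "D (Suc k) = D' k"
    using per[of "- real k"] per[of "1 - real k"] by (simp_all add: D_def D'_def add.commute)
  moreover have "act (alt s t k) f =
    (\<lambda>x. f0 x + (if even k then D k * bt s x + D (Suc k) * bt t x else D (Suc k) * bt s x + D k * bt t x))"
    using act_alt_plane[of s t f0 D k] assms f0 D f(1) by (simp add: D_def)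
  moreover have "act (alt t s k) f =
    (\<lambda>x. f0 x + (if even k then D' k * bt t x + D' (Suc k) * bt s x else D' (Suc k) * bt t x + D' k * bt s x))"
    using act_alt_plane[of t s f0 D' k] assms f0 D' f(2) by (simp add: D'_def)
  ultimately show ?thesis by (auto simp: fun_eq_iff)
qed

lemma act_cong: assumes "pr u = pr v" shows "act u f = act v f"
proof -
  from assms have "cox_eq m u v" by (simp add: pr_iff)
  then show ?thesis
  proof (induction arbitrary: f rule: cox_eq.induct)
    case (cancel u s v)
    have "act [s, s] h = h" for h by (auto simp: fun_eq_iff bt_def)
    then show ?case by (metis act_append)
  next
    case (braid s t k u v)
    show ?case by (simp only: act_append act_braid[OF braid])
  qed auto
qed

lemma act_alt_coords:
  assumes "s \<noteq> t" "f s = 1" "f t = 1" "A 0 = - 1" "A 1 = 1"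
    "\<And>i. A (Suc (Suc i)) = 2 * cth s t * A (Suc i) - A i"
  shows "act (alt s t k) f s = (if even k then A (Suc k) else - A k) \<and>
    act (alt s t k) f t = (if even k then - A k else A (Suc k))"
proof (induction k)
  case (Suc k)
  then show ?case
    unfolding alt_Suc_snoc act_append
    using assms(1) cth_sym[OF assms(1)] by (auto simp: assms(6) bt_def algebra_simps)
qed (use assms in auto)

text \<open>Let both words act on the form that is 1 on all simple roots. After \<open>j\<close>
  steps the value at the root of the last letter is \<open>- A j\<close> and the other one is
  \<open>A (Suc j)\<close>. Both \<open>A j\<close> and \<open>A (Suc j)\<close> are positive below
  \<open>m s t\<close>, so the sign pattern reveals the last letter, and the two words end in
  different letters.\<close>

lemma pr_alt_neq: assumes "s \<noteq> t" "0 < j" "enat j < m s t" shows "pr (alt s t j) \<noteq> pr (alt t s j)"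
proof
  assume eq: "pr (alt s t j) = pr (alt t s j)"
  have "\<exists>A :: nat \<Rightarrow> real. A 0 = - 1 \<and> A 1 = 1 \<and> (\<forall>i. A (Suc (Suc i)) = 2 * cth s t * A (Suc i) - A i) \<and>
     A j > 0 \<and> A (Suc j) > 0"
  proof (cases "m s t")
    case (enat k)
    define \<theta> where "\<theta> = pi / k"
    have k: "j < k" "k \<ge> 2" using assms m_ge2[OF assms(1)] enat by (simp_all add: numeral_eq_enat)
    have \<theta>: "\<theta> > 0" "k * \<theta> = pi" using k by (simp_all add: \<theta>_def)
    have "\<theta> < pi" using k by (simp add: \<theta>_def field_simps)
    then have sn: "sin (\<theta> / 2) > 0" using \<theta> by (intro sin_gt_zero) auto
    \<comment> \<open>The shift by one half produces the initial values -1 and 1, and it keeps the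
      argument of the sine inside the open interval from 0 to pi for all indices from 1 to
      \<open>k\<close>.\<close>
    define A where "A i = sin ((real i - 1 / 2) * \<theta>) / sin (\<theta> / 2)" for i
    have pos: "A i > 0" if "0 < i" "i \<le> k" for i
    proof -
      have "(real i - 1 / 2) * \<theta> < k * \<theta>" using that \<theta> by (intro mult_strict_right_mono) auto
      then have "sin ((real i - 1 / 2) * \<theta>) > 0" using that \<theta> by (intro sin_gt_zero) auto
      then show ?thesis using sn by (simp add: A_def)
    qed
    have "A (Suc (Suc i)) = 2 * cth s t * A (Suc i) - A i" for i
    proof -
      define y where "y = (real (Suc i) - 1 / 2) * \<theta>"
      have "(real (Suc (Suc i)) - 1 / 2) * \<theta> = y + \<theta>" "(real i - 1 / 2) * \<theta> = y - \<theta>"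
        by (simp_all add: y_def algebra_simps)
      then have "A (Suc (Suc i)) = sin (y + \<theta>) / sin (\<theta> / 2)" "A i = sin (y - \<theta>) / sin (\<theta> / 2)"
        by (simp_all only: A_def)
      moreover have "cth s t = cos \<theta>" by (simp add: cth_def enat \<theta>_def)
      moreover have "A (Suc i) = sin y / sin (\<theta> / 2)" by (simp only: A_def y_def)
      ultimately show ?thesis
        by (simp add: sin_add sin_diff add_divide_distrib diff_divide_distrib)
    qed
    moreover have "A 0 = - 1" "A 1 = 1" using sn by (simp_all add: A_def)
    ultimately show ?thesis using pos[of j] pos[of "Suc j"] assms(2) k
      by (intro exI[of _ A]) auto
  next
    case infinity
    \<comment> \<open>For an infinite bond the recurrence degenerates to that of an arithmetic
      progression.\<close>
    then have "cth s t = 1" by (simp add: cth_def)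
    then show ?thesis using assms(2) by (intro exI[of _ "\<lambda>i. 2 * real i - 1"]) auto
  qed
  then obtain A :: "nat \<Rightarrow> real" where A: "A 0 = - 1" "A 1 = 1"
    "\<And>i. A (Suc (Suc i)) = 2 * cth s t * A (Suc i) - A i" "A j > 0" "A (Suc j) > 0" by blast
  have A': "A (Suc (Suc i)) = 2 * cth t s * A (Suc i) - A i" for i
    using A(3) cth_sym[OF assms(1)] by simp
  have "act (alt s t j) (\<lambda>_. 1) s = act (alt t s j) (\<lambda>_. 1) s" using act_cong[OF eq] by simp
  moreover have "t \<noteq> s" using assms(1) by simp
  note act_alt_coords[of t s "\<lambda>_. 1" A j, OF this _ _ A(1,2) A']
  moreover note act_alt_coords[of s t "\<lambda>_. 1" A j, OF assms(1) _ _ A(1-3)]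
  ultimately show False using A(4,5) by (auto split: if_splits)
qed

subsection \<open>Dihedral subgroups\<close>

text \<open>By \<open>distinct_rr_red\<close> it suffices that the odd alternating words in the
  inversion sequence are different elements. If two agreed, the two alternating words of length
  \<open>j - i\<close> would agree, against \<open>pr_alt_neq\<close>.\<close>

lemma red_alt: assumes "s \<noteq> t" "enat k \<le> m s t" shows "red (alt s t k)"
proof -
  have ne: "pr (alt s t (2 * i + 1)) \<noteq> pr (alt s t (2 * j + 1))" if "i < j" "j < k" for i j
  proof
    assume eq: "pr (alt s t (2 * i + 1)) = pr (alt s t (2 * j + 1))"
    have "2 * j + 1 = (2 * i + 1) + 2 * (j - i)" using that by simp
    then have "pr (alt s t (2 * j + 1)) = pr (alt s t (2 * i + 1)) + pr (alt t s (2 * (j - i)))"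
      by (simp only: alt_add map_append sum_list_append) simp
    then have "pr (alt t s (j - i)) = pr (alt s t (j - i))"
      unfolding eq by (metis add.right_neutral add_left_cancel pr_alt_double)
    moreover have "enat (j - i) < m t s"
      using that assms m_sym[OF assms(1)] by (metis enat_ord_simps(2) less_imp_diff_less order.strict_trans2)
    ultimately show False using pr_alt_neq[of t s "j - i"] assms that by simp
  qed
  have "inj_on (\<lambda>i. pr (alt s t (2 * i + 1))) {0..<k}"
    by (rule linorder_inj_onI') (use ne in auto)
  then have "distinct (rr (rev (alt s t k)))"
    by (simp add: rr_rev_alt distinct_map del: alt.simps)
  then show ?thesis using distinct_rr_red red_rev by blast
qed

lemma len_alt: "\<lbrakk>s \<noteq> t; enat k \<le> m s t\<rbrakk> \<Longrightarrow> len (pr (alt s t k)) = k"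
  using red_alt[of s t k] by (simp add: red_def)

lemma red_dihedral:
  "\<lbrakk>red u; u \<in> lists {s, t}\<rbrakk> \<Longrightarrow> u = alt s t (length u) \<or> u = alt t s (length u)"
proof (induction u)
  case (Cons a u)
  then have IH: "u = alt s t (length u) \<or> u = alt t s (length u)"
    using red_append[of "[a]" u] by auto
  show ?case
  proof (cases u)
    case (Cons b v)
    have "a \<noteq> b"
    proof
      assume "a = b"
      then have "red [a, a]" using Cons.prems(1) Cons red_append[of "[a, a]" v] by simp
      then show False by (simp add: red_def)
    qed
    then show ?thesis using IH Cons Cons.prems(2) by auto
  qed (use Cons.prems in auto)
qed simp

text \<open>Beyond length \<open>m s t\<close>, braiding the letters after the first one brings an
  equal letter next to it, and the two cancel.\<close>

lemma red_alt_le: assumes "s \<noteq> t" "red (alt s t k)" shows "enat k \<le> m s t"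
proof (rule ccontr)
  assume "\<not> ?thesis"
  then obtain n where n: "m s t = enat n" "n < k" by (cases "m s t") auto
  then obtain r where "k = Suc n + r" using less_iff_Suc_add by auto
  then have "red (alt s t (Suc n))" using assms(2) alt_add[of s t "Suc n" r] red_append by metis
  then have l: "len (pr (alt s t (Suc n))) = Suc n" by (metis length_alt red_def)
  obtain n' where n': "n = Suc n'"
    using m_ge2[OF assms(1)] n by (cases n) (auto simp: numeral_eq_enat)
  have "pr (alt s t (Suc n)) = g s + pr (alt s t n)" using pr_braid[OF assms(1) n(1)] by simp
  also have "\<dots> = pr (alt t s n')" using n' by simp
  finally show False using l len_le[of "alt t s n'"] n' by simp
qed

lemma dihedral_elt:
  assumes "s \<noteq> t" "x \<in> WP {s, t}"
  obtains i where "enat i \<le> m s t" "x = pr (alt s t i) \<or> x = pr (alt t s i)"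
proof -
  obtain u where u: "u \<in> lists {s, t}" "red u" "pr u = x" using WP_red[OF assms(2)] by blast
  then consider "u = alt s t (length u)" | "u = alt t s (length u)" using red_dihedral by blast
  then show ?thesis
  proof cases
    case 1
    then show ?thesis using red_alt_le[OF assms(1)] u that by metis
  next
    case 2
    then show ?thesis using red_alt_le[of t s "length u"] assms(1) m_sym[OF assms(1)] u that by metis
  qed
qed

lemma alt_WP [intro]: "pr (alt s t k) \<in> WP {s, t}"
  using set_alt[of s t k] by (intro WP_pr) (auto simp: in_lists_conv_set)

lemma alt_WP_sub: "{s, t} \<subseteq> J \<Longrightarrow> pr (alt s t k) \<in> WP J"
  using WP_mono alt_WP by blast

text \<open>Split off the minimal coset element. The dihedral component then has reduced words
  ending in \<open>s\<close> and in \<open>t\<close>. These must be the two alternating words of one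
  length, and by \<open>pr_alt_neq\<close> their equality forces that length to be
  \<open>m s t\<close>, which is thereby finite.\<close>

lemma dihedral_top:
  assumes "s \<noteq> t" "w \<in> W" "len (w + g s) < len w" "len (w + g t) < len w"
  obtains y k where "m s t = enat k" "is_min {s, t} y" "w = y + pr (alt s t k)"
proof -
  obtain y x where yx: "is_min {s, t} y" "x \<in> WP {s, t}" "w = y + x" using min_decomp[OF assms(2)] by blast
  have *: "\<exists>u. u \<in> lists {s, t} \<and> red (u @ [r]) \<and> pr (u @ [r]) = x"
    if "r \<in> {s, t}" "len (w + g r) < len w" for r
  proof -
    have w: "x + g r \<in> WP {s, t}" using yx(2) that(1) by blast
    have "len (x + g r) < len x" using min_desc_iff[OF yx(1,2) that(1)] that(2) yx(3) by simp
    moreover obtain u where "u \<in> lists {s, t}" "red u" "pr u = x + g r"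
      using WP_red[OF w] by blast
    ultimately show ?thesis by (intro exI[of _ u]) (simp add: red_snoc add.assoc)
  qed
  obtain u where u: "u \<in> lists {s, t}" "red (u @ [s])" "pr (u @ [s]) = x" using *[of s] assms by auto
  obtain v where v: "v \<in> lists {s, t}" "red (v @ [t])" "pr (v @ [t]) = x" using *[of t] assms by auto
  define k where "k = length (u @ [s])"
  have k0: "k > 0" by (simp add: k_def)
  have lv: "k = length (v @ [t])" using u v by (simp add: red_def k_def)
  have U: "u @ [s] = alt s t k \<or> u @ [s] = alt t s k"
    using red_dihedral[OF u(2)] u(1) by (simp add: k_def del: alt.simps)
  have V: "v @ [t] = alt s t k \<or> v @ [t] = alt t s k"
    using red_dihedral[OF v(2)] v(1) lv by (simp del: alt.simps)
  have "u @ [s] \<noteq> v @ [t]" using assms(1) by simp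
  then have eq: "pr (alt s t k) = pr (alt t s k)" "x = pr (alt s t k)" "red (alt s t k)"
    using U V u v by metis+
  then have "\<not> enat k < m s t" using pr_alt_neq[OF assms(1) k0] by blast
  moreover have "enat k \<le> m s t" using red_alt_le[OF assms(1) eq(3)] .
  ultimately have "m s t = enat k" by simp
  then show ?thesis using that yx eq(2) by blast
qed

lemma g_inj: "g s = g t \<longleftrightarrow> s = t"
proof
  assume eq: "g s = g t"
  show "s = t"
  proof (rule ccontr)
    assume "s \<noteq> t"
    moreover have "enat 1 < m s t"
      using m_ge2[OF \<open>s \<noteq> t\<close>] by (cases "m s t") (auto simp: numeral_eq_enat)
    ultimately show False using pr_alt_neq[of s t 1] eq by simp
  qed
qed simp

lemma g_WP_iff: "g s \<in> WP J \<longleftrightarrow> s \<in> J"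
proof
  assume "g s \<in> WP J"
  then obtain u where u: "u \<in> lists J" "red u" "pr u = g s" using WP_red by blast
  then have "length u = 1" using len_g unfolding red_def by metis
  then obtain t where "u = [t]" by (auto simp: length_Suc_conv)
  then show "s \<in> J" using u g_inj by simp
qed blast

end

section \<open>Existence of Zamolodzhikov cycles\<close>

definition (in coxeter) coset :: "'w \<Rightarrow> 'a set \<Rightarrow> 'w set" where
  "coset y J = (+) y ` WP J"

lemma (in coxeter) coset_add: assumes "x \<in> WP J" shows "coset (y + x) J = coset y J"
proof -
  have "coset (y + x) J \<subseteq> coset y J" if "x \<in> WP J" for y x
    unfolding coset_def using that by (auto simp: add.assoc)
  from this[OF assms] this[OF WP_uminus[OF assms], of "y + x"] show ?thesis
    by (auto simp: add.assoc add.right_inverse simp del: add_uminus_conv_diff)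
qed

text \<open>The type of a coset can be recovered: translating back to the identity turns a letter of
  \<open>J\<close> into an element of \<open>WP J'\<close>, and \<open>g_WP_iff\<close>
  applies.\<close>

lemma (in coxeter) coset_eqD:
  assumes "coset y J = coset y' J'"
  obtains x where "J = J'" "x \<in> WP J" "y' = y + x"
proof -
  have sub: "K \<subseteq> K'" if eq: "coset z K = coset z' K'" for z z' K K'
  proof
    fix s assume s: "s \<in> K"
    have "z + 0 \<in> coset z K" unfolding coset_def by (rule imageI) (rule WP_0)
    then have "z + 0 \<in> (+) z' ` WP K'" by (simp only: eq coset_def[symmetric])
    then obtain x0 where x0: "z + 0 = z' + x0" "x0 \<in> WP K'" by (rule imageE)
    have "z + g s \<in> coset z K" unfolding coset_def by (rule imageI) (rule WP_g[OF s])
    then have "z + g s \<in> (+) z' ` WP K'" by (simp only: eq coset_def[symmetric])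
    then obtain x1 where x1: "z + g s = z' + x1" "x1 \<in> WP K'" by (rule imageE)
    from x0(1) have "z = z' + x0" by simp
    with x1(1) have "z' + x0 + g s = z' + x1" by (simp only:)
    then have "z' + (x0 + g s) = z' + x1" by (simp only: add.assoc)
    then have "x0 + g s = x1" by simp
    then have "g s = - x0 + x1" by auto
    then have "g s \<in> WP K'" using WP_add[OF WP_uminus[OF x0(2)] x1(2)] by simp
    then show "s \<in> K'" by (simp add: g_WP_iff)
  qed
  have "J = J'" using sub[OF assms] sub[OF assms[symmetric]] by blast
  moreover have "y' + 0 \<in> coset y' J'" unfolding coset_def using WP_0 by (rule imageI)
  then have "y' + 0 \<in> (+) y ` WP J" by (simp only: assms[symmetric] coset_def[symmetric])
  then obtain x where "y' + 0 = y + x" "x \<in> WP J" by (rule imageE)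
  then have "x \<in> WP J" "y' = y + x" by simp_all
  ultimately show ?thesis using that by blast
qed

definition (in coxeter) red_words :: "'a set \<Rightarrow> 'w \<Rightarrow> 'a list set" where
  "red_words J w = {u \<in> lists J. red u \<and> pr u = w}"

definition (in coxeter) rank2_cosets :: "'a set \<Rightarrow> 'w set set" where
  "rank2_cosets I = {coset y J | y J. y \<in> WP I \<and> J \<subseteq> I \<and> card J = 2}"

text \<open>Counterpart of \<open>gamma_path\<close> for the reduced words over \<open>J\<close> of
  an arbitrary element, free of \<open>longest_elt\<close> and of the presented group;
  \<open>zam_cycle_braid_path\<close> translates back.\<close>

fun (in coxeter) braid_path ::
  "'a set \<Rightarrow> 'w \<Rightarrow> 'a list \<Rightarrow> ('a list \<times> 'a \<times> 'a \<times> 'a list) list \<Rightarrow> 'a list \<Rightarrow> bool" where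
  "braid_path J w u [] v \<longleftrightarrow> u = v"
| "braid_path J w u ((a, s, t, c) # es) v \<longleftrightarrow>
     s \<in> J \<and> t \<in> J \<and> s \<noteq> t \<and> m s t \<noteq> \<infinity> \<and> u = move_src m (a, s, t, c) \<and>
     u \<in> red_words J w \<and> move_tgt m (a, s, t, c) \<in> red_words J w \<and>
     braid_path J w (move_tgt m (a, s, t, c)) es v"

fun (in coxeter) crossed :: "'a list \<times> 'a \<times> 'a \<times> 'a list \<Rightarrow> 'w set" where
  "crossed (a, s, t, c) = coset (pr a) {s, t}"

text \<open>An edge of the Cayley graph is given by its start \<open>z\<close> and its label
  \<open>b\<close>; a word is read as the path from the identity that it spells.\<close>

definition (in coxeter) on_path :: "'a list \<Rightarrow> 'w \<Rightarrow> 'a \<Rightarrow> bool" where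
  "on_path u z b \<longleftrightarrow> (\<exists>a c. u = a @ b # c \<and> z = pr a)"

text \<open>The edges on one of the two ascending boundary paths of the \<open>2k\<close>-gon with
  lowest vertex \<open>y\<close>, namely the path that spells \<open>alt s t k\<close>.\<close>

definition (in coxeter) on_side :: "'w \<Rightarrow> 'a \<Rightarrow> 'a \<Rightarrow> nat \<Rightarrow> 'w \<Rightarrow> 'a \<Rightarrow> bool" where
  "on_side y s t k z b \<longleftrightarrow> (\<exists>i<k. z = y + pr (alt s t i) \<and> b = (if even i then s else t))"

lemma (in coxeter) len_take: "red u \<Longrightarrow> n \<le> length u \<Longrightarrow> len (pr (take n u)) = n"
  using red_append[of "take n u" "drop n u"] by (metis append_take_drop_id length_take min.absorb2 red_def)

lemma (in coxeter) on_path_nth: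
  assumes "red u"
  shows "on_path u z b \<longleftrightarrow> len z < length u \<and> z = pr (take (len z) u) \<and> b = u ! len z"
proof
  assume "on_path u z b"
  then obtain a c where u: "u = a @ b # c" "z = pr a" unfolding on_path_def by blast
  then have "len z = length a" using assms red_append[of a "b # c"] by (simp add: red_def)
  then show "len z < length u \<and> z = pr (take (len z) u) \<and> b = u ! len z" using u by simp
next
  assume "len z < length u \<and> z = pr (take (len z) u) \<and> b = u ! len z"
  then show "on_path u z b"
    unfolding on_path_def using id_take_nth_drop[of "len z" u] by metis
qed

lemma (in coxeter) on_path_asc: "red u \<Longrightarrow> on_path u z b \<Longrightarrow> len z < len (z + g b)"
  unfolding on_path_def using red_append red_snoc by (metis append_Cons append_Nil append_assoc)

lemma take_alt: "i \<le> k \<Longrightarrow> take i (alt s t k) = alt s t i"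
  using alt_add[of s t i "k - i"] by simp

lemma (in coxeter) on_side_iff:
  assumes "red (a @ alt s t k @ c)"
  shows "on_side (pr a) s t k z b \<longleftrightarrow>
    length a \<le> len z \<and> len z < length a + k \<and> on_path (a @ alt s t k @ c) z b"
proof -
  let ?u = "a @ alt s t k @ c"
  have *: "pr (take (length a + i) ?u) = pr a + pr (alt s t i)" "?u ! (length a + i) = (if even i then s else t)"
    if "i < k" for i
    using that by (simp_all add: take_alt nth_append nth_alt)
  show ?thesis
  proof
    assume "on_side (pr a) s t k z b"
    then obtain i where i: "i < k" "z = pr a + pr (alt s t i)" "b = (if even i then s else t)"
      unfolding on_side_def by blast
    then have "len z = length a + i" using len_take[OF assms, of "length a + i"] *(1)[OF i(1)] by simp
    then show "length a \<le> len z \<and> len z < length a + k \<and> on_path ?u z b"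
      using i * on_path_nth[OF assms] by simp
  next
    assume "length a \<le> len z \<and> len z < length a + k \<and> on_path ?u z b"
    then obtain i where "len z = length a + i" "i < k" "on_path ?u z b"
      using le_Suc_ex by auto
    then show "on_side (pr a) s t k z b"
      unfolding on_side_def on_path_nth[OF assms] using * by (intro exI[of _ i]) auto
  qed
qed

text \<open>In a reduced path the length of the start of an edge is its position, so exactly the
  edges whose start has length from \<open>length a\<close> up to, but excluding,
  \<open>length a + k\<close> are exchanged. Stating this with sums avoids truncated
  subtraction.\<close>

lemma (in coxeter) on_path_flip:
  assumes "red (a @ alt s t k @ c)" "red (a @ alt t s k @ c)" "pr (alt s t k) = pr (alt t s k)"
  shows "of_bool (on_path (a @ alt t s k @ c) z b) + (of_bool (on_side (pr a) s t k z b) :: nat) =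
    of_bool (on_path (a @ alt s t k @ c) z b) + of_bool (on_side (pr a) t s k z b)"
proof (cases "length a \<le> len z \<and> len z < length a + k")
  case True
  then show ?thesis by (simp add: on_side_iff[OF assms(1)] on_side_iff[OF assms(2)])
next
  case False
  then have "on_path (a @ alt t s k @ c) z b \<longleftrightarrow> on_path (a @ alt s t k @ c) z b"
    unfolding on_path_nth[OF assms(1)] on_path_nth[OF assms(2)]
    using assms(3) by (auto simp: nth_append)
  then show ?thesis using False by (simp add: on_side_iff[OF assms(1)] on_side_iff[OF assms(2)])
qed

text \<open>At the bottom of a dihedral coset both letters ascend. Higher up the letter just used
  descends, so only the continuation of the alternating word ascends, and at the top nothing
  does.\<close>

lemma (in coxeter) asc_alt:
  assumes "s \<noteq> t" "m s t = enat k" "i \<le> k" "b \<in> {s, t}"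
    "len (pr (alt s t i)) < len (pr (alt s t i) + g b)"
  shows "i < k \<and> (i = 0 \<or> b = (if even i then s else t))"
proof -
  have desc: "\<not> len (pr (alt p q (Suc j))) < len (pr (alt p q (Suc j)) + g (if even j then p else q))"
    if "p \<noteq> q" "enat (Suc j) \<le> m p q" for p q j
    using red_alt[OF that] unfolding alt_Suc_snoc red_snoc by (simp add: add.assoc)
  have k2: "k \<ge> 2" using m_ge2[OF assms(1)] assms(2) by (simp add: numeral_eq_enat)
  show ?thesis
  proof (cases i)
    case (Suc j)
    have "b = (if even i then s else t)"
      using desc[of s t j] assms Suc by (auto split: if_splits)
    moreover have "i < k"
    proof (rule ccontr)
      assume "\<not> i < k"
      then have "i = k" using assms(3) by simp
      then show False
        using desc[of t s j] assms Suc m_sym[OF assms(1)] pr_braid[OF assms(1,2)] calculation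
        by (auto split: if_splits simp del: alt.simps)
    qed
    ultimately show ?thesis by blast
  qed (use k2 in simp)
qed

text \<open>The sweep takes place in a sphere: \<open>nx\<close> and \<open>pv\<close> are the two rotations of the three generators, and
  reading the edges \<open>y \<rightarrow> ys\<close> of the Cayley graph clockwise around \<open>y\<close> gives the cyclic order \<open>nx\<close> for
  \<open>y\<close> of even length and \<open>pv\<close> for \<open>y\<close> of odd length.\<close>

locale rank3 = coxeter m g for m :: "'a \<Rightarrow> 'a \<Rightarrow> enat" and g :: "'a \<Rightarrow> 'w::group_add" +
  fixes I :: "'a set" and nx pv :: "'a \<Rightarrow> 'a" and w0 :: 'w
  assumes nx_I [simp]: "a \<in> I \<Longrightarrow> nx a \<in> I" and pv_I [simp]: "a \<in> I \<Longrightarrow> pv a \<in> I"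
    and nx_neq [simp]: "a \<in> I \<Longrightarrow> nx a \<noteq> a" and pv_neq [simp]: "a \<in> I \<Longrightarrow> pv a \<noteq> a"
    and nx_neq_pv: "a \<in> I \<Longrightarrow> nx a \<noteq> pv a"
    and nx_pv [simp]: "a \<in> I \<Longrightarrow> nx (pv a) = a" and pv_nx [simp]: "a \<in> I \<Longrightarrow> pv (nx a) = a"
    and nx_nx [simp]: "a \<in> I \<Longrightarrow> nx (nx a) = pv a" and pv_pv [simp]: "a \<in> I \<Longrightarrow> pv (pv a) = nx a"
    and I_eq: "a \<in> I \<Longrightarrow> I = {a, nx a, pv a}" and I_nonempty: "I \<noteq> {}"
    and w0_WP: "w0 \<in> WP I" and w0_desc: "s \<in> I \<Longrightarrow> len (w0 + g s) < len w0"
begin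

text \<open>Mirroring the sphere exchanges right and left, so statements about left faces follow
  from those about right faces.\<close>

lemma rank3_swap: "rank3 m g I pv nx w0"
  by unfold_locales (use nx_neq_pv I_eq I_nonempty w0_WP w0_desc in \<open>force+\<close>)

text \<open>The label of the next edge clockwise after \<open>a\<close> at \<open>y\<close>, hence
  the second label of the face to the right of the edge \<open>a\<close>; \<open>lf\<close> is the
  anticlockwise analogue.\<close>

definition rt :: "'w \<Rightarrow> 'a \<Rightarrow> 'a" where
  "rt y a = (if even (len y) then nx a else pv a)"

definition lf :: "'w \<Rightarrow> 'a \<Rightarrow> 'a" where
  "lf y a = (if even (len y) then pv a else nx a)"

lemma rt_I [simp]: "a \<in> I \<Longrightarrow> rt y a \<in> I" and lf_I [simp]: "a \<in> I \<Longrightarrow> lf y a \<in> I"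
  and rt_neq [simp]: "a \<in> I \<Longrightarrow> rt y a \<noteq> a" and lf_neq [simp]: "a \<in> I \<Longrightarrow> lf y a \<noteq> a"
  and rt_neq_lf: "a \<in> I \<Longrightarrow> rt y a \<noteq> lf y a"
  and lf_rt [simp]: "a \<in> I \<Longrightarrow> lf y (rt y a) = a" and rt_lf [simp]: "a \<in> I \<Longrightarrow> rt y (lf y a) = a"
  and rt_rt [simp]: "a \<in> I \<Longrightarrow> rt y (rt y a) = lf y a"
  by (auto simp: rt_def lf_def nx_neq_pv nx_neq_pv[symmetric])

lemma third: "\<lbrakk>a \<in> I; d \<in> I; d \<noteq> a; d \<noteq> rt y a\<rbrakk> \<Longrightarrow> d = lf y a"
  using I_eq[of a] by (auto simp: rt_def lf_def split: if_splits)

lemma rt_parity: "even (len z) \<noteq> even (len y) \<Longrightarrow> rt z a = lf y a"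
  and lf_parity: "even (len z) \<noteq> even (len y) \<Longrightarrow> lf z a = rt y a"
  by (auto simp: rt_def lf_def)

lemma rt_same: "even (len z) = even (len y) \<Longrightarrow> rt z a = rt y a"
  by (auto simp: rt_def)

lemma lf_lf [simp]: "a \<in> I \<Longrightarrow> lf y (lf y a) = rt y a"
  by (auto simp: rt_def lf_def)

definition right_face :: "'w \<Rightarrow> 'a \<Rightarrow> 'w set" where
  "right_face y a = coset y {a, rt y a}"

definition left_face :: "'w \<Rightarrow> 'a \<Rightarrow> 'w set" where
  "left_face y a = coset y {a, lf y a}"

text \<open>Along an alternating word the label and the parity of the vertex change together, so a
  face once on the right stays on the right. The edges having it there form the boundary path
  starting with \<open>s\<close>.\<close>

lemma right_face_iff:
  assumes y: "is_min {s, t} y" "s \<in> I" "t = rt y s" "m s t = enat k"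
    and e: "z \<in> W" "b \<in> I" "len z < len (z + g b)"
  shows "right_face z b = coset y {s, t} \<longleftrightarrow> on_side y s t k z b"
proof
  have st: "s \<noteq> t" using rt_neq[OF y(2)] y(3) by metis
  assume "right_face z b = coset y {s, t}"
  then have "coset y {s, t} = coset z {b, rt z b}" by (simp add: right_face_def)
  then obtain x where J: "{s, t} = {b, rt z b}" and x: "x \<in> WP {s, t}" and z: "z = y + x"
    by (rule coset_eqD)
  have b: "b \<in> {s, t}" using J by blast
  have asc: "len x < len (x + g b)" using min_asc_iff[OF y(1) x b] e z by simp
  obtain i where i: "enat i \<le> m s t" "x = pr (alt s t i) \<or> x = pr (alt t s i)"
    using dihedral_elt[OF st x] by blast
  have ik: "i \<le> k" using i(1) y(4) by simp
  have lx: "len x = i"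
    using i len_alt[of s t i] len_alt[of t s i] st m_sym[OF st] by auto
  have par: "even (len z) \<longleftrightarrow> (even (len y) \<longleftrightarrow> even i)"
    using min_add[OF y(1) x] z lx by simp
  from i(2) show "on_side y s t k z b"
  proof
    assume xs: "x = pr (alt s t i)"
    have *: "i < k \<and> (i = 0 \<or> b = (if even i then s else t))"
      using asc_alt[OF st y(4) ik b] asc xs by simp
    show ?thesis
    \<comment> \<open>Only at the lowest vertex do both letters ascend; there the orientation
      decides which of the two has the face on its right.\<close>
    proof (cases "i = 0 \<and> b = t")
      case True
      then have "rt y t = s" using J par rt_same[of z y t] st by auto
      then have False using y(2,3) rt_neq_lf[of s y] rt_rt[of s y] lf_neq[of s y] by auto
      then show ?thesis ..
    next
      case False
      then have "b = (if even i then s else t)" using * b by auto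
      then show ?thesis unfolding on_side_def using * z xs by blast
    qed
  next
    assume xs: "x = pr (alt t s i)"
    have *: "i < k \<and> (i = 0 \<or> b = (if even i then t else s))"
      using asc_alt[of t s k i b] asc xs y(4) st ik b m_sym[OF st] by auto
    show ?thesis
    proof (cases "i = 0 \<and> b = s")
      case True
      then show ?thesis unfolding on_side_def using * z xs by auto
    next
      case False
      then have bb: "b = (if even i then t else s)" using * b by auto
      have "rt z b = (if even i then s else t)" using J bb st by (auto split: if_splits)
      moreover have "rt z b = (if even i then lf y s else lf y s)"
        using bb par y rt_parity[of z y b] rt_same[of z y b] by (auto split: if_splits)
      ultimately have False
        using y(2,3) rt_neq_lf[of s y] lf_neq[of s y] by (auto split: if_splits)
      then show ?thesis ..
    qed
  qed
next
  have st: "s \<noteq> t" using rt_neq[OF y(2)] y(3) by metis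
  assume "on_side y s t k z b"
  then obtain i where i: "i < k" "z = y + pr (alt s t i)" "b = (if even i then s else t)"
    unfolding on_side_def by blast
  have "len (pr (alt s t i)) = i" using len_alt[OF st, of i] i y(4) by simp
  then have "even (len z) \<longleftrightarrow> (even (len y) \<longleftrightarrow> even i)"
    using min_add[OF y(1) alt_WP[of s t i]] i by simp
  then have "rt z b = (if even i then t else s)"
    using i(3) y rt_parity[of z y b] rt_same[of z y b] by (auto split: if_splits)
  then have "{b, rt z b} = {s, t}" using i(3) by auto
  then show "right_face z b = coset y {s, t}"
    unfolding right_face_def i(2) using coset_add[OF alt_WP[of s t i]] by simp
qed

lemma left_face_iff:
  assumes y: "is_min {s, t} y" "s \<in> I" "t = rt y s" "m s t = enat k"
    and e: "z \<in> W" "b \<in> I" "len z < len (z + g b)"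
  shows "left_face z b = coset y {s, t} \<longleftrightarrow> on_side y t s k z b"
proof -
  interpret sw: rank3 m g I pv nx w0 by (rule rank3_swap)
  have lf: "sw.rt = lf" by (simp add: fun_eq_iff sw.rt_def lf_def)
  have "s \<noteq> t" using rt_neq[OF y(2)] y(3) by metis
  then have "m t s = enat k" using y(4) m_sym by metis
  moreover have "is_min {t, s} y" using y(1) by (simp add: insert_commute)
  moreover have "t \<in> I" "s = sw.rt y t" using y(2,3) by (simp_all add: lf)
  ultimately have "sw.right_face z b = coset y {t, s} \<longleftrightarrow> on_side y t s k z b"
    using e by (intro sw.right_face_iff)
  then show ?thesis by (simp add: sw.right_face_def left_face_def lf insert_commute)
qed

section \<open>Pushing a path across the faces\<close>

abbreviation full :: "'a list \<Rightarrow> bool" where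
  "full u \<equiv> u \<in> red_words I w0"

lemmas full_def = red_words_def

abbreviation faces :: "'w set set" where
  "faces \<equiv> rank2_cosets I"

lemmas faces_def = rank2_cosets_def

lemma right_face_faces: assumes "z \<in> WP I" "b \<in> I" shows "right_face z b \<in> faces"
proof -
  have "{b, rt z b} \<subseteq> I \<and> card {b, rt z b} = 2" using assms(2) rt_neq[OF assms(2), of z, symmetric] by simp
  then show ?thesis unfolding faces_def right_face_def using assms(1) by blast
qed

lemma left_face_faces: assumes "z \<in> WP I" "b \<in> I" shows "left_face z b \<in> faces"
proof -
  have "{b, lf z b} \<subseteq> I \<and> card {b, lf z b} = 2" using assms(2) lf_neq[OF assms(2), of z, symmetric] by simp
  then show ?thesis unfolding faces_def left_face_def using assms(1) by blast
qed

text \<open>\<open>X\<close> is the set of faces already crossed while sweeping the path \<open>p0\<close> to the right to \<open>u\<close>.\<close>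

definition swept :: "'a list \<Rightarrow> 'w set set \<Rightarrow> 'a list \<Rightarrow> bool" where
  "swept p0 X u \<longleftrightarrow> (\<forall>z b. z \<in> WP I \<longrightarrow> b \<in> I \<longrightarrow> len z < len (z + g b) \<longrightarrow>
     of_bool (on_path u z b) + (of_bool (right_face z b \<in> X) :: nat) =
     of_bool (on_path p0 z b) + of_bool (left_face z b \<in> X))"

text \<open>The identity in \<open>swept\<close> is a boundary formula: on each ascending edge the
  path \<open>u\<close> minus the path \<open>p0\<close> equals the indicator of a crossed left face
  minus that of a crossed right face. Off \<open>u\<close>, a crossed left face therefore forces a
  crossed right face.\<close>

lemma sweptD:
  assumes "swept p0 X u" "z \<in> WP I" "b \<in> I" "len z < len (z + g b)"
    "\<not> on_path u z b" "left_face z b \<in> X"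
  shows "right_face z b \<in> X"
proof -
  have "of_bool (on_path u z b) + (of_bool (right_face z b \<in> X) :: nat) =
     of_bool (on_path p0 z b) + of_bool (left_face z b \<in> X)"
    using assms(1-4) unfolding swept_def by blast
  then show ?thesis using assms(5,6) by (auto simp: of_bool_def split: if_splits)
qed

definition flippable :: "'w set set \<Rightarrow> 'a list \<Rightarrow> bool" where
  "flippable X u \<longleftrightarrow> (\<exists>a s t k c. u = a @ alt s t k @ c \<and> s \<in> I \<and> t = rt (pr a) s \<and> m s t = enat k \<and>
     is_min {s, t} (pr a) \<and> coset (pr a) {s, t} \<notin> X)"

context
  fixes u :: "'a list" and p0 :: "'a list" and X :: "'w set set"
  assumes u: "full u" and sw: "swept p0 X u"
begin

abbreviation vx :: "nat \<Rightarrow> 'w" where "vx i \<equiv> pr (take i u)"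

abbreviation rf :: "nat \<Rightarrow> 'w set" where "rf i \<equiv> right_face (vx i) (u ! i)"

lemma red_u: "red u" and u_I: "u \<in> lists I" and pr_u: "pr u = w0"
  using u by (auto simp: full_def)

lemma nth_I [simp]: "i < length u \<Longrightarrow> u ! i \<in> I"
  using u_I by (auto simp: in_lists_conv_set)

lemma vx_WP [simp]: "vx i \<in> WP I"
  using u_I by (intro WP_pr) (auto simp: in_lists_conv_set dest: in_set_takeD)

lemma vx_W [simp]: "vx i \<in> W"
  by blast

lemma len_vx [simp]: "i \<le> length u \<Longrightarrow> len (vx i) = i"
  using len_take[OF red_u] .

lemma vx_Suc: "i < length u \<Longrightarrow> vx (Suc i) = vx i + g (u ! i)"
  by (simp add: take_Suc_conv_app_nth)

lemma asc_nth: "i < length u \<Longrightarrow> len (vx i) < len (vx i + g (u ! i))"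
  using len_vx[of "Suc i"] vx_Suc[of i] by simp

lemma nth_Suc_neq: assumes "Suc i < length u" shows "u ! Suc i \<noteq> u ! i"
proof
  assume "u ! Suc i = u ! i"
  then have "vx (Suc (Suc i)) = vx i" using vx_Suc[of i] vx_Suc[of "Suc i"] assms by (simp add: add.assoc)
  then show False using len_vx[of "Suc (Suc i)"] len_vx[of i] assms by simp
qed

text \<open>The edge number \<open>i\<close> lies on the boundary of an uncrossed face to its right,
  and the path has followed this boundary ever since the lowest vertex \<open>vx j\<close> of the
  face.\<close>

definition entered :: "nat \<Rightarrow> bool" where
  "entered i \<longleftrightarrow> i < length u \<and> rf i \<notin> X \<and>
     (\<exists>j\<le>i. is_min {u ! i, rt (vx i) (u ! i)} (vx j) \<and> (\<forall>l. j \<le> l \<and> l \<le> i \<longrightarrow> u ! l \<in> {u ! i, rt (vx i) (u ! i)}))"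

lemma rf_step:
  assumes "Suc i < length u" "u ! Suc i = rt (vx i) (u ! i)"
  shows "rt (vx (Suc i)) (u ! Suc i) = u ! i" "rf (Suc i) = rf i"
proof -
  show *: "rt (vx (Suc i)) (u ! Suc i) = u ! i"
    using assms rt_parity[of "vx (Suc i)" "vx i"] by simp
  show "rf (Suc i) = rf i"
    unfolding right_face_def * unfolding assms(2) vx_Suc[OF Suc_lessD[OF assms(1)]]
    by (subst coset_add) (auto simp: insert_commute)
qed

text \<open>When the path leaves the face on its right, clockwise at the new vertex come the
  outgoing edge \<open>d\<close>, the third edge \<open>c\<close>, and the edge just traversed. Seen
  from that vertex, \<open>c\<close> separates \<open>rf (Suc i)\<close> on its left from
  \<open>rf i\<close> on its right.\<close>

lemma turn:
  assumes "Suc i < length u" "u ! Suc i \<noteq> rt (vx i) (u ! i)"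
  defines "c \<equiv> rt (vx i) (u ! i)" and "d \<equiv> u ! Suc i"
  shows "d = lf (vx i) (u ! i)" "rt (vx (Suc i)) d = c" "lf (vx (Suc i)) c = d" "rt (vx (Suc i)) c = u ! i"
    "rt (vx i) c = d" "lf (vx i) c = u ! i"
proof -
  show d: "d = lf (vx i) (u ! i)"
    unfolding d_def using third[of "u ! i" "u ! Suc i" "vx i"] assms nth_Suc_neq[of i] by simp
  have par: "even (len (vx (Suc i))) \<noteq> even (len (vx i))" using assms(1) by simp
  show "rt (vx (Suc i)) d = c" "lf (vx (Suc i)) c = d" "rt (vx (Suc i)) c = u ! i"
    "rt (vx i) c = d" "lf (vx i) c = u ! i"
    using assms(1) by (simp_all add: rt_parity[OF par] lf_parity[OF par] c_def d)
qed

lemma min_at_turn: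
  assumes "Suc i < length u" "u ! Suc i \<noteq> rt (vx i) (u ! i)"
    "len (vx (Suc i)) < len (vx (Suc i) + g (rt (vx i) (u ! i)))" "rf (Suc i) \<notin> X"
  shows "entered (Suc i)"
proof -
  have "is_min {u ! Suc i, rt (vx (Suc i)) (u ! Suc i)} (vx (Suc i))"
    using asc_nth[OF assms(1)] assms(3) by (simp add: is_min_def turn(2)[OF assms(1,2)])
  then show ?thesis
    unfolding entered_def using assms(1,4) by (intro conjI exI[of _ "Suc i"]) (auto simp: le_antisym)
qed

text \<open>Both labels of the face descend at the new vertex, so it is the top of the face. As the
  path entered at the bottom, it has run along a complete side, which can be flipped.\<close>

lemma exit_at_top:
  assumes i: "entered i" and "len (vx (Suc i) + g (rt (vx i) (u ! i))) < len (vx (Suc i))"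
  shows "flippable X u"
proof -
  define a where "a = u ! i"
  define c where "c = rt (vx i) a"
  obtain j where j: "i < length u" "rf i \<notin> X" "j \<le> i" "is_min {a, c} (vx j)"
    "\<And>l. j \<le> l \<Longrightarrow> l \<le> i \<Longrightarrow> u ! l \<in> {a, c}"
    using i unfolding entered_def a_def c_def by blast
  have I: "a \<in> I" "c \<in> I" "c \<noteq> a" using j(1) by (simp_all add: a_def c_def)
  have "len (vx (Suc i) + g a) < len (vx (Suc i))"
    using asc_nth[OF j(1)] vx_Suc[OF j(1)] by (simp add: a_def add.assoc)
  then obtain y k where y: "m a c = enat k" "is_min {a, c} y" "vx (Suc i) = y + pr (alt a c k)"
    using dihedral_top[OF I(3)[symmetric] vx_W[of "Suc i"]] assms(2)[folded a_def, folded c_def] by blast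
  define v where "v = take (Suc i - j) (drop j u)"
  have uv: "u = take j u @ v @ drop (Suc i) u"
    unfolding v_def using j(3) by (metis Suc_diff_le append_take_drop_id drop_drop le_SucI le_add_diff_inverse2 plus_1_eq_Suc)
  have tv: "take (Suc i) u = take j u @ v"
    unfolding v_def using j(3) by (metis le_SucI le_add_diff_inverse take_add)
  have lv: "length v = Suc i - j" unfolding v_def using j(1) by simp
  have vI: "v \<in> lists {a, c}"
  proof -
    have "v ! l \<in> {a, c}" if "l < length v" for l
      using j(5)[of "j + l"] that j(1,3) lv by (simp add: v_def)
    then show ?thesis by (metis in_lists_conv_set in_set_conv_nth)
  qed
  have "red v" using red_u uv red_append by metis
  have "vx j + pr v = y + pr (alt a c k)" using y(3) tv by simp
  then have yv: "y = vx j" "pr v = pr (alt a c k)"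
    using min_unique[OF j(4) y(2) WP_pr[OF vI] alt_WP] by auto
  have kv: "length v = k" using \<open>red v\<close> yv(2) len_alt[of a c k] y(1) I(3) unfolding red_def by simp
  obtain s t where st: "v = alt s t k" "{s, t} = {a, c}"
    using red_dihedral[OF \<open>red v\<close> vI] kv by (metis insert_commute)
  have kpos: "k > 0" and ik: "i = j + (k - 1)" using kv lv j(3) by auto
  have "v ! (k - 1) = a" using kv lv j(1,3) ik by (simp add: v_def a_def)
  then have last: "a = (if even (k - 1) then s else t)" using nth_alt[of "k - 1" k s t] kpos st(1) by simp
  have other: "c = (if even (k - 1) then t else s)" using last st(2) I(3) by (auto simp: doubleton_eq_iff)
  have par: "even (len (vx i)) \<longleftrightarrow> (even (len (vx j)) \<longleftrightarrow> even (k - 1))"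
    using j(1,3) ik by simp
  \<comment> \<open>The orientation known at the edge \<open>i\<close> is carried down to the
    bottom: each of the \<open>k - 1\<close> steps swaps the two labels and changes the
    parity.\<close>
  have t: "t = rt (vx j) s"
  proof (cases "even (k - 1)")
    case True
    then show ?thesis using last other par rt_same[of "vx i" "vx j" a] by (simp add: c_def)
  next
    case False
    then have "s = rt (vx i) t" using last other by (simp add: c_def)
    then show ?thesis
      using False par lf_rt[of t "vx i"] rt_parity[of "vx j" "vx i" s] I last by simp
  qed
  have "coset (vx i) {a, c} \<notin> X" using j(2) by (simp add: right_face_def a_def c_def)
  moreover have "coset (vx i) {a, c} = coset (vx j) {a, c}"
  proof -
    have "vx (Suc i) = vx j + pr v" using tv by simp
    moreover have "vx i + g a = vx (Suc i)" using vx_Suc[OF j(1)] by (simp add: a_def)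
    ultimately show ?thesis
      using coset_add[OF WP_g[of a "{a, c}"], of "vx i"] coset_add[OF WP_pr[OF vI], of "vx j"] by auto
  qed
  moreover have "s \<in> I" "m s t = enat k"
    using st(2) I y(1) m_sym[OF I(3)] by (auto simp: doubleton_eq_iff)
  ultimately show ?thesis
    unfolding flippable_def using uv st t j(4)
    by (intro exI[of _ "take j u"] exI[of _ s] exI[of _ t] exI[of _ k] exI[of _ "drop (Suc i) u"]) simp
qed

text \<open>At the next vertex the path has reached the top of the face, or follows its boundary, or
  turns left. In the last case the ascending edge \<open>c\<close> has the uncrossed face
  \<open>rf i\<close> on its right and the next face on its left. By \<open>sweptD\<close> the next
  face is uncrossed too, and it is entered at its lowest vertex.\<close>

lemma entered_step: assumes i: "entered i" shows "flippable X u \<or> entered (Suc i)"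
proof -
  define a where "a = u ! i"
  define c where "c = rt (vx i) a"
  have il: "i < length u" and nX: "rf i \<notin> X" using i by (auto simp: entered_def)
  have I: "a \<in> I" "c \<in> I" "c \<noteq> a" using il by (simp_all add: a_def c_def)
  consider "len (vx (Suc i) + g c) < len (vx (Suc i))" | "len (vx (Suc i)) < len (vx (Suc i) + g c)"
    using len_add_g[of "vx (Suc i)" c] by auto
  then show ?thesis
  proof cases
    case 1
    then show ?thesis using exit_at_top[OF i] by (simp add: a_def c_def)
  next
    case 2
    have il2: "Suc i < length u"
    proof (rule ccontr)
      assume "\<not> Suc i < length u"
      then have "vx (Suc i) = w0" using il pr_u by simp
      then show False using 2 w0_desc[OF I(2)] by simp
    qed
    show ?thesis
    proof (cases "u ! Suc i = c")
      case True
      note s = rf_step[OF il2 True[unfolded c_def a_def]]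
      obtain j where j: "j \<le> i" "is_min {a, c} (vx j)" "\<And>l. j \<le> l \<Longrightarrow> l \<le> i \<Longrightarrow> u ! l \<in> {a, c}"
        using i unfolding entered_def a_def c_def by blast
      have "u ! l \<in> {a, c}" if "j \<le> l" "l \<le> Suc i" for l
        using that j(3)[of l] True by (cases "l = Suc i") auto
      moreover have "{u ! Suc i, rt (vx (Suc i)) (u ! Suc i)} = {a, c}"
        using s(1) True by (auto simp: a_def)
      ultimately have "entered (Suc i)"
        unfolding entered_def using il2 nX s(2) j by (intro conjI exI[of _ j]) auto
      then show ?thesis ..
    next
      case False
      note t = turn[OF il2 False[unfolded c_def a_def], folded a_def, folded c_def]
      have "\<not> on_path u (vx (Suc i)) c" using False il2 by (simp add: on_path_nth[OF red_u])
      moreover have "right_face (vx (Suc i)) c = rf i"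
        unfolding right_face_def t(4) using vx_Suc[OF il] coset_add[OF WP_g[of a "{a, c}"], of "vx i"]
        by (auto simp: insert_commute a_def c_def)
      ultimately have "left_face (vx (Suc i)) c \<notin> X"
        using sweptD[OF sw _ I(2) 2] nX by auto
      then have "rf (Suc i) \<notin> X"
        unfolding left_face_def right_face_def t(2,3) by (simp add: insert_commute)
      then show ?thesis
        using min_at_turn[OF il2] False 2 by (simp add: a_def c_def)
    qed
  qed
qed

lemma entered_flippable: assumes "entered i" shows "flippable X u"
  using assms
proof (induction "length u - i" arbitrary: i rule: less_induct)
  case less
  have "i < length u" using less.prems by (simp add: entered_def)
  then show ?case using entered_step[OF less.prems] less.hyps[of "Suc i"] by auto
qed

text \<open>The first uncrossed face on the right is met at its lowest vertex. Otherwise the third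
  edge \<open>c\<close> would come up to this vertex with the crossed face \<open>rf i'\<close> on
  its left and the uncrossed face on its right, which \<open>sweptD\<close> forbids.\<close>

lemma first_uncrossed:
  assumes i: "i < length u" "rf i \<notin> X" and least: "\<And>j. j < i \<Longrightarrow> rf j \<in> X"
  shows "entered i"
proof (cases i)
  case 0
  then show ?thesis
    unfolding entered_def using i by (auto simp: is_min_def)
next
  case (Suc i')
  have il: "Suc i' < length u" "i' < length u" using i Suc by auto
  have R: "rf i' \<in> X" using least Suc by simp
  define a where "a = u ! i'"
  define c where "c = rt (vx i') a"
  have I: "a \<in> I" "c \<in> I" "c \<noteq> a" using il by (simp_all add: a_def c_def)
  have ne: "u ! Suc i' \<noteq> rt (vx i') (u ! i')"
    using rf_step(2)[OF il(1)] R i Suc by auto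
  note t = turn[OF il(1) ne, folded a_def, folded c_def]
  consider "len (vx (Suc i') + g c) < len (vx (Suc i'))" | "len (vx (Suc i')) < len (vx (Suc i') + g c)"
    using len_add_g[of "vx (Suc i')" c] by auto
  then show ?thesis
  proof cases
    case 2
    then show ?thesis using min_at_turn[OF il(1) ne] i Suc by (simp add: a_def c_def)
  next
    case 1
    define z where "z = vx (Suc i') + g c"
    have zc: "z + g c = vx (Suc i')" by (simp add: z_def add.assoc)
    have zI: "z \<in> WP I" unfolding z_def using I by (intro WP_add WP_g) auto
    have lz: "len z = i'" using len_add_g[of "vx (Suc i')" c] 1 il by (auto simp: z_def)
    have "\<not> on_path u z c" using lz I(3) by (auto simp: on_path_nth[OF red_u] a_def)
    moreover have "rt z c = u ! Suc i'" "lf z c = a"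
      using t lz il lf_lf by (simp_all add: rt_def lf_def)
    moreover have "coset z {c, e} = coset (vx (Suc i')) {c, e}" for e
      using coset_add[OF WP_g[of c "{c, e}"], of z] zc by auto
    moreover have "coset (vx (Suc i')) {a, c} = coset (vx i') {a, c}"
      using coset_add[OF WP_g[of a "{a, c}"], of "vx i'"] vx_Suc[OF il(2)] by (auto simp: a_def)
    ultimately have "right_face z c = rf i" "left_face z c = rf i'"
      unfolding right_face_def left_face_def using t Suc by (simp_all add: a_def c_def insert_commute)
    then have False
      using sweptD[OF sw zI I(2)] \<open>\<not> on_path u z c\<close> R i 1 zc by (auto simp: z_def)
    then show ?thesis ..
  qed
qed

text \<open>If all faces to the right of \<open>u\<close> are crossed, then \<open>propagate\<close>
  carries crossing from left to right over every ascending edge. Induction on the length of a vertex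
  then reaches all faces around it: faces containing a descending edge are already seen from
  below.\<close>

lemma all_crossed:
  assumes all: "\<And>i. i < length u \<Longrightarrow> rf i \<in> X"
  shows "faces \<subseteq> X"
proof -
  have propagate: "right_face z b \<in> X"
    if "z \<in> WP I" "b \<in> I" "len z < len (z + g b)" "left_face z b \<in> X" for z b
  proof (cases "on_path u z b")
    case True
    then show ?thesis using all[of "len z"] by (simp add: on_path_nth[OF red_u])
  qed (use that sweptD[OF sw] in blast)
  have "\<forall>J. J \<subseteq> I \<and> card J = 2 \<longrightarrow> coset y J \<in> X" if "y \<in> WP I" for y
    using that
  proof (induction "len y" arbitrary: y rule: less_induct)
    case less
    show ?case
    proof (intro allI impI)
      fix J assume J: "J \<subseteq> I \<and> card J = 2"
      then obtain p q where pq: "J = {p, q}" "p \<noteq> q" "p \<in> I" "q \<in> I" by (auto simp: card_2_iff)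
      have *: "coset y J \<in> X" if "d \<in> J" "len (y + g d) < len y" for d
      proof -
        have "coset (y + g d) J \<in> X"
          using less.hyps[OF that(2)] that(1) J less.prems by auto
        then show ?thesis using coset_add[OF WP_g[OF that(1)], of y] by simp
      qed
      have asc: "len y < len (y + g d)" if "\<not> len (y + g d) < len y" for d
        using that len_add_g[OF WP_W[OF less.prems], of d] by auto
      show "coset y J \<in> X"
      proof (cases "\<exists>d\<in>J. len (y + g d) < len y")
        case False
        then have ascJ: "len y < len (y + g c)" if "c \<in> J" for c using asc that by blast
        \<comment> \<open>At \<open>y\<close> these two faces are separated by the ascending edge
          \<open>rt y b\<close>, so crossing advances clockwise by one face.\<close>
        have adv: "coset y {rt y b, lf y b} \<in> X"
          if "b \<in> I" "coset y {b, rt y b} \<in> X" "len y < len (y + g (rt y b))" for b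
          using propagate[OF less.prems, of "rt y b"] that
          by (simp add: left_face_def right_face_def insert_commute)
        show ?thesis
        proof (cases "\<exists>b\<in>I. len (y + g b) < len y")
          case True
          then obtain b where b: "b \<in> I" "len (y + g b) < len y" by blast
          then have "p \<noteq> b" "q \<noteq> b" using False pq(1) by auto
          then have "p = rt y b \<or> p = lf y b" "q = rt y b \<or> q = lf y b" using third[OF b(1)] pq(3,4) by blast+
          then have "J = {rt y b, lf y b}" using pq(1,2) by auto
          moreover have "{b, rt y b} \<subseteq> I \<and> card {b, rt y b} = 2" using rt_neq[OF b(1), of y, symmetric] b(1) by simp
          then have "coset (y + g b) {b, rt y b} \<in> X"
            using less.hyps[OF b(2)] less.prems b(1) by blast
          then have "coset y {b, rt y b} \<in> X" using coset_add[OF WP_g[of b "{b, rt y b}"], of y] by simp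
          ultimately show ?thesis using adv[OF b(1)] ascJ by simp
        next
          \<comment> \<open>Here \<open>y\<close> is the identity. The face to the right of the
            first edge of \<open>u\<close> is crossed, and two clockwise steps reach the remaining
            two faces.\<close>
          case no_desc: False
          obtain v where v: "v \<in> lists I" "red v" "pr v = y" using WP_red[OF less.prems] by blast
          have "v = []"
          proof (rule ccontr)
            assume "v \<noteq> []"
            then obtain v' a where "v = v' @ [a]" by (metis rev_exhaust)
            then show False using v no_desc by (auto simp: red_snoc add.assoc)
          qed
          then have y0: "y = 0" using v(3) by simp
          have "u \<noteq> []" using pr_u w0_desc I_nonempty by fastforce
          then have a: "rf 0 \<in> X" "u ! 0 \<in> I" using all[of 0] by auto
          define a0 where "a0 = u ! 0"
          have "coset y {a0, rt y a0} \<in> X" "a0 \<in> I" using a y0 by (simp_all add: right_face_def a0_def)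
          moreover from this have "coset y {rt y a0, lf y a0} \<in> X" using adv asc no_desc by simp
          moreover from calculation have "coset y {lf y a0, a0} \<in> X"
            using adv[of "rt y a0"] asc no_desc by simp
          moreover have "p = a0 \<or> p = rt y a0 \<or> p = lf y a0" "q = a0 \<or> q = rt y a0 \<or> q = lf y a0"
            using third[of a0] pq \<open>a0 \<in> I\<close> by blast+
          ultimately show ?thesis using pq(1,2) by (auto simp: insert_commute)
        qed
      qed (use * in blast)
    qed
  qed
  then show ?thesis unfolding faces_def by blast
qed

lemma ex_flippable: assumes "\<not> faces \<subseteq> X" shows "flippable X u"
proof -
  have "\<exists>i. i < length u \<and> rf i \<notin> X" using all_crossed assms by blast
  then obtain i where "i < length u \<and> rf i \<notin> X" "\<And>j. j < i \<Longrightarrow> \<not> (j < length u \<and> rf j \<notin> X)"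
    using exists_least_iff[of "\<lambda>i. i < length u \<and> rf i \<notin> X"] by blast
  then have "entered i" using first_uncrossed by (meson less_trans)
  then show ?thesis by (rule entered_flippable)
qed

end

text \<open>The flip gives up the edges having the face on their right and gains those having it on
  their left. Inserting the face into \<open>X\<close> changes the boundary formula in the same
  way.\<close>

lemma flip:
  assumes u: "full u" and sw: "swept p0 X u" and fl: "flippable X u"
  obtains a s t c where "s \<in> I" "t \<in> I" "s \<noteq> t" "m s t \<noteq> \<infinity>" "u = move_src m (a, s, t, c)"
    "full (move_tgt m (a, s, t, c))" "coset (pr a) {s, t} \<in> faces - X"
    "swept p0 (insert (coset (pr a) {s, t}) X) (move_tgt m (a, s, t, c))"
proof -
  obtain a s t k c where f: "u = a @ alt s t k @ c" "s \<in> I" "t = rt (pr a) s" "m s t = enat k"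
    "is_min {s, t} (pr a)" "coset (pr a) {s, t} \<notin> X"
    using fl unfolding flippable_def by blast
  have st: "s \<noteq> t" "t \<in> I" using f(2,3) rt_neq[OF f(2), of "pr a"] rt_I[OF f(2)] by metis+
  define u' where "u' = a @ alt t s k @ c"
  define F where "F = coset (pr a) {s, t}"
  have br: "pr (alt s t k) = pr (alt t s k)" using pr_braid[OF st(1) f(4)] .
  have aI: "a \<in> lists I" "c \<in> lists I" using u f(1) by (auto simp: full_def)
  have "alt t s k \<in> lists I" using set_alt[of t s k] st f(2) by (auto simp: in_lists_conv_set)
  then have u': "full u'"
    using u f(1) br aI by (simp add: full_def u'_def red_def)
  have "F \<in> faces"
    unfolding faces_def F_def using aI f(2) st by (auto intro!: exI[of _ "pr a"] exI[of _ "{s, t}"])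
  have "swept p0 (insert F X) u'"
    unfolding swept_def
  proof (intro allI impI)
    fix z b assume z: "z \<in> WP I" "b \<in> I" "len z < len (z + g b)"
    have 1: "of_bool (on_path u' z b) + (of_bool (on_side (pr a) s t k z b) :: nat) =
        of_bool (on_path u z b) + of_bool (on_side (pr a) t s k z b)"
      unfolding u'_def f(1) using on_path_flip[of a s t k c] u u' f(1) br by (simp add: full_def u'_def)
    have 2: "right_face z b = F \<longleftrightarrow> on_side (pr a) s t k z b" "left_face z b = F \<longleftrightarrow> on_side (pr a) t s k z b"
      unfolding F_def using right_face_iff[OF f(5,2,3,4)] left_face_iff[OF f(5,2,3,4)] z WP_W by blast+
    have 3: "of_bool (on_path u z b) + (of_bool (right_face z b \<in> X) :: nat) =
        of_bool (on_path p0 z b) + of_bool (left_face z b \<in> X)"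
      using sw z unfolding swept_def by blast
    have 4: "of_bool (Y \<in> insert F X) = (of_bool (Y = F) :: nat) + of_bool (Y \<in> X)" for Y
      using f(6) by (auto simp: F_def)
    show "of_bool (on_path u' z b) + (of_bool (right_face z b \<in> insert F X) :: nat) =
        of_bool (on_path p0 z b) + of_bool (left_face z b \<in> insert F X)"
      using 1 3 unfolding 4 2 by linarith
  qed
  then show ?thesis
    using that[of s t a c] f st u' \<open>F \<in> faces\<close> by (simp add: F_def u'_def)
qed

text \<open>With all faces crossed the two face terms cancel, so \<open>u\<close> and
  \<open>p0\<close> have the same edges: the path has come around the sphere to where it
  started.\<close>

lemma swept_all:
  assumes "full u" "full p0" "swept p0 X u" "faces \<subseteq> X" shows "u = p0"
proof -
  have r: "red u" "red p0" "u \<in> lists I" using assms(1,2) by (auto simp: full_def)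
  have l: "length u = length p0" using assms(1,2) by (simp add: full_def red_def)
  have "take n u = take n p0" if "n \<le> length u" for n
    using that
  proof (induction n)
    case (Suc n)
    define z where "z = pr (take n u)"
    have lz: "len z = n" using len_take[OF r(1)] Suc.prems by (simp add: z_def)
    have on: "on_path u z (u ! n)" using on_path_nth[OF r(1)] lz Suc.prems by (simp add: z_def)
    have z: "z \<in> WP I" "u ! n \<in> I"
      unfolding z_def using r(3) Suc.prems by (auto simp: in_lists_conv_set dest: in_set_takeD)
    have "len z < len (z + g (u ! n))" using on_path_asc[OF r(1) on] .
    then have "on_path p0 z (u ! n)"
      using assms(3,4) z on right_face_faces[OF z] left_face_faces[OF z] unfolding swept_def
      by (auto simp: of_bool_def split: if_splits)
    then have "p0 ! n = u ! n" using on_path_nth[OF r(2)] lz by simp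
    then show ?case using Suc l by (simp add: take_Suc_conv_app_nth)
  qed simp
  from this[of "length u"] show ?thesis using l by simp
qed

lemma sweep:
  assumes "full p0" "full u" "swept p0 X u" "X \<subseteq> faces" "finite faces"
  shows "\<exists>es. braid_path I w0 u es p0 \<and> distinct (map crossed es) \<and> set (map crossed es) = faces - X"
  using assms(2-4)
proof (induction "card (faces - X)" arbitrary: u X rule: less_induct)
  case less
  show ?case
  proof (cases "faces \<subseteq> X")
    case True
    then show ?thesis
      using swept_all[OF less.prems(1) assms(1) less.prems(2)] by (intro exI[of _ "[]"]) auto
  next
    case False
    then have "flippable X u" using ex_flippable less.prems by blast
    then obtain a s t c where f: "s \<in> I" "t \<in> I" "s \<noteq> t" "m s t \<noteq> \<infinity>" "u = move_src m (a, s, t, c)"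
      "full (move_tgt m (a, s, t, c))" "coset (pr a) {s, t} \<in> faces - X"
      "swept p0 (insert (coset (pr a) {s, t}) X) (move_tgt m (a, s, t, c))"
      using flip[OF less.prems(1,2)] by metis
    define F where "F = coset (pr a) {s, t}"
    have "card (faces - insert F X) < card (faces - X)"
      using f(7) assms(5) by (intro psubset_card_mono) (auto simp: F_def)
    then obtain es where es: "braid_path I w0 (move_tgt m (a, s, t, c)) es p0" "distinct (map crossed es)"
      "set (map crossed es) = faces - insert F X"
      using less.hyps[of "insert F X" "move_tgt m (a, s, t, c)"] f less.prems(3) by (auto simp: F_def)
    have "braid_path I w0 u ((a, s, t, c) # es) p0"
      using f es(1) less.prems(1) by simp
    moreover have "distinct (map crossed ((a, s, t, c) # es))"
      using es(2,3) by (auto simp: F_def)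
    moreover have "set (map crossed ((a, s, t, c) # es)) = faces - X"
      using es(3) f(7) by (auto simp: F_def)
    ultimately show ?thesis by blast
  qed
qed

lemma ex_cycle:
  "\<exists>u es. u \<in> red_words I w0 \<and> braid_path I w0 u es u \<and> distinct (map crossed es) \<and>
    set (map crossed es) = rank2_cosets I"
proof -
  obtain p0 where p0: "p0 \<in> lists I" "red p0" "pr p0 = w0" using WP_red[OF w0_WP] by blast
  then have "full p0" by (simp add: full_def)
  obtain a where "a \<in> I" using I_nonempty by blast
  then have finI: "finite I" using I_eq by (metis finite.emptyI finite.insertI)
  have "finite (WP I)" using longest_finite[OF w0_WP w0_desc finI] .
  moreover have "faces \<subseteq> (\<lambda>(y, J). coset y J) ` (WP I \<times> Pow I)" unfolding faces_def by auto
  ultimately have "finite faces" using finI by (meson finite_Pow_iff finite_SigmaI finite_imageI finite_subset)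
  then show ?thesis
    using sweep[OF \<open>full p0\<close> \<open>full p0\<close>, of "{}"] \<open>full p0\<close> by (auto simp: swept_def)
qed

end

lemma (in coxeter) ex_zam_cycle:
  assumes "distinct [r, s, t]" "x \<in> WP {r, s, t}" "\<And>a. a \<in> {r, s, t} \<Longrightarrow> len (x + g a) < len x"
  shows "\<exists>u es. u \<in> red_words {r, s, t} x \<and> braid_path {r, s, t} x u es u \<and> distinct (map crossed es) \<and>
    set (map crossed es) = rank2_cosets {r, s, t}"
proof -
  define nx where "nx a = (if a = r then s else if a = s then t else r)" for a
  define pv where "pv a = (if a = r then t else if a = s then r else s)" for a
  interpret rank3 m g "{r, s, t}" nx pv x
    by unfold_locales (use assms in \<open>auto simp: nx_def pv_def\<close>)
  show ?thesis by (rule ex_cycle)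
qed

section \<open>The Coxeter group of a Coxeter matrix\<close>

lemma cox_eq_append: "cox_eq m u v \<Longrightarrow> cox_eq m (a @ u @ b) (a @ v @ b)"
proof (induction arbitrary: a b rule: cox_eq.induct)
  case (cancel u s v)
  show ?case using cox_eq.cancel[of m "a @ u" s "v @ b"] by simp
next
  case (braid s t k u v)
  show ?case using cox_eq.braid[of s t m k "a @ u" "v @ b", OF braid] by simp
next
  case (trans u v w)
  then show ?case by (meson cox_eq.trans)
qed (auto intro: cox_eq.refl cox_eq.sym)

definition cox_class :: "('a \<Rightarrow> 'a \<Rightarrow> enat) \<Rightarrow> 'a list \<Rightarrow> 'a list set" where
  "cox_class m u = {v. cox_eq m u v}"

lemma cox_class_eq_iff: "cox_class m u = cox_class m v \<longleftrightarrow> cox_eq m u v"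
  unfolding cox_class_def by (auto intro: cox_eq.refl cox_eq.sym cox_eq.trans)

text \<open>Left multiplication on congruence classes of words, extended by the identity to all
  other sets of words, so that it is a permutation of a whole type and lives in an instance of
  \<open>group_add\<close>.\<close>

definition cox_gen :: "('a \<Rightarrow> 'a \<Rightarrow> enat) \<Rightarrow> 'a \<Rightarrow> 'a list set permutation" where
  "cox_gen m s = Perm (\<lambda>X. if X \<in> range (cox_class m) then cox_class m (s # (SOME u. X = cox_class m u)) else X)"

lemma cox_class_Cons_SOME:
  "cox_class m (s # (SOME u'. cox_class m u = cox_class m u')) = cox_class m (s # u)"
proof -
  have "cox_class m u = cox_class m (SOME u'. cox_class m u = cox_class m u')"
    by (rule someI[of _ u]) simp
  then show ?thesis
    using cox_eq_append[of m _ u "[s]" "[]"] by (simp add: cox_class_eq_iff cox_eq.sym)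
qed

lemma apply_cox_gen:
  "apply_perm (cox_gen m s) X =
    (if X \<in> range (cox_class m) then cox_class m (s # (SOME u. X = cox_class m u)) else X)"
proof -
  let ?f = "\<lambda>X. if X \<in> range (cox_class m) then cox_class m (s # (SOME u. X = cox_class m u)) else X"
  have "?f (?f X) = X" for X
  proof (cases "X \<in> range (cox_class m)")
    case True
    then obtain u where X: "X = cox_class m u" by blast
    have f: "?f (cox_class m v) = cox_class m (s # v)" for v
      by (simp only: cox_class_Cons_SOME rangeI if_True)
    have "cox_class m (s # s # u) = cox_class m u"
      using cox_eq.cancel[of m "[]" s u] by (simp add: cox_class_eq_iff)
    then show ?thesis
      unfolding X f .
  next
    case False
    then show ?thesis by (simp only: if_False)
  qed
  then have "bij ?f" by (rule involuntory_imp_bij)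
  then show ?thesis unfolding cox_gen_def by (simp only: Perm_inverse mem_Collect_eq)
qed

lemma apply_cox_word:
  "apply_perm (sum_list (map (cox_gen m) u)) (cox_class m v) = cox_class m (u @ v)"
  by (induction u)
    (simp_all add: zero_permutation.rep_eq plus_permutation.rep_eq apply_cox_gen cox_class_Cons_SOME)

lemma apply_cox_word_other:
  "X \<notin> range (cox_class m) \<Longrightarrow> apply_perm (sum_list (map (cox_gen m) u)) X = X"
  by (induction u) (simp_all add: zero_permutation.rep_eq plus_permutation.rep_eq apply_cox_gen)

text \<open>This is the left regular representation; it is faithful because applying a product to
  the class of the empty word gives back the class of the word.\<close>

lemma coxeter_cox_gen:
  assumes "\<And>s t. s \<noteq> t \<Longrightarrow> m s t = m t s" "\<And>s t. s \<noteq> t \<Longrightarrow> m s t \<ge> 2"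
  shows "coxeter m (cox_gen m)"
proof
  fix u v
  show "sum_list (map (cox_gen m) u) = sum_list (map (cox_gen m) v) \<longleftrightarrow> cox_eq m u v"
  proof
    assume "sum_list (map (cox_gen m) u) = sum_list (map (cox_gen m) v)"
    then have "apply_perm (sum_list (map (cox_gen m) u)) (cox_class m []) =
        apply_perm (sum_list (map (cox_gen m) v)) (cox_class m [])" by simp
    then show "cox_eq m u v"
      by (simp only: apply_cox_word cox_class_eq_iff append_Nil2)
  next
    assume eq: "cox_eq m u v"
    have "apply_perm (sum_list (map (cox_gen m) u)) X = apply_perm (sum_list (map (cox_gen m) v)) X" for X
    proof (cases "X \<in> range (cox_class m)")
      case True
      then obtain w where X: "X = cox_class m w" by blast
      show ?thesis
        using cox_eq_append[OF eq, of "[]" w] by (simp add: X apply_cox_word cox_class_eq_iff)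
    qed (simp add: apply_cox_word_other)
    then show "sum_list (map (cox_gen m) u) = sum_list (map (cox_gen m) v)"
      by (metis apply_perm_inject ext)
  qed
qed (use assms in auto)

subsection \<open>Presented groups\<close>

lemma pres_eq_lists: "pres_eq X R u v \<Longrightarrow> u \<in> lists (X \<times> UNIV) \<and> v \<in> lists (X \<times> UNIV)"
  by (induction rule: pres_eq.induct) auto

lemma pres_eq_append:
  assumes "pres_eq X R u v" "a \<in> lists (X \<times> UNIV)" "b \<in> lists (X \<times> UNIV)"
  shows "pres_eq X R (a @ u @ b) (a @ v @ b)"
  using assms
proof (induction arbitrary: a b rule: pres_eq.induct)
  case (cancel u v x c)
  then show ?case using pres_eq.cancel[of "a @ u" X "v @ b" x R c] by simp
next
  case (rel u v l r)
  then show ?case using pres_eq.rel[of "a @ u" X "v @ b" l r R] by simp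
next
  case (refl u)
  then show ?case by (intro pres_eq.refl) (simp only: append_in_lists_conv)
next
  case (trans u v w)
  then show ?case by (meson pres_eq.trans)
qed (auto intro: pres_eq.sym)

definition pres_class where "pres_class X R u = {w. pres_eq X R u w}"

lemma pres_class_eq_iff:
  "\<lbrakk>u \<in> lists (X \<times> UNIV); v \<in> lists (X \<times> UNIV)\<rbrakk> \<Longrightarrow>
    pres_class X R u = pres_class X R v \<longleftrightarrow> pres_eq X R u v"
  unfolding pres_class_def by (auto intro: pres_eq.refl pres_eq.sym pres_eq.trans)

lemma pres_mult:
  assumes "u \<in> lists (X \<times> UNIV)" "v \<in> lists (X \<times> UNIV)"
  shows "pres_class X R u \<otimes>\<^bsub>presented_group X R\<^esub> pres_class X R v = pres_class X R (u @ v)"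
proof -
  have "(\<exists>u'. pres_eq X R u u' \<and> (\<exists>v'. pres_eq X R v v' \<and> pres_eq X R (u' @ v') w)) \<longleftrightarrow> pres_eq X R (u @ v) w" for w
  proof
    assume "\<exists>u'. pres_eq X R u u' \<and> (\<exists>v'. pres_eq X R v v' \<and> pres_eq X R (u' @ v') w)"
    then obtain u' v' where *: "pres_eq X R u u'" "pres_eq X R v v'" "pres_eq X R (u' @ v') w" by blast
    have "pres_eq X R (u @ v) (u' @ v)" using pres_eq_append[OF *(1), of "[]" v] assms by simp
    moreover have "pres_eq X R (u' @ v) (u' @ v')"
      using pres_eq_append[OF *(2), of u' "[]"] pres_eq_lists[OF *(1)] by simp
    ultimately show "pres_eq X R (u @ v) w" using *(3) by (meson pres_eq.trans)
  qed (use assms pres_eq.refl in blast)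
  then show ?thesis by (simp add: presented_group_def pres_class_def)
qed

lemma pres_carrier: "carrier (presented_group X R) = pres_class X R ` lists (X \<times> UNIV)"
  by (auto simp: presented_group_def pres_class_def quotient_def)

lemma pres_one: "\<one>\<^bsub>presented_group X R\<^esub> = pres_class X R []"
  by (simp add: presented_group_def pres_class_def)

section \<open>Comparison of the presented group with the group of permutations\<close>

locale coxeter_system =
  fixes S :: "'a set" and m :: "'a \<Rightarrow> 'a \<Rightarrow> enat"
  assumes cm: "coxeter_matrix S m"
begin

text \<open>Letters outside \<open>S\<close> become further generators, related to nothing.\<close>

definition mS :: "'a \<Rightarrow> 'a \<Rightarrow> enat" where
  "mS s t = (if s \<in> S \<and> t \<in> S then m s t else \<infinity>)"

lemma mS_eq [simp]: "\<lbrakk>s \<in> S; t \<in> S\<rbrakk> \<Longrightarrow> mS s t = m s t"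
  by (simp add: mS_def)

sublocale coxeter mS "cox_gen mS"
  by (rule coxeter_cox_gen) (use cm in \<open>auto simp: mS_def coxeter_matrix_def\<close>)

abbreviation R where "R \<equiv> coxeter_relations S m"
abbreviation G where "G \<equiv> coxeter_group S m"
abbreviation wd where "wd \<equiv> word_elt S m"

definition emb :: "'a list \<Rightarrow> ('a \<times> bool) list" where
  "emb = map (\<lambda>x. (x, True))"

lemma emb_lists [simp]: "emb u \<in> lists (S \<times> UNIV) \<longleftrightarrow> u \<in> lists S"
  by (auto simp: emb_def in_lists_conv_set)

lemma emb_append [simp]: "emb (u @ v) = emb u @ emb v" and emb_Nil [simp]: "emb [] = []"
  by (simp_all add: emb_def)

lemma emb_filter [simp, intro]: "emb (filter (\<lambda>x. x \<in> S) u) \<in> lists (S \<times> UNIV)"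
  by (simp only: emb_lists) auto

lemma generator_eq: "generator S m s = pres_class S R (emb [s])"
  by (simp add: generator_def pres_class_def emb_def)

lemma word_elt_eq: "u \<in> lists S \<Longrightarrow> wd u = pres_class S R (emb u)"
proof (induction u)
  case Nil
  then show ?case by (simp add: word_elt_def coxeter_group_def pres_one)
next
  case (Cons s u)
  then have "wd (s # u) = pres_class S R (emb [s]) \<otimes>\<^bsub>presented_group S R\<^esub> pres_class S R (emb u)"
    by (simp add: word_elt_def generator_eq coxeter_group_def)
  also have "\<dots> = pres_class S R (emb [s] @ emb u)"
    using Cons.prems by (intro pres_mult) auto
  finally show ?case by (simp add: emb_def)
qed

lemma pres_eq_cox_eq: "pres_eq S R a b \<Longrightarrow> cox_eq mS (map fst a) (map fst b)"
proof (induction rule: pres_eq.induct)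
  case (cancel u v x b)
  show ?case using cox_eq.cancel[of mS "map fst u" x "map fst v"] by simp
next
  case (rel u v l r)
  from rel(3) consider s where "s \<in> S" "l = emb [s, s]" "r = []"
    | s t k where "s \<in> S" "t \<in> S" "s \<noteq> t" "m s t = enat k" "l = emb (alt s t k)" "r = emb (alt t s k)"
    unfolding coxeter_relations_def emb_def by blast
  then show ?case
  proof cases
    case 1
    then show ?thesis using cox_eq.cancel[of mS "map fst u" s "map fst v"] by (simp add: emb_def)
  next
    case 2
    then show ?thesis
      using cox_eq.braid[of s t mS k "map fst u" "map fst v"] by (simp add: emb_def comp_def)
  qed
qed (auto intro: cox_eq.intros)

text \<open>Erasing the letters outside \<open>S\<close> turns each congruence step into a step of
  the presentation. Cancelled foreign letters vanish, and braid relations involve letters of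
  \<open>S\<close> only, as \<open>mS\<close> is infinite elsewhere.\<close>

lemma cox_eq_pres_eq:
  "cox_eq mS u v \<Longrightarrow> pres_eq S R (emb (filter (\<lambda>x. x \<in> S) u)) (emb (filter (\<lambda>x. x \<in> S) v))"
proof (induction rule: cox_eq.induct)
  case (refl u)
  show ?case by (rule pres_eq.refl) (rule emb_filter)
next
  case (cancel u s v)
  let ?f = "\<lambda>u. emb (filter (\<lambda>x. x \<in> S) u)"
  show ?case
  proof (cases "s \<in> S")
    case True
    then have "(emb [s, s], []) \<in> R" unfolding coxeter_relations_def emb_def by blast
    then have "pres_eq S R (?f u @ emb [s, s] @ ?f v) (?f u @ [] @ ?f v)"
      using True by (intro pres_eq.rel emb_filter) (simp_all only: emb_lists, auto)
    then show ?thesis using True by (simp add: emb_def)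
  next
    case False
    then show ?thesis using pres_eq.refl[OF emb_filter[of "u @ v"]] by simp
  qed
next
  case (braid s t k u v)
  let ?f = "\<lambda>u. emb (filter (\<lambda>x. x \<in> S) u)"
  have st: "s \<in> S" "t \<in> S" "m s t = enat k" using braid by (auto simp: mS_def split: if_splits)
  then have "(emb (alt s t k), emb (alt t s k)) \<in> R"
    unfolding coxeter_relations_def emb_def using braid by blast
  moreover have "filter (\<lambda>x. x \<in> S) (alt s t k) = alt s t k" "filter (\<lambda>x. x \<in> S) (alt t s k) = alt t s k"
    using set_alt[of s t k] set_alt[of t s k] st by (auto simp: filter_id_conv)
  moreover from this have "alt s t k \<in> lists S" "alt t s k \<in> lists S" by (auto simp: filter_id_conv)
  ultimately show ?case
    using pres_eq.rel[OF emb_filter emb_filter, of "emb (alt s t k)" "emb (alt t s k)" R u v] by simp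
next
  case (trans u v w)
  then show ?case by (meson pres_eq.trans)
qed (rule pres_eq.sym)

lemma word_elt_eq_iff: assumes "u \<in> lists S" "v \<in> lists S" shows "wd u = wd v \<longleftrightarrow> pr u = pr v"
proof -
  have f: "filter (\<lambda>x. x \<in> S) w = w" if "w \<in> lists S" for w
    using that by (auto simp: filter_id_conv)
  have "wd u = wd v \<longleftrightarrow> pres_eq S R (emb u) (emb v)"
    using assms by (simp add: word_elt_eq pres_class_eq_iff)
  also have "\<dots> \<longleftrightarrow> cox_eq mS u v"
    using pres_eq_cox_eq[of "emb u" "emb v"] cox_eq_pres_eq[of u v] assms by (auto simp: f emb_def comp_def)
  finally show ?thesis by (simp add: pr_iff)
qed

lemma word_elt_append: "\<lbrakk>u \<in> lists S; v \<in> lists S\<rbrakk> \<Longrightarrow> wd (u @ v) = wd u \<otimes>\<^bsub>G\<^esub> wd v"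
  by (simp add: word_elt_eq coxeter_group_def pres_mult)

lemma word_elt_Nil: "wd [] = \<one>\<^bsub>G\<^esub>"
  by (simp add: word_elt_def)

text \<open>Inserting \<open>xx\<close> after a formal inverse of \<open>x\<close> and cancelling
  shows that the inverse letter equals \<open>x\<close>.\<close>

lemma pres_eq_emb: "a \<in> lists (S \<times> UNIV) \<Longrightarrow> pres_eq S R a (emb (map fst a))"
proof (induction a)
  case (Cons p a)
  obtain x b where p: "p = (x, b)" by (cases p)
  have x: "x \<in> S" and a: "a \<in> lists (S \<times> UNIV)" using Cons.prems p by auto
  have xb: "pres_eq S R [(x, b)] [(x, True)]"
  proof (cases b)
    case False
    have "(emb [x, x], []) \<in> R" unfolding coxeter_relations_def emb_def using x by blast
    then have "pres_eq S R ([(x, False)] @ emb [x, x] @ []) ([(x, False)] @ [] @ [])"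
      using x by (intro pres_eq.rel) auto
    moreover have "pres_eq S R ([] @ [(x, False), (x, \<not> False)] @ [(x, True)]) ([] @ [(x, True)])"
      using x by (intro pres_eq.cancel) auto
    ultimately show ?thesis using False by (simp add: emb_def) (meson pres_eq.sym pres_eq.trans)
  qed (use x in \<open>auto intro: pres_eq.refl\<close>)
  have "pres_eq S R ([(x, b)] @ a) ([(x, True)] @ a)"
    using pres_eq_append[OF xb, of "[]" a] a by simp
  moreover have "pres_eq S R ([(x, True)] @ a) ([(x, True)] @ emb (map fst a))"
    using pres_eq_append[OF Cons.IH[OF a], of "[(x, True)]" "[]"] x by simp
  ultimately show ?case using p by (simp add: emb_def) (meson pres_eq.trans)
qed (simp add: pres_eq.refl)

lemma carrier_eq: "carrier G = wd ` lists S"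
proof
  show "carrier G \<subseteq> wd ` lists S"
  proof
    fix x assume "x \<in> carrier G"
    then obtain a where a: "a \<in> lists (S \<times> UNIV)" "x = pres_class S R a"
      by (auto simp: coxeter_group_def pres_carrier)
    then have l: "map fst a \<in> lists S" by (auto simp: in_lists_conv_set)
    have "x = pres_class S R (emb (map fst a))"
      using pres_eq_emb[OF a(1)] a pres_class_eq_iff[of a S "emb (map fst a)" R] l by auto
    then show "x \<in> wd ` lists S" using l by (auto simp: word_elt_eq)
  qed
  show "wd ` lists S \<subseteq> carrier G"
  proof (rule image_subsetI)
    fix u assume u: "u \<in> lists S"
    then have "emb u \<in> lists (S \<times> UNIV)" by simp
    then show "wd u \<in> carrier G" unfolding coxeter_group_def pres_carrier word_elt_eq[OF u] by (rule imageI)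
  qed
qed

lemma wd_carrier [simp]: "u \<in> lists S \<Longrightarrow> wd u \<in> carrier G"
  by (simp add: carrier_eq)

lemma group_G: "group G"
proof (rule groupI)
  show "\<one>\<^bsub>G\<^esub> \<in> carrier G" using wd_carrier[of "[]"] by (simp add: word_elt_Nil)
  fix x assume "x \<in> carrier G"
  then obtain u where u: "u \<in> lists S" "x = wd u" by (auto simp: carrier_eq)
  show "\<one>\<^bsub>G\<^esub> \<otimes>\<^bsub>G\<^esub> x = x"
    using word_elt_append[of "[]" u] u by (simp add: word_elt_Nil)
  have r: "rev u \<in> lists S" using u by (auto simp: in_lists_conv_set)
  have "wd (rev u @ u) = wd []" using r u by (subst word_elt_eq_iff) (auto simp: pr_rev)
  then show "\<exists>y\<in>carrier G. y \<otimes>\<^bsub>G\<^esub> x = \<one>\<^bsub>G\<^esub>"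
    using r u word_elt_append[OF r u(1)] by (intro bexI[of _ "wd (rev u)"]) (auto simp: word_elt_Nil)
  fix y assume "y \<in> carrier G"
  then obtain v where v: "v \<in> lists S" "y = wd v" by (auto simp: carrier_eq)
  show "x \<otimes>\<^bsub>G\<^esub> y \<in> carrier G" using u v wd_carrier[of "u @ v"] by (simp add: word_elt_append)
  fix z assume "z \<in> carrier G"
  then obtain w where w: "w \<in> lists S" "z = wd w" by (auto simp: carrier_eq)
  show "x \<otimes>\<^bsub>G\<^esub> y \<otimes>\<^bsub>G\<^esub> z = x \<otimes>\<^bsub>G\<^esub> (y \<otimes>\<^bsub>G\<^esub> z)"
    using word_elt_append[of "u @ v" w] word_elt_append[of u "v @ w"] u v w
    by (simp add: word_elt_append)
qed

lemma generator_wd: "s \<in> S \<Longrightarrow> generator S m s = wd [s]"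
  by (simp add: generator_eq word_elt_eq)

lemma parabolic_eq: assumes "I \<subseteq> S" shows "parabolic S m I = wd ` lists I"
proof
  have IS: "u \<in> lists I \<Longrightarrow> u \<in> lists S" for u using assms lists_mono by blast
  show "parabolic S m I \<subseteq> wd ` lists I"
  proof
    fix x assume "x \<in> parabolic S m I"
    then show "x \<in> wd ` lists I"
      unfolding parabolic_def
    proof (induction rule: generate.induct)
      case one
      then show ?case by (intro image_eqI[of _ _ "[]"]) (simp_all add: word_elt_Nil)
    next
      case (incl h)
      then obtain s where "s \<in> I" "h = wd [s]" using assms generator_wd by blast
      then show ?case by (intro image_eqI[of _ _ "[s]"]) auto
    next
      case (inv h)
      then obtain s where s: "s \<in> I" "h = wd [s]" using assms generator_wd by blast
      have "wd [s, s] = wd []" using s assms by (subst word_elt_eq_iff) auto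
      then have "h \<otimes>\<^bsub>G\<^esub> h = \<one>\<^bsub>G\<^esub>"
        using word_elt_append[of "[s]" "[s]"] s assms by (auto simp: word_elt_Nil)
      then have "m_inv G h = h"
        using s assms by (intro group.inv_equality[OF group_G]) auto
      then show ?case using s by (intro image_eqI[of _ _ "[s]"]) auto
    next
      case (eng h1 h2)
      then obtain u v where "u \<in> lists I" "v \<in> lists I" "h1 = wd u" "h2 = wd v" by blast
      then show ?case by (intro image_eqI[of _ _ "u @ v"]) (auto simp: word_elt_append IS)
    qed
  qed
  show "wd ` lists I \<subseteq> parabolic S m I"
  proof
    fix x assume "x \<in> wd ` lists I"
    then obtain u where u: "u \<in> lists I" "x = wd u" by blast
    have "wd u \<in> parabolic S m I"
      using u(1)
    proof (induction u)
      case Nil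
      show ?case by (simp add: parabolic_def word_elt_Nil generate.one)
    next
      case (Cons s u)
      then have "generator S m s \<otimes>\<^bsub>G\<^esub> wd u \<in> parabolic S m I"
        unfolding parabolic_def by (intro generate.eng[OF generate.incl[OF imageI]]) auto
      then show ?case by (simp add: word_elt_def)
    qed
    then show "x \<in> parabolic S m I" using u by simp
  qed
qed

lemma cox_length_wd: assumes "u \<in> lists S" shows "cox_length S m (wd u) = len (pr u)"
  unfolding cox_length_def
proof (rule Least_equality)
  obtain v where v: "v \<in> lists S" "red v" "pr v = pr u" using WP_red[OF WP_pr[OF assms]] by blast
  then show "\<exists>v\<in>lists S. wd v = wd u \<and> length v = len (pr u)"
    using assms by (intro bexI[of _ v]) (simp_all add: word_elt_eq_iff red_def)
next
  fix n assume "\<exists>v\<in>lists S. wd v = wd u \<and> length v = n"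
  then show "len (pr u) \<le> n" using assms len_le by (auto simp: word_elt_eq_iff) (metis len_le)
qed

lemma reduced_exprs_wd:
  assumes "u \<in> lists S" shows "reduced_exprs S m (wd u) = red_words S (pr u)"
  unfolding reduced_exprs_def red_words_def
proof (rule Collect_cong)
  fix v
  show "v \<in> lists S \<and> wd v = wd u \<and> length v = cox_length S m (wd u) \<longleftrightarrow> v \<in> lists S \<and> red v \<and> pr v = pr u"
  proof (cases "v \<in> lists S")
    case True
    then show ?thesis
      unfolding word_elt_eq_iff[OF True assms] cox_length_wd[OF assms] red_def by metis
  qed blast
qed

lemma l_coset_wd:
  assumes "a \<in> lists S" "J \<subseteq> S"
  shows "wd a <#\<^bsub>G\<^esub> parabolic S m J = wd ` (@) a ` lists J"
proof -
  have JS: "u \<in> lists J \<Longrightarrow> u \<in> lists S" for u using assms lists_mono by blast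
  have "wd a <#\<^bsub>G\<^esub> parabolic S m J = (\<lambda>v. wd a \<otimes>\<^bsub>G\<^esub> wd v) ` lists J"
    by (auto simp: l_coset_def parabolic_eq[OF assms(2)])
  also have "\<dots> = (\<lambda>v. wd (a @ v)) ` lists J"
    using assms JS by (intro image_cong) (simp_all add: word_elt_append)
  finally show ?thesis by (simp add: image_image)
qed

lemma coset_pr: "coset (pr a) J = pr ` (@) a ` lists J"
  by (simp add: coset_def WP_def image_image)

text \<open>Cosets in both groups are images of the same sets of words under \<open>wd\<close> and
  \<open>pr\<close>, and these maps identify the same words.\<close>

lemma l_coset_eq_iff:
  assumes "a \<in> lists S" "J \<subseteq> S" "b \<in> lists S" "K \<subseteq> S"
  shows "wd a <#\<^bsub>G\<^esub> parabolic S m J = wd b <#\<^bsub>G\<^esub> parabolic S m K \<longleftrightarrow> coset (pr a) J = coset (pr b) K"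
proof -
  have sub: "wd ` Z \<subseteq> wd ` Z' \<longleftrightarrow> pr ` Z \<subseteq> pr ` Z'" if "Z \<subseteq> lists S" "Z' \<subseteq> lists S" for Z Z'
    using that word_elt_eq_iff by (auto simp: image_subset_iff image_iff) (metis subsetD)+
  have l: "(@) a ` lists J \<subseteq> lists S" if "a \<in> lists S" "J \<subseteq> S" for a J
    using that lists_mono[of J S] by (intro image_subsetI) (auto simp only: append_in_lists_conv)
  have "(@) a ` lists J \<subseteq> lists S" "(@) b ` lists K \<subseteq> lists S" using l assms by simp_all
  then show ?thesis
    using assms sub unfolding set_eq_subset by (simp add: l_coset_wd coset_pr)
qed

text \<open>\<open>ARG_MAX\<close> only names some maximal element, so the uniqueness part of
  \<open>longest_max\<close> is needed to identify it.\<close>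

lemma longest_elt_wd:
  assumes "I \<subseteq> S" "u \<in> lists I" "\<And>s. s \<in> I \<Longrightarrow> len (pr u + cox_gen mS s) < len (pr u)"
  shows "longest_elt S m I = wd u"
  unfolding longest_elt_def
proof (rule arg_maxI[of "\<lambda>w. w \<in> parabolic S m I" "wd u"])
  have IS: "v \<in> lists I \<Longrightarrow> v \<in> lists S" for v using assms lists_mono by blast
  show "wd u \<in> parabolic S m I" using assms by (simp add: parabolic_eq)
  show "\<not> cox_length S m y > cox_length S m (wd u)" if "y \<in> parabolic S m I" for y
  proof -
    obtain v where "v \<in> lists I" "y = wd v" using \<open>y \<in> _\<close> by (auto simp: parabolic_eq[OF assms(1)])
    then show ?thesis
      using longest_max(1)[OF WP_pr[OF assms(2)] assms(3) WP_pr[of v]] assms(2) IS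
      by (simp add: cox_length_wd not_less)
  qed
  fix x assume x: "x \<in> parabolic S m I" "\<forall>y. y \<in> parabolic S m I \<longrightarrow> \<not> cox_length S m x < cox_length S m y"
  then obtain v where v: "v \<in> lists I" "x = wd v" by (auto simp: parabolic_eq[OF assms(1)])
  have "\<not> cox_length S m x < cox_length S m (wd u)" using x(2) assms by (simp add: parabolic_eq)
  then have "len (pr v) = len (pr u)"
    using longest_max(1)[OF WP_pr[OF assms(2)] assms(3) WP_pr[OF v(1)]] v assms(2) IS
    by (simp add: cox_length_wd)
  then have "pr v = pr u" using longest_max(2)[OF WP_pr[OF assms(2)] assms(3) WP_pr[OF v(1)]] by blast
  then show "x = wd u" using v assms(2) IS word_elt_eq_iff by blast
qed

lemma move_src_mS: "\<lbrakk>s \<in> S; t \<in> S\<rbrakk> \<Longrightarrow> move_src mS (a, s, t, b) = move_src m (a, s, t, b)"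
  and move_tgt_mS: "\<lbrakk>s \<in> S; t \<in> S\<rbrakk> \<Longrightarrow> move_tgt mS (a, s, t, b) = move_tgt m (a, s, t, b)"
  using cm by (auto simp: coxeter_matrix_def)

lemma red_words_mono: "I \<subseteq> J \<Longrightarrow> u \<in> red_words I w \<Longrightarrow> u \<in> red_words J w"
  using lists_mono[of I J] by (auto simp: red_words_def)

lemma gamma_path_braid_path:
  assumes "I \<subseteq> S" "longest_elt S m I = wd p" "p \<in> lists S"
  shows "braid_path I (pr p) u es v \<Longrightarrow> u \<in> red_words I (pr p) \<Longrightarrow> gamma_path S m I u es v"
proof (induction es arbitrary: u)
  case Nil
  then show ?case using red_words_mono[OF assms(1)] by (simp add: assms(2) reduced_exprs_wd[OF assms(3)])
next
  case (Cons e es)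
  obtain a s t c where e: "e = (a, s, t, c)" by (cases e) auto
  have st: "s \<in> S" "t \<in> S" using Cons.prems e assms(1) by auto
  note mv = move_src_mS[OF st] move_tgt_mS[OF st]
  have *: "u = move_src m (a, s, t, c)" "move_tgt m (a, s, t, c) \<in> red_words I (pr p)" "s \<noteq> t" "m s t \<noteq> \<infinity>"
    using Cons.prems(1) st unfolding e braid_path.simps mv by auto
  have "gamma_path S m I (move_tgt m e) es v"
    using Cons.IH[of "move_tgt m e"] Cons.prems(1) unfolding e braid_path.simps mv by blast
  moreover have "gamma_edge S m I e"
    using * Cons.prems(2) red_words_mono[OF assms(1)] st
    unfolding e gamma_edge.simps assms(2) reduced_exprs_wd[OF assms(3)] by blast
  ultimately show ?case using * by (simp add: e)
qed

lemma braid_path_letters: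
  "\<lbrakk>braid_path J w u es v; (a, s, t, c) \<in> set es\<rbrakk> \<Longrightarrow> a \<in> lists J \<and> s \<in> J \<and> t \<in> J"
proof (induction es arbitrary: u)
  case (Cons e es)
  obtain a' s' t' c' where e: "e = (a', s', t', c')" by (cases e) auto
  show ?case using Cons unfolding e by (auto simp: red_words_def)
qed simp

text \<open>Distinctness of the crossed cosets gives at most one crossing of each, and exhausting
  \<open>rank2_cosets I\<close> gives at least one.\<close>

lemma zam_cycle_braid_path:
  assumes "I \<subseteq> S" "u \<in> red_words I x" "\<And>s. s \<in> I \<Longrightarrow> len (x + cox_gen mS s) < len x"
    and bp: "braid_path I x u es u" and "distinct (map crossed es)" "set (map crossed es) = rank2_cosets I"
  shows "zam_cycle S m I u es"
  unfolding zam_cycle_def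
proof (intro conjI allI impI)
  have u: "u \<in> lists I" "pr u = x" using assms(2) by (auto simp: red_words_def)
  have uS: "u \<in> lists S" using u assms(1) lists_mono by blast
  have "longest_elt S m I = wd u" using longest_elt_wd[OF assms(1) u(1)] assms(3) u(2) by simp
  then show "gamma_path S m I u es u"
    using gamma_path_braid_path[OF assms(1) _ uS] bp assms(2) u(2) by simp
  fix J y assume J: "J \<subseteq> I \<and> card J = 2 \<and> y \<in> parabolic S m I"
  then obtain v where v: "v \<in> lists I" "y = wd v" using parabolic_eq[OF assms(1)] by blast
  have vS: "v \<in> lists S" and JS: "J \<subseteq> S" using v J assms(1) lists_mono by blast+
  have *: "move_coset S m (es ! i) = y <#\<^bsub>G\<^esub> parabolic S m J \<longleftrightarrow> crossed (es ! i) = coset (pr v) J"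
    if "i < length es" for i
  proof -
    obtain a s t c where e: "es ! i = (a, s, t, c)" by (cases "es ! i") auto
    then have "a \<in> lists I \<and> s \<in> I \<and> t \<in> I"
      using braid_path_letters[OF bp] that by (metis nth_mem)
    then have "a \<in> lists S" "{s, t} \<subseteq> S" using assms(1) lists_mono by blast+
    then show ?thesis using l_coset_eq_iff[of a "{s, t}" v J] vS JS by (simp add: e v(2))
  qed
  have "coset (pr v) J \<in> set (map crossed es)"
    unfolding assms(6) rank2_cosets_def using J WP_pr[OF v(1)] by blast
  then obtain i where i: "i < length es" "crossed (es ! i) = coset (pr v) J"
    by (auto simp: in_set_conv_nth)
  show "\<exists>!i. i < length es \<and> move_coset S m (es ! i) = y <#\<^bsub>G\<^esub> parabolic S m J"
  proof (rule ex1I[of _ i])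
    show "i < length es \<and> move_coset S m (es ! i) = y <#\<^bsub>G\<^esub> parabolic S m J" using i * by blast
    fix j assume "j < length es \<and> move_coset S m (es ! j) = y <#\<^bsub>G\<^esub> parabolic S m J"
    then have "j < length es" "crossed (es ! j) = crossed (es ! i)" using * i by auto
    then show "j = i" using i(1) assms(5) nth_eq_iff_index_eq[of "map crossed es" j i] by simp
  qed
qed

lemma finite_parabolic:
  assumes "I \<subseteq> S" "finite (WP I)" shows "finite (parabolic S m I)"
proof -
  have "wd u = wd (SOME v. v \<in> lists I \<and> pr v = pr u)" if u: "u \<in> lists I" for u
  proof -
    define v where "v = (SOME v. v \<in> lists I \<and> pr v = pr u)"
    have v: "v \<in> lists I \<and> pr v = pr u"
      unfolding v_def by (rule someI[of _ u]) (use u in blast)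
    then have "u \<in> lists S" "v \<in> lists S" using u lists_mono[OF assms(1)] by blast+
    then show ?thesis using word_elt_eq_iff[of u v] v unfolding v_def by simp
  qed
  then have "parabolic S m I \<subseteq> (\<lambda>x. wd (SOME v. v \<in> lists I \<and> pr v = x)) ` WP I"
    unfolding parabolic_eq[OF assms(1)] WP_def by blast
  then show ?thesis using assms(2) finite_surj by blast
qed

end

section \<open>The diagrammatic category\<close>

lemma cat_functor_comp:
  assumes "cat_functor C D F\<^sub>0 F\<^sub>1" "cat_functor D E G\<^sub>0 G\<^sub>1"
  shows "cat_functor C E (\<lambda>a. G\<^sub>0 (F\<^sub>0 a)) (\<lambda>a b f. G\<^sub>1 (F\<^sub>0 a) (F\<^sub>0 b) (F\<^sub>1 a b f))"
proof -
  interpret F: cat_functor C D F\<^sub>0 F\<^sub>1 by (rule assms(1))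
  interpret G: cat_functor D E G\<^sub>0 G\<^sub>1 by (rule assms(2))
  show ?thesis
    by unfold_locales (simp_all add: F.F_Obj F.F_Hom F.F_Idn F.F_Cmp G.F_Obj G.F_Hom G.F_Idn G.F_Cmp)
qed

context coxeter_system
begin

abbreviation D where "D \<equiv> W_diag S m"
abbreviation dt where "dt \<equiv> diag_type S m"
abbreviation de where "de \<equiv> diag_eq S m"
abbreviation comp_class (infixr "\<cdot>" 55) where "B \<cdot> A \<equiv> Cmp D B A"
abbreviation tensor_class (infixr "\<parallel>" 60) where "A \<parallel> B \<equiv> TMor D A B"
abbreviation ide where "ide u \<equiv> Idn D u"

definition cl :: "'a diag \<Rightarrow> 'a diag set" where
  "cl f = {g. de f g}"

lemma diag_type_unique: "\<lbrakk>dt f u v; dt f u' v'\<rbrakk> \<Longrightarrow> u = u' \<and> v = v'"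
proof (induction arbitrary: u' v' rule: diag_type.induct)
  case (Vert s t k)
  from Vert(5) show ?case by cases (use Vert in auto)
next
  case (Comp f u v g w)
  from Comp(5) show ?case by cases (use Comp in blast)
next
  case (Tensor f u v g u1 v1)
  from Tensor(5) show ?case by cases (use Tensor in blast)
qed (auto elim: diag_type.cases)

lemma diag_type_lists: "dt f u v \<Longrightarrow> u \<in> lists S \<and> v \<in> lists S"
proof (induction rule: diag_type.induct)
  case (Vert s t k)
  then show ?case using set_alt[of s t k] set_alt[of t s k] by (auto simp: in_lists_conv_set)
qed auto

lemma diag_type_pr: "dt f u v \<Longrightarrow> pr u = pr v"
  by (induction rule: diag_type.induct) (auto intro: pr_braid)

text \<open>Several rules of \<open>diag_eq\<close> mention no types. That congruent diagrams share
  source and target is what makes \<open>Dm\<close> and \<open>Cd\<close> well defined on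
  classes.\<close>

lemma diag_eq_typed: "de f g \<Longrightarrow> \<exists>u v. dt f u v \<and> dt g u v"
proof (induction rule: diag_eq.induct)
  case (trans f g h)
  then show ?case using diag_type_unique by blast
next
  case (Comp_cong f f' g g' u v w)
  then have "dt f' u v" "dt g' v w" using diag_type_unique by blast+
  then show ?case using Comp_cong by (blast intro: diag_type.Comp)
next
  case (Tensor_cong f f' g g')
  then show ?case by (blast intro: diag_type.Tensor)
next
  case (Tensor_Id u v)
  then show ?case
    using diag_type.Tensor[OF diag_type.Ident diag_type.Ident, of u S v m] diag_type.Ident[of "u @ v" S m] by auto
next
  case (Comp_Id f u v)
  then show ?case using diag_type_lists by (blast intro: diag_type.intros)
next
  case (Id_Comp f u v)
  then show ?case using diag_type_lists by (blast intro: diag_type.intros)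
next
  case (Comp_assoc f u v g w h x)
  then show ?case by (blast intro: diag_type.intros)
next
  case (interchange f u v g w f' u' v' g' w')
  then show ?case by (blast intro: diag_type.intros)
next
  case (Unit_Tensor f u v)
  then show ?case using diag_type.Tensor[OF diag_type.Ident, of "[]" S m f u v] by auto
next
  case (Tensor_Unit f u v)
  then show ?case using diag_type.Tensor[OF _ diag_type.Ident, of S m f u v "[]"] by auto
next
  case (Tensor_assoc f u v g u' v' h u'' v'')
  then have "dt ((f \<star> g) \<star> h) ((u @ u') @ u'') ((v @ v') @ v'')" "dt (f \<star> (g \<star> h)) (u @ u' @ u'') (v @ v' @ v'')"
    by (blast intro: diag_type.Tensor)+
  then show ?case by auto
qed blast+

lemma cl_eqI: "de f g \<Longrightarrow> cl f = cl g"
  unfolding cl_def using diag_eq.sym diag_eq.trans by blast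

lemma cl_eqD: "\<lbrakk>cl f = cl g; dt g u v\<rbrakk> \<Longrightarrow> de f g"
  unfolding cl_def using diag_eq.refl by blast

lemma Hom_iff: "A \<in> Hom D u v \<longleftrightarrow> (\<exists>f. dt f u v \<and> A = cl f)"
  by (auto simp: W_diag_def quotient_def cl_def)

lemma Obj_D [simp]: "Obj D = lists S" and Unit_D [simp]: "Unit D = []" and TObj_D [simp]: "TObj D = (@)"
  by (simp_all add: W_diag_def)

lemma ide_cl: "ide u = cl (Ident u)"
  by (simp add: W_diag_def cl_def)

lemma comp_cl: assumes "dt f u v" "dt g v w" shows "cl g \<cdot> cl f = cl (g \<bullet> f)"
proof -
  have "(\<exists>g'. de g g' \<and> (\<exists>f'. de f f' \<and> de (g' \<bullet> f') h)) \<longleftrightarrow> de (g \<bullet> f) h" for h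
  proof
    assume "\<exists>g'. de g g' \<and> (\<exists>f'. de f f' \<and> de (g' \<bullet> f') h)"
    then obtain g' f' where "de g g'" "de f f'" "de (g' \<bullet> f') h" by blast
    then show "de (g \<bullet> f) h" using diag_eq.Comp_cong[of S m f f' g g' u v w] assms diag_eq.trans by blast
  qed (use assms diag_eq.refl in blast)
  then show ?thesis by (simp add: W_diag_def cl_def)
qed

lemma tensor_cl: assumes "dt f u v" "dt g u' v'" shows "cl f \<parallel> cl g = cl (f \<star> g)"
proof -
  have "(\<exists>f'. de f f' \<and> (\<exists>g'. de g g' \<and> de (f' \<star> g') h)) \<longleftrightarrow> de (f \<star> g) h" for h
  proof
    assume "\<exists>f'. de f f' \<and> (\<exists>g'. de g g' \<and> de (f' \<star> g') h)"
    then obtain g' f' where "de g g'" "de f f'" "de (f' \<star> g') h" by blast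
    then show "de (f \<star> g) h" using diag_eq.Tensor_cong[of S m f f' g g'] diag_eq.trans by blast
  qed (use assms diag_eq.refl in blast)
  then show ?thesis by (simp add: W_diag_def cl_def)
qed

lemma strict_monoidal_D: "strict_monoidal_category D"
proof
  show "Unit D \<in> Obj D" by simp
next
  fix a assume "a \<in> Obj D"
  then show "ide a \<in> Hom D a a" by (auto simp: Hom_iff ide_cl intro: diag_type.Ident)
next
  fix a b c f g assume "f \<in> Hom D a b" "g \<in> Hom D b c"
  then show "g \<cdot> f \<in> Hom D a c" by (auto simp: Hom_iff comp_cl intro: diag_type.Comp)
next
  fix a b f assume "a \<in> Obj D" "b \<in> Obj D" "f \<in> Hom D a b"
  then obtain f' where f: "a \<in> lists S" "b \<in> lists S" "dt f' a b" "f = cl f'" by (auto simp: Hom_iff)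
  note I = diag_type.Ident[OF f(1), of m] diag_type.Ident[OF f(2), of m]
  show "f \<cdot> ide a = f" unfolding f(4) ide_cl comp_cl[OF I(1) f(3)] by (intro cl_eqI diag_eq.Comp_Id[OF f(3)])
  show "ide b \<cdot> f = f" unfolding f(4) ide_cl comp_cl[OF f(3) I(2)] by (intro cl_eqI diag_eq.Id_Comp[OF f(3)])
  have N: "dt (Ident []) [] []" by (rule diag_type.Ident) simp
  show "ide (Unit D) \<parallel> f = f"
    unfolding f(4) ide_cl Unit_D tensor_cl[OF N f(3)] by (intro cl_eqI diag_eq.Unit_Tensor[OF f(3)])
  show "f \<parallel> ide (Unit D) = f"
    unfolding f(4) ide_cl Unit_D tensor_cl[OF f(3) N] by (intro cl_eqI diag_eq.Tensor_Unit[OF f(3)])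
next
  fix a b c d f g h assume "f \<in> Hom D a b" "g \<in> Hom D b c" "h \<in> Hom D c d"
  then obtain f' g' h' where f: "dt f' a b" "dt g' b c" "dt h' c d" "f = cl f'" "g = cl g'" "h = cl h'"
    by (auto simp: Hom_iff)
  then have "dt (g' \<bullet> f') a c" "dt (h' \<bullet> g') b d" by (auto intro: diag_type.Comp)
  then show "h \<cdot> (g \<cdot> f) = (h \<cdot> g) \<cdot> f"
    using f by (simp add: comp_cl cl_eqI[OF diag_eq.Comp_assoc])
next
  fix a b a' b' f g assume "f \<in> Hom D a b" "g \<in> Hom D a' b'"
  then show "f \<parallel> g \<in> Hom D (TObj D a a') (TObj D b b')"
    by (auto simp: Hom_iff tensor_cl intro: diag_type.Tensor)
next
  fix a b assume "a \<in> Obj D" "b \<in> Obj D"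
  then have ab: "a \<in> lists S" "b \<in> lists S" by auto
  show "ide a \<parallel> ide b = ide (TObj D a b)"
    unfolding ide_cl TObj_D tensor_cl[OF diag_type.Ident[OF ab(1)] diag_type.Ident[OF ab(2)]]
    by (intro cl_eqI diag_eq.Tensor_Id ab)
next
  fix a b c a' b' c' f g f' g'
  assume "f \<in> Hom D a b" "g \<in> Hom D b c" "f' \<in> Hom D a' b'" "g' \<in> Hom D b' c'"
  then obtain f1 g1 f1' g1' where f: "dt f1 a b" "dt g1 b c" "dt f1' a' b'" "dt g1' b' c'"
    "f = cl f1" "g = cl g1" "f' = cl f1'" "g' = cl g1'"
    by (auto simp: Hom_iff)
  have t: "dt (g1 \<bullet> f1) a c" "dt (g1' \<bullet> f1') a' c'" "dt (f1 \<star> f1') (a @ a') (b @ b')"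
    "dt (g1 \<star> g1') (b @ b') (c @ c')"
    using f by (auto intro: diag_type.intros)
  show "(g \<cdot> f) \<parallel> (g' \<cdot> f') = (g \<parallel> g') \<cdot> (f \<parallel> f')"
    unfolding f(5-8) comp_cl[OF f(1,2)] comp_cl[OF f(3,4)] tensor_cl[OF f(1,3)] tensor_cl[OF f(2,4)]
      tensor_cl[OF t(1,2)] comp_cl[OF t(3,4)]
    by (rule cl_eqI) (rule diag_eq.interchange[OF f(1-4)])
next
  fix a b a' b' a'' b'' f g h
  assume "f \<in> Hom D a b" "g \<in> Hom D a' b'" "h \<in> Hom D a'' b''"
  then obtain f1 g1 h1 where f: "dt f1 a b" "dt g1 a' b'" "dt h1 a'' b''" "f = cl f1" "g = cl g1" "h = cl h1"
    by (auto simp: Hom_iff)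
  have t: "dt (f1 \<star> g1) (a @ a') (b @ b')" "dt (g1 \<star> h1) (a' @ a'') (b' @ b'')"
    using f by (auto intro: diag_type.intros)
  show "(f \<parallel> g) \<parallel> h = f \<parallel> (g \<parallel> h)"
    unfolding f(4-6) tensor_cl[OF f(1,2)] tensor_cl[OF f(2,3)] tensor_cl[OF t(1) f(3)] tensor_cl[OF f(1) t(2)]
    by (rule cl_eqI) (rule diag_eq.Tensor_assoc[OF f(1-3)])
qed (auto simp: in_lists_conv_set)

interpretation D: strict_monoidal_category D
  by (rule strict_monoidal_D)

text \<open>Sources and targets as functions, so that the simplifier can check composability.\<close>

definition arr :: "'a diag set \<Rightarrow> bool" where
  "arr A \<longleftrightarrow> (\<exists>u v. A \<in> Hom D u v)"

definition Dm :: "'a diag set \<Rightarrow> 'a list" where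
  "Dm A = (THE u. \<exists>v. A \<in> Hom D u v)"

definition Cd :: "'a diag set \<Rightarrow> 'a list" where
  "Cd A = (THE v. \<exists>u. A \<in> Hom D u v)"

lemma Hom_unique: assumes "A \<in> Hom D u v" "A \<in> Hom D u' v'" shows "u = u' \<and> v = v'"
proof -
  obtain f g where fg: "dt f u v" "dt g u' v'" "A = cl f" "A = cl g" using assms by (auto simp: Hom_iff)
  then have "de f g" using cl_eqD by blast
  then obtain u1 v1 where "dt f u1 v1" "dt g u1 v1" using diag_eq_typed by blast
  then show ?thesis using fg diag_type_unique by blast
qed

lemma HomD: assumes "A \<in> Hom D u v" shows "arr A" "Dm A = u" "Cd A = v"
proof -
  show "arr A" using assms by (auto simp: arr_def)
  show "Dm A = u" unfolding Dm_def using assms Hom_unique by blast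
  show "Cd A = v" unfolding Cd_def using assms Hom_unique by blast
qed

lemma HomI: "\<lbrakk>arr A; Dm A = u; Cd A = v\<rbrakk> \<Longrightarrow> A \<in> Hom D u v"
  unfolding arr_def using HomD by blast

lemma Hom_lists: "A \<in> Hom D u v \<Longrightarrow> u \<in> lists S \<and> v \<in> lists S"
  unfolding Hom_iff using diag_type_lists by blast

lemma arr_lists [simp]: "arr A \<Longrightarrow> Dm A \<in> lists S" "arr A \<Longrightarrow> Cd A \<in> lists S"
  using Hom_lists HomI by blast+

lemma arr_cl: "arr A \<Longrightarrow> \<exists>f. dt f (Dm A) (Cd A) \<and> A = cl f"
  using HomI[of A] by (simp add: Hom_iff)

lemma arr_pr: assumes "arr A" shows "pr (Dm A) = pr (Cd A)"
proof -
  obtain f where "dt f (Dm A) (Cd A)" using arr_cl[OF assms] by blast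
  then show ?thesis by (rule diag_type_pr)
qed

lemma ide_Hom: "u \<in> lists S \<Longrightarrow> ide u \<in> Hom D u u"
  using D.Idn_Hom by simp

lemma ide_simps [simp]: assumes "u \<in> lists S" shows "arr (ide u)" "Dm (ide u) = u" "Cd (ide u) = u"
  using HomD[OF ide_Hom[OF assms]] by auto

lemma comp_simps [simp]:
  assumes "arr A" "arr B" "Cd A = Dm B"
  shows "arr (B \<cdot> A)" "Dm (B \<cdot> A) = Dm A" "Cd (B \<cdot> A) = Cd B"
proof -
  have "B \<cdot> A \<in> Hom D (Dm A) (Cd B)"
    using D.Cmp_Hom[of "Dm A" "Cd A" "Cd B" A B] HomI assms by simp
  then show "arr (B \<cdot> A)" "Dm (B \<cdot> A) = Dm A" "Cd (B \<cdot> A) = Cd B" using HomD by auto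
qed

lemma tensor_simps [simp]:
  assumes "arr A" "arr B"
  shows "arr (A \<parallel> B)" "Dm (A \<parallel> B) = Dm A @ Dm B" "Cd (A \<parallel> B) = Cd A @ Cd B"
proof -
  have "A \<parallel> B \<in> Hom D (Dm A @ Dm B) (Cd A @ Cd B)"
    using D.TMor_Hom[of "Dm A" "Cd A" "Dm B" "Cd B" A B] HomI assms by simp
  then show "arr (A \<parallel> B)" "Dm (A \<parallel> B) = Dm A @ Dm B" "Cd (A \<parallel> B) = Cd A @ Cd B" using HomD by auto
qed

lemma comp_ide [simp]: "\<lbrakk>arr A; u = Dm A\<rbrakk> \<Longrightarrow> A \<cdot> ide u = A"
  using D.Cmp_Idn[of "Dm A" "Cd A" A] HomI by simp

lemma ide_comp [simp]: "\<lbrakk>arr A; u = Cd A\<rbrakk> \<Longrightarrow> ide u \<cdot> A = A"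
  using D.Idn_Cmp[of "Dm A" "Cd A" A] HomI by simp

lemma comp_assoc: "\<lbrakk>arr A; arr B; arr C; Cd A = Dm B; Cd B = Dm C\<rbrakk> \<Longrightarrow> (C \<cdot> B) \<cdot> A = C \<cdot> (B \<cdot> A)"
  using D.Cmp_assoc[of "Dm A" "Dm B" "Dm C" "Cd C" A B C] HomI by simp

lemma interchange:
  "\<lbrakk>arr A; arr B; arr A'; arr B'; Cd A = Dm B; Cd A' = Dm B'\<rbrakk>
    \<Longrightarrow> (B \<parallel> B') \<cdot> (A \<parallel> A') = (B \<cdot> A) \<parallel> (B' \<cdot> A')"
  using D.TMor_Cmp[of "Dm A" "Dm B" "Cd B" "Dm A'" "Dm B'" "Cd B'" A B A' B'] HomI by simp

lemma tensor_assoc: "\<lbrakk>arr A; arr B; arr C\<rbrakk> \<Longrightarrow> (A \<parallel> B) \<parallel> C = A \<parallel> (B \<parallel> C)"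
  using D.TMor_assoc[of "Dm A" "Cd A" "Dm B" "Cd B" "Dm C" "Cd C" A B C] HomI by simp

lemma tensor_ide: "\<lbrakk>u \<in> lists S; v \<in> lists S\<rbrakk> \<Longrightarrow> ide u \<parallel> ide v = ide (u @ v)"
  using D.TMor_Idn[of u v] by simp

lemma tensor_Nil [simp]: "arr A \<Longrightarrow> A \<parallel> ide [] = A" "arr A \<Longrightarrow> ide [] \<parallel> A = A"
  using D.TMor_Unit_left[of "Dm A" "Cd A" A] D.TMor_Unit_right[of "Dm A" "Cd A" A] HomI by simp_all

lemma cl_simps: assumes "dt f u v" shows "arr (cl f)" "Dm (cl f) = u" "Cd (cl f) = v"
proof -
  have "cl f \<in> Hom D u v" using assms by (auto simp: Hom_iff)
  then show "arr (cl f)" "Dm (cl f) = u" "Cd (cl f) = v" using HomD by auto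
qed

lemma Cap_simps [simp]: assumes "s \<in> S"
  shows "arr (cl (Cap s))" "Dm (cl (Cap s)) = [s, s]" "Cd (cl (Cap s)) = []"
  using cl_simps[OF diag_type.Cap[OF assms]] by auto

lemma Cup_simps [simp]: assumes "s \<in> S"
  shows "arr (cl (Cup s))" "Dm (cl (Cup s)) = []" "Cd (cl (Cup s)) = [s, s]"
  using cl_simps[OF diag_type.Cup[OF assms]] by auto

lemma Vert_simps: assumes "s \<in> S" "t \<in> S" "s \<noteq> t" "m s t = enat k"
  shows "arr (cl (Vert s t))" "Dm (cl (Vert s t)) = alt s t k" "Cd (cl (Vert s t)) = alt t s k"
  using cl_simps[OF diag_type.Vert[where m = m, OF assms]] by auto

section \<open>The standard relations and invertibility\<close>

lemma rel_cl: "\<lbrakk>diag_rel S m f g; dt f u v; dt g u v\<rbrakk> \<Longrightarrow> cl f = cl g"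
  by (intro cl_eqI diag_eq.rel)

lemma cap_cup: assumes "s \<in> S" shows "cl (Cap s) \<cdot> cl (Cup s) = ide []"
proof -
  note t = diag_type.Cup[OF assms, of m] diag_type.Cap[OF assms, of m]
  show ?thesis
    unfolding comp_cl[OF t] ide_cl
    by (rule rel_cl[OF diag_rel.cap_cup[OF assms] diag_type.Comp[OF t]]) (auto intro: diag_type.Ident)
qed

lemma cup_cap: assumes "s \<in> S" shows "cl (Cup s) \<cdot> cl (Cap s) = ide [s, s]"
proof -
  note t = diag_type.Cap[OF assms, of m] diag_type.Cup[OF assms, of m]
  show ?thesis
    unfolding comp_cl[OF t] ide_cl
    by (rule rel_cl[OF diag_rel.cup_cap[OF assms] diag_type.Comp[OF t]]) (auto intro: diag_type.Ident simp: assms)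
qed

lemma m_sym_S: "\<lbrakk>s \<in> S; t \<in> S; s \<noteq> t\<rbrakk> \<Longrightarrow> m s t = m t s"
  using cm by (auto simp: coxeter_matrix_def)

lemma vert_vert:
  assumes "s \<in> S" "t \<in> S" "s \<noteq> t" "m s t = enat k"
  shows "cl (Vert t s) \<cdot> cl (Vert s t) = ide (alt s t k)"
proof -
  have "m t s = enat k" using assms m_sym_S by metis
  then have t: "dt (Vert t s) (alt t s k) (alt s t k)" "dt (Vert s t) (alt s t k) (alt t s k)"
    using assms by (auto intro: diag_type.Vert)
  then have "alt s t k \<in> lists S" using diag_type_lists by blast
  then show ?thesis
    unfolding comp_cl[OF t(2,1)] ide_cl
    by (intro rel_cl[OF diag_rel.vert_vert[where m = m, OF assms] diag_type.Comp[OF t(2,1)]] diag_type.Ident)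
qed

lemma ex_inverse:
  "dt f u v \<Longrightarrow> \<exists>B. arr B \<and> Dm B = v \<and> Cd B = u \<and> B \<cdot> cl f = ide u \<and> cl f \<cdot> B = ide v"
proof (induction rule: diag_type.induct)
  case (Ident u)
  then show ?case by (intro exI[of _ "ide u"]) (simp add: ide_cl[symmetric])
next
  case (Cap s)
  then show ?case by (intro exI[of _ "cl (Cup s)"]) (simp add: cap_cup cup_cap)
next
  case (Cup s)
  then show ?case by (intro exI[of _ "cl (Cap s)"]) (simp add: cap_cup cup_cap)
next
  case (Vert s t k)
  moreover from this have "m t s = enat k" using m_sym_S by metis
  ultimately show ?case by (intro exI[of _ "cl (Vert t s)"]) (simp add: Vert_simps vert_vert)
next
  case (Comp f u v g w)
  then obtain A B where A: "arr A" "Dm A = v" "Cd A = u" "A \<cdot> cl f = ide u" "cl f \<cdot> A = ide v"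
    and B: "arr B" "Dm B = w" "Cd B = v" "B \<cdot> cl g = ide v" "cl g \<cdot> B = ide w" by blast
  note t = cl_simps[OF Comp(1)] cl_simps[OF Comp(2)]
  have "(A \<cdot> B) \<cdot> (cl g \<cdot> cl f) = A \<cdot> ((B \<cdot> cl g) \<cdot> cl f)"
    using A(1-3) B(1-3) t by (simp add: comp_assoc)
  then have 1: "(A \<cdot> B) \<cdot> (cl g \<cdot> cl f) = ide u" using A B t by simp
  have "(cl g \<cdot> cl f) \<cdot> (A \<cdot> B) = cl g \<cdot> ((cl f \<cdot> A) \<cdot> B)"
    using A(1-3) B(1-3) t by (simp add: comp_assoc)
  then have 2: "(cl g \<cdot> cl f) \<cdot> (A \<cdot> B) = ide w" using A B t by simp
  show ?case
    using 1 2 A B by (intro exI[of _ "A \<cdot> B"]) (simp add: comp_cl[OF Comp(1,2), symmetric])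
next
  case (Tensor f u v g u' v')
  then obtain A B where A: "arr A" "Dm A = v" "Cd A = u" "A \<cdot> cl f = ide u" "cl f \<cdot> A = ide v"
    and B: "arr B" "Dm B = v'" "Cd B = u'" "B \<cdot> cl g = ide u'" "cl g \<cdot> B = ide v'" by blast
  note t = cl_simps[OF Tensor(1)] cl_simps[OF Tensor(2)]
  show ?case
    using A B t diag_type_lists[OF Tensor(1)] diag_type_lists[OF Tensor(2)]
    by (intro exI[of _ "A \<parallel> B"])
      (simp add: tensor_cl[OF Tensor(1,2), symmetric] interchange tensor_ide)
qed

definition iv :: "'a diag set \<Rightarrow> 'a diag set" where
  "iv A = (SOME B. arr B \<and> Dm B = Cd A \<and> Cd B = Dm A \<and> B \<cdot> A = ide (Dm A) \<and> A \<cdot> B = ide (Cd A))"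

lemma iv_simps [simp]:
  assumes "arr A"
  shows "arr (iv A)" "Dm (iv A) = Cd A" "Cd (iv A) = Dm A" "iv A \<cdot> A = ide (Dm A)" "A \<cdot> iv A = ide (Cd A)"
proof -
  obtain f where f: "dt f (Dm A) (Cd A)" "A = cl f" using arr_cl[OF assms] by blast
  have "\<exists>B. arr B \<and> Dm B = Cd A \<and> Cd B = Dm A \<and> B \<cdot> A = ide (Dm A) \<and> A \<cdot> B = ide (Cd A)"
    using ex_inverse[OF f(1)] f(2) by simp
  from someI_ex[OF this]
  show "arr (iv A)" "Dm (iv A) = Cd A" "Cd (iv A) = Dm A" "iv A \<cdot> A = ide (Dm A)" "A \<cdot> iv A = ide (Cd A)"
    unfolding iv_def by blast+
qed

lemma comp_iv_cancel [simp]: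
  "\<lbrakk>arr A; arr B; Cd B = Dm A\<rbrakk> \<Longrightarrow> iv A \<cdot> (A \<cdot> B) = B"
  "\<lbrakk>arr A; arr B; Cd B = Cd A\<rbrakk> \<Longrightarrow> A \<cdot> (iv A \<cdot> B) = B"
  by (simp_all flip: comp_assoc)

lemma comp_left_cancel:
  "\<lbrakk>arr A; arr B; arr C; Cd B = Dm A; Cd C = Dm A; A \<cdot> B = A \<cdot> C\<rbrakk> \<Longrightarrow> B = C"
  by (metis comp_iv_cancel(1))

lemma comp_right_cancel:
  assumes "arr A" "arr B" "arr C" "Dm B = Cd A" "Dm C = Cd A" "B \<cdot> A = C \<cdot> A" shows "B = C"
proof -
  have "(B \<cdot> A) \<cdot> iv A = (C \<cdot> A) \<cdot> iv A" using assms(6) by simp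
  then show ?thesis using assms(1-5) by (simp add: comp_assoc)
qed

lemma comp_ide_tensor [simp]: "\<lbrakk>u \<in> lists S; arr A; arr B; Cd A = Dm B\<rbrakk> \<Longrightarrow>
    (ide u \<parallel> B) \<cdot> (ide u \<parallel> A) = ide u \<parallel> (B \<cdot> A)"
  by (simp add: interchange)

text \<open>Compose the zigzag identity with a cap: the cup and the cap then meet and cancel,
  because they are mutually inverse. In effect, a cap on two of three parallel strands may be moved
  to the other pair.\<close>

lemma cap_slide: assumes "s \<in> S" shows "cl (Cap s) \<parallel> ide [s] = ide [s] \<parallel> cl (Cap s)"
proof -
  let ?c = "cl (Cap s)" and ?u = "cl (Cup s)" and ?i = "ide [s]"
  have t: "dt (Cap s) [s, s] []" "dt (Cup s) [] [s, s]" "dt (Ident [s]) [s] [s]"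
    using assms by (auto intro: diag_type.intros)
  have t2: "dt (Cap s \<star> Ident [s]) [s, s, s] [s]" "dt (Ident [s] \<star> Cup s) [s] [s, s, s]"
    using diag_type.Tensor[OF t(1,3)] diag_type.Tensor[OF t(3,2)] by simp_all
  have z: "(?c \<parallel> ?i) \<cdot> (?i \<parallel> ?u) = ?i"
    unfolding ide_cl tensor_cl[OF t(1,3)] tensor_cl[OF t(3,2)] comp_cl[OF t2(2,1)]
    by (rule rel_cl[OF diag_rel.zigzag_left[OF assms] diag_type.Comp[OF t2(2,1)] t(3)])
  have "(?c \<parallel> ?i) \<cdot> ((?i \<parallel> ?u) \<cdot> (?i \<parallel> ?c)) = ?i \<parallel> ?c"
    using assms z by (simp del: comp_ide_tensor flip: comp_assoc)
  moreover have "(?i \<parallel> ?u) \<cdot> (?i \<parallel> ?c) = ide [s, s, s]"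
    using assms by (simp add: interchange cup_cap tensor_ide)
  ultimately show ?thesis using assms by simp
qed

end

section \<open>Coherence\<close>

context coxeter_system
begin

section \<open>Normal forms and the morphisms leading to them\<close>

abbreviation gn where "gn \<equiv> cox_gen mS"
abbreviation WS where "WS \<equiv> WP S"

text \<open>One descent is fixed for each nontrivial element of \<open>WS\<close>; the normal form
  \<open>N\<close> and the special case of \<open>Phi\<close> both use it.\<close>

definition rd where
  "rd z = (SOME s. s \<in> S \<and> len (z + gn s) < len z)"

lemma rd: assumes "z \<in> WS" "z \<noteq> 0" shows "rd z \<in> S" "len (z + gn (rd z)) < len z"
proof -
  obtain v where v: "v \<in> lists S" "red v" "pr v = z" using WP_red[OF assms(1)] by blast
  then have "v \<noteq> []" using assms(2) by auto
  then obtain v' a where v': "v = v' @ [a]" by (metis rev_exhaust)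
  then have "z + gn a = pr v'" using v(3) by (auto simp: add.assoc)
  moreover have "pr v' + gn a = z" using v(3) v' by simp
  moreover have "len (pr v') < len (pr v' + gn a)" using v(2) v' red_snoc by blast
  moreover have "a \<in> S" using v(1) v' by simp
  ultimately have "\<exists>s. s \<in> S \<and> len (z + gn s) < len z" by metis
  then show "rd z \<in> S" "len (z + gn (rd z)) < len z" unfolding rd_def using someI_ex by (metis (mono_tags, lifting))+
qed

primrec nf_aux where
  "nf_aux 0 z = []"
| "nf_aux (Suc n) z = nf_aux n (z + gn (rd z)) @ [rd z]"

definition N where "N z = nf_aux (len z) z"

lemma N_0 [simp]: "N 0 = []"
  by (simp add: N_def)

lemma WS_add_gn [simp]: "z \<in> WS \<Longrightarrow> s \<in> S \<Longrightarrow> z + gn s \<in> WS"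
  by (intro WP_add WP_g)

lemma WS_add_pr [simp]: "z \<in> WS \<Longrightarrow> u \<in> lists S \<Longrightarrow> z + pr u \<in> WS"
  by (intro WP_add WP_pr)

lemma N_rd: assumes "z \<in> WS" "z \<noteq> 0" shows "N z = N (z + gn (rd z)) @ [rd z]"
proof -
  have "len z = Suc (len (z + gn (rd z)))"
    using rd(2)[OF assms] len_add_g[OF WP_W[OF assms(1)], of "rd z"] by auto
  then show ?thesis by (simp add: N_def)
qed

lemma N_lists [simp]: "z \<in> WS \<Longrightarrow> N z \<in> lists S"
proof (induction "len z" arbitrary: z rule: less_induct)
  case less
  show ?case
  proof (cases "z = 0")
    case False
    then show ?thesis
      using less.hyps[OF rd(2)] less.prems rd(1)[OF less.prems False] N_rd[OF less.prems False] by simp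
  qed simp
qed

text \<open>The family \<open>F\<close> of single steps is a parameter because the same composite is
  needed for \<open>Up\<close>, for \<open>Psi\<close>, and for the truncated function inside the
  recursion defining \<open>Phi\<close>.\<close>

primrec ext ::
  "('a list set permutation \<Rightarrow> 'a \<Rightarrow> 'a diag set) \<Rightarrow> 'a list set permutation \<Rightarrow> 'a list \<Rightarrow> 'a diag set" where
  "ext F w [] = ide (N w)"
| "ext F w (s # u) = ext F (w + gn s) u \<cdot> (F w s \<parallel> ide u)"

text \<open>Typing is required only along the steps actually taken, since the typing of
  \<open>Phi\<close> is established for descents only.\<close>

definition steps_ok where
  "steps_ok F w u \<longleftrightarrow> (\<forall>v s v'. u = v @ s # v' \<longrightarrow>
     F (w + pr v) s \<in> Hom D (N (w + pr v) @ [s]) (N (w + pr v + gn s)))"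

lemma steps_ok_Cons:
  "steps_ok F w (s # u) \<Longrightarrow> F w s \<in> Hom D (N w @ [s]) (N (w + gn s)) \<and> steps_ok F (w + gn s) u"
  unfolding steps_ok_def
proof (intro conjI allI impI)
  assume h: "\<forall>v s' v'. s # u = v @ s' # v' \<longrightarrow>
    F (w + pr v) s' \<in> Hom D (N (w + pr v) @ [s']) (N (w + pr v + gn s'))"
  show "F w s \<in> Hom D (N w @ [s]) (N (w + gn s))" using h[rule_format, of "[]" s u] by simp
  fix v s' v' assume "u = v @ s' # v'"
  then show "F (w + gn s + pr v) s' \<in> Hom D (N (w + gn s + pr v) @ [s']) (N (w + gn s + pr v + gn s'))"
    using h[rule_format, of "s # v" s' v'] by (simp add: add.assoc)
qed

lemma ext_simps:
  "\<lbrakk>w \<in> WS; u \<in> lists S; steps_ok F w u\<rbrakk> \<Longrightarrow>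
    arr (ext F w u) \<and> Dm (ext F w u) = N w @ u \<and> Cd (ext F w u) = N (w + pr u)"
proof (induction u arbitrary: w)
  case (Cons s u)
  then have s: "s \<in> S" "u \<in> lists S" by auto
  note st = steps_ok_Cons[OF Cons.prems(3)]
  note F = HomD[OF st[THEN conjunct1]]
  have "arr (ext F (w + gn s) u) \<and> Dm (ext F (w + gn s) u) = N (w + gn s) @ u \<and>
      Cd (ext F (w + gn s) u) = N (w + gn s + pr u)"
    using Cons.IH[of "w + gn s"] Cons.prems(1) s st by simp
  then show ?case using F s by (simp add: add.assoc)
qed simp

lemma ext_append:
  "\<lbrakk>w \<in> WS; u \<in> lists S; v \<in> lists S; steps_ok F w u; steps_ok F (w + pr u) v\<rbrakk> \<Longrightarrow>
    ext F w (u @ v) = ext F (w + pr u) v \<cdot> (ext F w u \<parallel> ide v)"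
proof (induction u arbitrary: w)
  case Nil
  then show ?case using ext_simps[of w v F] by (simp add: tensor_ide)
next
  case (Cons s u)
  then have s: "s \<in> S" "u \<in> lists S" "v \<in> lists S" by auto
  note st = steps_ok_Cons[OF Cons.prems(4)]
  note F = HomD[OF st[THEN conjunct1]]
  have w: "w + gn s \<in> WS" using Cons.prems(1) s by simp
  have eq: "w + gn s + pr u = w + pr (s # u)" by (simp add: add.assoc)
  note e = ext_simps[OF w s(2) st[THEN conjunct2]]
  have e2: "arr (ext F (w + pr (s # u)) v) \<and> Dm (ext F (w + pr (s # u)) v) = N (w + pr (s # u)) @ v"
    using ext_simps[OF _ s(3) Cons.prems(5)] Cons.prems by (metis WS_add_pr)
  have "ext F (w + gn s) (u @ v) = ext F (w + pr (s # u)) v \<cdot> (ext F (w + gn s) u \<parallel> ide v)"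
    using Cons.IH[OF w s(2,3) st[THEN conjunct2]] Cons.prems(5) unfolding eq by blast
  then have "ext F w ((s # u) @ v) =
      (ext F (w + pr (s # u)) v \<cdot> (ext F (w + gn s) u \<parallel> ide v)) \<cdot> ((F w s \<parallel> ide u) \<parallel> ide v)"
    using s F by (simp add: tensor_assoc tensor_ide)
  also have "\<dots> = ext F (w + pr (s # u)) v \<cdot> (ext F w (s # u) \<parallel> ide v)"
    using s F e e2 eq by (simp add: comp_assoc interchange del: map_eq_Cons_conv sum_list.Cons list.map)
  finally show ?case .
qed

lemma ext_cong:
  "(\<And>v s v'. u = v @ s # v' \<Longrightarrow> F (w + pr v) s = F' (w + pr v) s) \<Longrightarrow> ext F w u = ext F' w u"
proof (induction u arbitrary: w)
  case (Cons s u)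
  have "ext F (w + gn s) u = ext F' (w + gn s) u"
  proof (rule Cons.IH)
    fix v t v' assume "u = v @ t # v'"
    then show "F (w + gn s + pr v) t = F' (w + gn s + pr v) t"
      using Cons.prems[of "s # v" t v'] by (simp add: add.assoc)
  qed
  moreover have "F w s = F' w s" using Cons.prems[of "[]" s u] by simp
  ultimately show ?case by simp
qed simp

text \<open>\<open>Phi z s\<close> is the canonical morphism from \<open>N (zs) \<cdot> s\<close> to \<open>N z\<close> for a right descent \<open>s\<close> of \<open>z\<close>.
  If \<open>s\<close> is not the chosen descent \<open>rd z\<close>, it is forced by the vertex on the coset of \<open>z\<close> under \<open>s\<close> and \<open>rd z\<close>.\<close>

definition Phi_step where
  "Phi_step f z s = (if s = rd z then ide (N z) else
     (let (y, k) = (SOME (y, k). mS (rd z) s = enat k \<and> is_min {rd z, s} y \<and> z = y + pr (alt (rd z) s k));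
          a = (if odd k then s else rd z); b = (if odd k then rd z else s)
      in (ext (\<lambda>w t. f (w + gn t) t) y (alt b a (k - 1)) \<parallel> ide [rd z]) \<cdot> (ide (N y) \<parallel> cl (Vert a b)) \<cdot>
         iv (ext (\<lambda>w t. f (w + gn t) t) y (alt a b (k - 1)) \<parallel> ide [s])))"

definition Phi where "Phi = wfrec (measure len) Phi_step"

definition Up where "Up w t = Phi (w + gn t) t"

lemma Phi_unfold: "Phi z = Phi_step (cut Phi (measure len) z) z"
  unfolding Phi_def by (rule wfrec) simp

lemma Phi_rd: "Phi z (rd z) = ide (N z)"
  by (simp add: Phi_unfold Phi_step_def)

lemma min_add_red: "\<lbrakk>is_min J y; v \<in> lists J; red v\<rbrakk> \<Longrightarrow> len (y + pr v) = len y + length v"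
  using min_add[of J y "pr v"] WP_pr[of v J] by (simp add: red_def)

lemma alt_lists: "{s, t} \<subseteq> J \<Longrightarrow> alt s t k \<in> lists J"
  using set_alt[of s t k] by (auto simp: in_lists_conv_set)

lemma asc_prefix:
  assumes "y \<in> W" "len (y + pr (v @ v')) = len y + length (v @ v')"
  shows "len (y + pr v) = len y + length v"
proof -
  have "len (y + pr v + pr v') \<le> len (y + pr v) + len (pr v')" using assms(1) by (intro len_add_le) auto
  moreover have "len (y + pr v) \<le> len y + len (pr v)" using assms(1) by (intro len_add_le) auto
  moreover have "len (pr v) \<le> length v" "len (pr v') \<le> length v'" by (rule len_le)+
  ultimately show ?thesis using assms(2) by (simp add: add.assoc)
qed

text \<open>Unfolds \<open>Phi\<close> at a descent other than \<open>rd z\<close>. By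
  \<open>min_unique\<close> the chosen pair is the actual lowest element of the coset with the
  actual bond, and all recursive values are those of \<open>Phi\<close> itself.\<close>

lemma top_data:
  assumes z: "z \<in> WS" and s: "s \<in> S" "s \<noteq> rd z" "len (z + gn s) < len z"
  obtains y k a b where "{a, b} = {rd z, s}" "a \<noteq> b" "a \<in> S" "b \<in> S" "m a b = enat k" "k \<ge> 2" "is_min {a, b} y"
    "y \<in> WS" "z = y + pr (alt a b k)" "z = y + pr (alt b a k)"
    "alt a b k = alt a b (k - 1) @ [s]" "alt b a k = alt b a (k - 1) @ [rd z]"
    "len z = len y + k"
    "Phi z s = (ext Up y (alt b a (k - 1)) \<parallel> ide [rd z]) \<cdot> (ide (N y) \<parallel> cl (Vert a b)) \<cdot>
       iv (ext Up y (alt a b (k - 1)) \<parallel> ide [s])"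
proof -
  have z0: "z \<noteq> 0" using s(3) by auto
  define r where "r = rd z"
  have r: "r \<in> S" "len (z + gn r) < len z" using rd[OF z z0] by (simp_all add: r_def)
  have rs: "r \<noteq> s" using s(2) by (simp add: r_def)
  obtain y k where y: "mS r s = enat k" "is_min {r, s} y" "z = y + pr (alt r s k)"
    using dihedral_top[OF rs WP_W[OF z] r(2) s(3)] by blast
  have u: "y' = y \<and> k' = k" if "mS r s = enat k' \<and> is_min {r, s} y' \<and> z = y' + pr (alt r s k')" for y' k'
    using that y min_unique[of "{r, s}" y' y "pr (alt r s k')" "pr (alt r s k)"] alt_WP by auto
  have some: "(SOME (y, k). mS r s = enat k \<and> is_min {r, s} y \<and> z = y + pr (alt r s k)) = (y, k)"
  proof (rule some_equality)
    show "case (y, k) of (y, k) \<Rightarrow> mS r s = enat k \<and> is_min {r, s} y \<and> z = y + pr (alt r s k)"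
      unfolding prod.case by (intro conjI y)
  next
    fix p :: "'a list set permutation \<times> nat"
    assume h: "case p of (y, k) \<Rightarrow> mS r s = enat k \<and> is_min {r, s} y \<and> z = y + pr (alt r s k)"
    obtain y' k' where p: "p = (y', k')" by (cases p)
    show "p = (y, k)" using u[OF h[unfolded p prod.case]] p by simp
  qed
  \<comment> \<open>The parity of \<open>k\<close> fixes the order of the two letters so that
    \<open>alt a b k\<close> ends in \<open>s\<close> and \<open>alt b a k\<close> ends in
    \<open>r\<close>.\<close>
  define a b where "a = (if odd k then s else r)" and "b = (if odd k then r else s)"
  have ab: "{a, b} = {r, s}" "a \<noteq> b" "a \<in> S" "b \<in> S" using rs r(1) s(1) by (auto simp: a_def b_def)
  have mab: "mS a b = enat k" "mS b a = enat k" using y(1) m_sym[OF rs] by (auto simp: a_def b_def)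
  have k2: "k \<ge> 2" using m_ge2[OF ab(2)] mab by (simp add: numeral_eq_enat)
  have eq: "pr (alt a b k) = pr (alt r s k)" "pr (alt b a k) = pr (alt r s k)"
    using pr_braid[OF rs y(1)] by (auto simp: a_def b_def)
  have last: "alt a b k = alt a b (k - 1) @ [s]" "alt b a k = alt b a (k - 1) @ [r]"
    using alt_Suc_snoc[of a b "k - 1"] alt_Suc_snoc[of b a "k - 1"] k2 by (auto simp: a_def b_def)
  have min: "is_min {a, b} y" using y(2) ab(1) by simp
  have "y = z + - pr (alt r s k)" using y(3) by (simp add: add.assoc add.right_inverse del: add_uminus_conv_diff)
  then have yS: "y \<in> WS" using z r(1) s(1) by (metis WP_add WP_uminus alt_WP_sub empty_subsetI insert_subset)
  have reds: "red (alt a b k)" "red (alt b a k)" using red_alt ab(2) mab by auto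
  have lz: "len z = len y + k"
    using min_add_red[OF min alt_lists[OF order.refl] reds(1)] y(3) eq by simp
  \<comment> \<open>Only the first \<open>k - 1\<close> letters of either side are traversed, so
    every recursive call stays strictly below \<open>z\<close> and the cut is invisible.\<close>
  have low: "len (y + pr v + gn t) < len z"
    if "alt p q (k - 1) = v @ t # v'" "p = a \<and> q = b \<or> p = b \<and> q = a" for p q v t v'
  proof -
    have "red (alt p q k)" using that(2) reds by auto
    then have rd: "red (alt p q (k - 1))"
      using red_append[of "alt p q (k - 1)" "[if even (k - 1) then p else q]"] alt_Suc_snoc[of p q "k - 1"] k2
      by (simp del: alt.simps)
    have "v @ [t] \<in> lists {a, b}"
      using alt_lists[of p q "{a, b}" "k - 1"] that by auto
    moreover have "red (v @ [t])" using rd that(1) red_append[of "v @ [t]" v'] by simp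
    moreover have "length v < k - 1" using that(1) by (metis length_alt length_append less_add_Suc1 list.size(4) add_Suc_right)
    ultimately show ?thesis using min_add_red[OF min, of "v @ [t]"] lz by (simp add: add.assoc)
  qed
  have ext_cut: "ext (\<lambda>w t. cut Phi (measure len) z (w + gn t) t) y (alt p q (k - 1)) = ext Up y (alt p q (k - 1))"
    if "p = a \<and> q = b \<or> p = b \<and> q = a" for p q
    by (rule ext_cong) (use low that in \<open>simp add: Up_def cut_apply\<close>)
  have P: "Phi z s = (ext Up y (alt b a (k - 1)) \<parallel> ide [r]) \<cdot> (ide (N y) \<parallel> cl (Vert a b)) \<cdot>
       iv (ext Up y (alt a b (k - 1)) \<parallel> ide [s])"
    unfolding Phi_unfold[of z] Phi_step_def r_def[symmetric] some
    using rs ext_cut by (simp add: a_def[symmetric] b_def[symmetric] Let_def)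
  have "m a b = enat k" using mab(1) ab(3,4) by simp
  moreover have "z = y + pr (alt a b k)" "z = y + pr (alt b a k)" unfolding eq by (rule y(3))+
  ultimately show ?thesis
    using that[OF ab(1)[unfolded r_def] ab(2-4) _ k2 min yS _ _ last(1) last(2)[unfolded r_def] lz
      P[unfolded r_def]] by blast
qed

lemma steps_ok_Up:
  assumes "\<And>z s. \<lbrakk>z \<in> WS; s \<in> S; len (z + gn s) < len z; len z \<le> n\<rbrakk> \<Longrightarrow> Phi z s \<in> Hom D (N (z + gn s) @ [s]) (N z)"
    and "y \<in> WS" "u \<in> lists S" "len (y + pr u) = len y + length u" "len y + length u \<le> n"
  shows "steps_ok Up y u"
  unfolding steps_ok_def
proof (intro allI impI)
  fix v s v' assume u: "u = v @ s # v'"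
  have W: "y \<in> W" using assms(2) by blast
  have 1: "len (y + pr v) = len y + length v" using asc_prefix[OF W, of v "s # v'"] assms(4) u by simp
  have 2: "len (y + pr v + gn s) = len y + Suc (length v)"
    using asc_prefix[OF W, of "v @ [s]" v'] assms(4) u by (simp add: add.assoc)
  have "v \<in> lists S" "s \<in> S" using assms(3) u by auto
  moreover have e: "y + pr v + gn s + gn s = y + pr v" by (simp add: add.assoc)
  ultimately show "Up (y + pr v) s \<in> Hom D (N (y + pr v) @ [s]) (N (y + pr v + gn s))"
    using assms(1)[of "y + pr v + gn s" s] assms(2,5) u 1 2 by (simp add: Up_def e)
qed

lemma last_step:
  assumes "u = v @ [x]" "z = y + pr u" shows "y + pr v = z + gn x"
  unfolding assms(2) unfolding assms(1) by (simp add: add.assoc)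

lemma Phi_Hom:
  "\<lbrakk>z \<in> WS; s \<in> S; len (z + gn s) < len z\<rbrakk> \<Longrightarrow> Phi z s \<in> Hom D (N (z + gn s) @ [s]) (N z)"
proof (induction "len z" arbitrary: z s rule: less_induct)
  case less
  have z0: "z \<noteq> 0" using less.prems(3) by auto
  show ?case
  proof (cases "s = rd z")
    case True
    then show ?thesis
      using less.prems N_rd[OF less.prems(1) z0] ide_Hom[OF N_lists[OF less.prems(1)]] by (simp add: Phi_rd)
  next
    case False
    obtain y k a b where d: "{a, b} = {rd z, s}" "a \<noteq> b" "a \<in> S" "b \<in> S" "m a b = enat k" "k \<ge> 2" "is_min {a, b} y"
      "y \<in> WS" "z = y + pr (alt a b k)" "z = y + pr (alt b a k)"
      "alt a b k = alt a b (k - 1) @ [s]" "alt b a k = alt b a (k - 1) @ [rd z]" "len z = len y + k"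
      "Phi z s = (ext Up y (alt b a (k - 1)) \<parallel> ide [rd z]) \<cdot> (ide (N y) \<parallel> cl (Vert a b)) \<cdot>
         iv (ext Up y (alt a b (k - 1)) \<parallel> ide [s])"
      by (rule top_data[OF less.prems(1,2) False less.prems(3)])
    have IH: "\<lbrakk>z' \<in> WS; s' \<in> S; len (z' + gn s') < len z'; len z' \<le> len z - 1\<rbrakk>
        \<Longrightarrow> Phi z' s' \<in> Hom D (N (z' + gn s') @ [s']) (N z')" for z' s'
      using less.hyps[of z' s'] d(6,13) by simp
    have l: "alt p q (k - 1) \<in> lists S" if "p \<in> S" "q \<in> S" for p q
      by (rule alt_lists) (use that in simp)
    have ok: "steps_ok Up y (alt p q (k - 1))"
      if "p \<in> S" "q \<in> S" "alt p q k = alt p q (k - 1) @ [x]" "z = y + pr (alt p q k)" for p q x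
    proof -
      have "len (y + pr (alt p q (k - 1))) = len y + length (alt p q (k - 1))"
        by (rule asc_prefix[of y _ "[x]"]) (use d(6,8,13) that in \<open>auto simp flip: that(3)\<close>)
      then show ?thesis using l[OF that(1,2)] d(6,8,13) by (intro steps_ok_Up[OF IH]) auto
    qed
    have e: "y + pr (alt b a (k - 1)) = z + gn (rd z)" "y + pr (alt a b (k - 1)) = z + gn s"
      using last_step[OF d(12,10)] last_step[OF d(11,9)] .
    note E1 = ext_simps[OF d(8) l[OF d(4,3)] ok[OF d(4,3,12,10)], unfolded e]
    note E2 = ext_simps[OF d(8) l[OF d(3,4)] ok[OF d(3,4,11,9)], unfolded e]
    note V = Vert_simps[OF d(3,4,2,5)]
    have rS: "rd z \<in> S" using rd(1)[OF less.prems(1) z0] .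
    show ?thesis
      unfolding d(14)
      by (rule HomI) (use E1 E2 V rS less.prems d(8,11,12) N_rd[OF less.prems(1) z0] in \<open>simp_all\<close>)
  qed
qed

text \<open>A descending step goes back along \<open>Phi w s\<close> and caps off the two final
  strands; this form is dictated by coherence of the cap.\<close>

definition Psi where
  "Psi w s = (if len w < len (w + gn s) then Phi (w + gn s) s
     else (ide (N (w + gn s)) \<parallel> cl (Cap s)) \<cdot> (iv (Phi w s) \<parallel> ide [s]))"

lemma gn_gn: "w + gn s + gn s = w"
  by (simp add: add.assoc)

lemma Psi_Hom: assumes "w \<in> WS" "s \<in> S" shows "Psi w s \<in> Hom D (N w @ [s]) (N (w + gn s))"
proof (cases "len w < len (w + gn s)")
  case True
  then show ?thesis using Phi_Hom[of "w + gn s" s] assms by (simp add: Psi_def gn_gn)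
next
  case False
  then have "len (w + gn s) < len w" using len_add_g[OF WP_W[OF assms(1)], of s] by auto
  note P = HomD[OF Phi_Hom[OF assms this]]
  show ?thesis by (rule HomI) (use P False assms in \<open>simp_all add: Psi_def\<close>)
qed

definition E where "E w u = ext Psi w u"

lemma steps_ok_Psi: "\<lbrakk>w \<in> WS; u \<in> lists S\<rbrakk> \<Longrightarrow> steps_ok Psi w u"
  unfolding steps_ok_def by (intro allI impI Psi_Hom) auto

lemma E_simps [simp]:
  assumes "w \<in> WS" "u \<in> lists S"
  shows "arr (E w u)" "Dm (E w u) = N w @ u" "Cd (E w u) = N (w + pr u)"
  using ext_simps[OF assms steps_ok_Psi[OF assms]] by (simp_all add: E_def)

lemma E_append:
  "\<lbrakk>w \<in> WS; u \<in> lists S; v \<in> lists S\<rbrakk> \<Longrightarrow> E w (u @ v) = E (w + pr u) v \<cdot> (E w u \<parallel> ide v)"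
  unfolding E_def by (intro ext_append steps_ok_Psi) auto

lemma E_Nil: "E w [] = ide (N w)"
  by (simp add: E_def)

lemma E_single: assumes "w \<in> WS" "s \<in> S" shows "E w [s] = Psi w s"
  using HomD[OF Psi_Hom[OF assms]] assms by (simp add: E_def)

lemma E_Up:
  assumes "w \<in> WS" "len (w + pr u) = len w + length u" shows "E w u = ext Up w u"
  unfolding E_def
proof (rule ext_cong)
  fix v s v' assume u: "u = v @ s # v'"
  have W: "w \<in> W" using assms(1) by blast
  have "len (w + pr v) = len w + length v" using asc_prefix[OF W, of v "s # v'"] assms(2) u by simp
  moreover have "len (w + pr v + gn s) = len w + Suc (length v)"
    using asc_prefix[OF W, of "v @ [s]" v'] assms(2) u by (simp add: add.assoc)
  ultimately show "Psi (w + pr v) s = Up (w + pr v) s" by (simp add: Psi_def Up_def)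
qed

section \<open>Coherent morphisms\<close>

definition good where
  "good w A \<longleftrightarrow> E w (Cd A) \<cdot> (ide (N w) \<parallel> A) = E w (Dm A)"

lemma good_ide: "\<lbrakk>w \<in> WS; u \<in> lists S\<rbrakk> \<Longrightarrow> good w (ide u)"
  by (simp add: good_def tensor_ide)

lemma good_comp:
  assumes "w \<in> WS" "arr A" "arr B" "Cd A = Dm B" "good w A" "good w B"
  shows "good w (B \<cdot> A)"
proof -
  have "E w (Cd B) \<cdot> (ide (N w) \<parallel> (B \<cdot> A)) = (E w (Cd B) \<cdot> (ide (N w) \<parallel> B)) \<cdot> (ide (N w) \<parallel> A)"
    using assms(1-4) arr_lists[OF assms(2)] arr_lists[OF assms(3)] arr_pr[OF assms(3)]
    by (simp add: comp_assoc)
  then show ?thesis using assms by (simp add: good_def)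
qed

lemma good_tensor:
  assumes "w \<in> WS" "arr A" "arr B" "good w A" "good (w + pr (Dm A)) B"
  shows "good w (A \<parallel> B)"
proof -
  let ?w = "w + pr (Dm A)"
  have w: "?w \<in> WS" "w + pr (Cd A) = ?w" using assms(1) arr_lists[OF assms(2)] arr_pr[OF assms(2)] by simp_all
  note l = arr_lists[OF assms(2)] arr_lists[OF assms(3)]
  have "E w (Cd A @ Cd B) \<cdot> (ide (N w) \<parallel> (A \<parallel> B)) =
      (E ?w (Cd B) \<cdot> (E w (Cd A) \<parallel> ide (Cd B))) \<cdot> ((ide (N w) \<parallel> A) \<parallel> B)"
    using assms(1-3) l w by (simp add: E_append tensor_assoc)
  also have "\<dots> = E ?w (Cd B) \<cdot> ((E w (Cd A) \<cdot> (ide (N w) \<parallel> A)) \<parallel> B)"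
    using assms(1-3) l w by (simp add: comp_assoc interchange)
  also have "\<dots> = E ?w (Cd B) \<cdot> (E w (Dm A) \<parallel> B)"
    using assms(4) by (simp add: good_def)
  also have "\<dots> = (E ?w (Cd B) \<cdot> (ide (N ?w) \<parallel> B)) \<cdot> (E w (Dm A) \<parallel> ide (Dm B))"
    using assms(1-3) l w by (simp add: comp_assoc interchange)
  also have "\<dots> = E w (Dm A @ Dm B)"
    using assms(1,5) l w by (simp add: good_def E_append)
  finally show ?thesis using assms by (simp add: good_def)
qed

text \<open>Strands on the left may be removed: coherence at \<open>w\<close> and at
  \<open>w + pr u\<close> differ by the morphism \<open>E w u\<close> tensored with an identity, and
  this is invertible.\<close>

lemma good_tensor_cancel:
  assumes "w \<in> WS" "u \<in> lists S" "arr A" "good w (ide u \<parallel> A)"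
  shows "good (w + pr u) A"
proof -
  let ?w = "w + pr u"
  have w: "?w \<in> WS" using assms by simp
  note l = arr_lists[OF assms(3)]
  have "(E ?w (Cd A) \<cdot> (ide (N ?w) \<parallel> A)) \<cdot> (E w u \<parallel> ide (Dm A)) =
      (E ?w (Cd A) \<cdot> (E w u \<parallel> ide (Cd A))) \<cdot> (ide (N w) \<parallel> (ide u \<parallel> A))"
    using assms(1-3) l w by (simp add: comp_assoc interchange tensor_ide flip: tensor_assoc)
  also have "\<dots> = E ?w (Dm A) \<cdot> (E w u \<parallel> ide (Dm A))"
    using assms l w by (simp add: good_def E_append)
  finally have eq: "(E ?w (Cd A) \<cdot> (ide (N ?w) \<parallel> A)) \<cdot> (E w u \<parallel> ide (Dm A)) =
      E ?w (Dm A) \<cdot> (E w u \<parallel> ide (Dm A))" .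
  show ?thesis
    unfolding good_def
    by (rule comp_right_cancel[OF _ _ _ _ _ eq]) (use assms(1-3) l w arr_pr[OF assms(3)] in simp_all)
qed

lemma good_inverse:
  assumes "w \<in> WS" "arr A" "arr B" "Dm B = Cd A" "Cd B = Dm A" "A \<cdot> B = ide (Cd A)" "good w A"
  shows "good w B"
proof -
  have "E w (Dm A) \<cdot> (ide (N w) \<parallel> B) = E w (Cd A) \<cdot> ((ide (N w) \<parallel> A) \<cdot> (ide (N w) \<parallel> B))"
    using assms(1-5,7) arr_lists[OF assms(2)] arr_pr[OF assms(2)] by (simp add: good_def del: comp_ide_tensor flip: comp_assoc)
  also have "\<dots> = E w (Cd A)"
    using assms(1-6) arr_lists[OF assms(2)] by (simp add: tensor_ide)
  finally show ?thesis using assms by (simp add: good_def)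
qed

lemma good_cancel_left:
  assumes "w \<in> WS" "arr A" "arr B" "Cd A = Dm B" "good w B" "good w (B \<cdot> A)"
  shows "good w A"
proof -
  have "E w (Cd B) \<cdot> (ide (N w) \<parallel> (B \<cdot> A)) = (E w (Cd B) \<cdot> (ide (N w) \<parallel> B)) \<cdot> (ide (N w) \<parallel> A)"
    using assms(1-4) arr_lists[OF assms(2)] arr_lists[OF assms(3)] arr_pr[OF assms(3)]
    by (simp add: comp_assoc)
  then show ?thesis using assms by (simp add: good_def)
qed

lemma good_cancel_right:
  assumes "w \<in> WS" "arr A" "arr B" "Cd A = Dm B" "good w A" "good w (B \<cdot> A)"
  shows "good w B"
proof -
  note l = arr_lists[OF assms(2)] arr_lists[OF assms(3)] arr_pr[OF assms(2)] arr_pr[OF assms(3)]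
  have "(E w (Cd B) \<cdot> (ide (N w) \<parallel> B)) \<cdot> (ide (N w) \<parallel> A) = E w (Cd B) \<cdot> (ide (N w) \<parallel> (B \<cdot> A))"
    using assms(1-4) l by (simp add: comp_assoc)
  also have "\<dots> = E w (Dm B) \<cdot> (ide (N w) \<parallel> A)"
    using assms by (simp add: good_def)
  finally have eq: "(E w (Cd B) \<cdot> (ide (N w) \<parallel> B)) \<cdot> (ide (N w) \<parallel> A) = E w (Dm B) \<cdot> (ide (N w) \<parallel> A)" .
  show ?thesis
    unfolding good_def by (rule comp_right_cancel[OF _ _ _ _ _ eq]) (use assms(1-4) l in simp_all)
qed

text \<open>If the first of the two steps ascends, the second one by definition undoes it and then
  caps. If it descends, the cap in its definition sits on the first two of three strands and has to
  be slid to the last two.\<close>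

lemma good_cap: assumes "w \<in> WS" "s \<in> S" shows "good w (cl (Cap s))"
proof -
  define z where "z = w + gn s"
  have z: "z \<in> WS" "z + gn s = w" using assms by (simp_all add: z_def gn_gn)
  have ss: "[s, s] \<in> lists S" "[s] \<in> lists S" using assms by auto
  have "E w [s, s] = E (w + pr [s]) [s] \<cdot> (E w [s] \<parallel> ide [s])"
    using E_append[of w "[s]" "[s]"] assms by simp
  then have Ess: "E w [s, s] = Psi z s \<cdot> (Psi w s \<parallel> ide [s])"
    using E_single[OF assms] E_single[OF z(1) assms(2)] by (simp add: z_def)
  have "Psi z s \<cdot> (Psi w s \<parallel> ide [s]) = ide (N w) \<parallel> cl (Cap s)"
  proof (cases "len w < len z")
    case True
    define P where "P = Phi z s"
    have P: "arr P" "Dm P = N w @ [s]" "Cd P = N z"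
      unfolding P_def using HomD[OF Phi_Hom[OF z(1) assms(2)]] True z(2) by auto
    have "Psi w s = P" using True by (simp add: Psi_def P_def z_def)
    moreover have "Psi z s = (ide (N w) \<parallel> cl (Cap s)) \<cdot> (iv P \<parallel> ide [s])"
      using True z(2) by (simp add: Psi_def P_def)
    ultimately show ?thesis
      using P assms z ss by (simp add: comp_assoc interchange tensor_ide)
  next
    case False
    then have zw: "len z < len w" using len_add_g[OF WP_W[OF assms(1)], of s] by (auto simp: z_def)
    define P where "P = Phi w s"
    have P: "arr P" "Dm P = N z @ [s]" "Cd P = N w"
      unfolding P_def using HomD[OF Phi_Hom[OF assms]] zw by (auto simp: z_def)
    have 1: "Psi z s = P" using zw z(2) by (simp add: Psi_def P_def)
    have 2: "Psi w s = (ide (N z) \<parallel> cl (Cap s)) \<cdot> (iv P \<parallel> ide [s])"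
      using False by (simp add: Psi_def P_def z_def)
    have "Psi w s \<parallel> ide [s] = ((ide (N z) \<parallel> cl (Cap s)) \<parallel> ide [s]) \<cdot> ((iv P \<parallel> ide [s]) \<parallel> ide [s])"
      unfolding 2 using P assms z ss by (simp add: interchange)
    also have "(ide (N z) \<parallel> cl (Cap s)) \<parallel> ide [s] = ide (N z) \<parallel> (ide [s] \<parallel> cl (Cap s))"
      using assms z ss by (simp add: tensor_assoc cap_slide)
    also have "\<dots> = ide (N z @ [s]) \<parallel> cl (Cap s)"
      using assms z ss by (simp add: tensor_ide flip: tensor_assoc)
    also have "(iv P \<parallel> ide [s]) \<parallel> ide [s] = iv P \<parallel> ide [s, s]"
      using P assms z ss by (simp add: tensor_assoc tensor_ide)
    also have "(ide (N z @ [s]) \<parallel> cl (Cap s)) \<cdot> (iv P \<parallel> ide [s, s]) = iv P \<parallel> cl (Cap s)"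
      using P assms z ss by (simp add: interchange)
    also have "\<dots> = (iv P \<parallel> ide []) \<cdot> (ide (N w) \<parallel> cl (Cap s))"
      using P assms z ss by (simp add: interchange del: tensor_Nil)
    also have "\<dots> = iv P \<cdot> (ide (N w) \<parallel> cl (Cap s))"
      using P by simp
    finally show ?thesis using 1 P assms by simp
  qed
  then show ?thesis
    unfolding good_def using Ess assms by (simp add: E_Nil)
qed

lemma good_cup: assumes "w \<in> WS" "s \<in> S" shows "good w (cl (Cup s))"
  by (rule good_inverse[OF assms(1) _ _ _ _ _ good_cap[OF assms]]) (use assms in \<open>simp_all add: cap_cup\<close>)

lemma good_vert_sym:
  assumes "w \<in> WS" "s \<in> S" "t \<in> S" "s \<noteq> t" "m s t = enat k" "good w (cl (Vert s t))"
  shows "good w (cl (Vert t s))"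
proof -
  have m: "m t s = enat k" using assms m_sym_S by metis
  show ?thesis
    by (rule good_inverse[OF assms(1) _ _ _ _ _ assms(6)])
      (use assms m vert_vert[of t s k] in \<open>simp_all add: Vert_simps\<close>)
qed

section \<open>Vertices whose coset top has its chosen descent among the two colours\<close>

lemma E_snoc:
  assumes "w \<in> WS" "u \<in> lists S" "s \<in> S" "len (w + pr u) < len (w + pr u + gn s)"
  shows "E w (u @ [s]) = Phi (w + pr u + gn s) s \<cdot> (E w u \<parallel> ide [s])"
proof -
  have "E w (u @ [s]) = Psi (w + pr u) s \<cdot> (E w u \<parallel> ide [s])"
    using E_append[of w u "[s]"] E_single[of "w + pr u" s] assms by simp
  then show ?thesis using assms(4) by (simp add: Psi_def)
qed

text \<open>Here coherence is the equation that was solved to define \<open>Phi\<close> at the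
  descent other than \<open>rd z\<close>. On the side ending in \<open>rd z\<close> the last step is
  an identity, because \<open>N z\<close> itself ends in that letter.\<close>

lemma vert_base:
  assumes st: "s \<in> S" "t \<in> S" "s \<noteq> t" "m s t = enat k" and y: "y \<in> WS" "is_min {s, t} y"
    and desc: "\<And>x. x \<in> {s, t} \<Longrightarrow> len (y + pr (alt s t k) + gn x) < len (y + pr (alt s t k))"
    and r: "rd (y + pr (alt s t k)) \<in> {s, t}"
  shows "good y (cl (Vert s t))"
proof -
  define z where "z = y + pr (alt s t k)"
  have zS: "z \<in> WS" using y(1) alt_lists[of s t S k] st by (simp add: z_def)
  define x where "x = (if rd z = s then t else s)"
  have x: "x \<in> S" "x \<noteq> rd z" "len (z + gn x) < len z" "{rd z, x} = {s, t}"
    using r st desc[of x] by (auto simp: x_def z_def)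
  obtain y' k' a b where d: "{a, b} = {rd z, x}" "a \<noteq> b" "a \<in> S" "b \<in> S" "m a b = enat k'" "k' \<ge> 2" "is_min {a, b} y'"
      "y' \<in> WS" "z = y' + pr (alt a b k')" "z = y' + pr (alt b a k')"
      "alt a b k' = alt a b (k' - 1) @ [x]" "alt b a k' = alt b a (k' - 1) @ [rd z]" "len z = len y' + k'"
      "Phi z x = (ext Up y' (alt b a (k' - 1)) \<parallel> ide [rd z]) \<cdot> (ide (N y') \<parallel> cl (Vert a b)) \<cdot>
         iv (ext Up y' (alt a b (k' - 1)) \<parallel> ide [x])"
    by (rule top_data[OF zS x(1-3)])
  have ab: "{a, b} = {s, t}" using d(1) x(4) by simp
  have "k' = k" using d(2,5) st m_sym_S[OF st(1-3)] ab by (auto simp: doubleton_eq_iff)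
  have "y' = y"
  proof -
    have "pr (alt a b k') \<in> WP {s, t}" using alt_WP[of a b k'] ab by simp
    then show ?thesis
      using min_unique[of "{s, t}" y' y "pr (alt a b k')" "pr (alt s t k)"] d(7,9) ab y(2) alt_WP[of s t k]
      by (simp add: z_def)
  qed
  note d = d[unfolded \<open>k' = k\<close> \<open>y' = y\<close>]
  have l: "alt p q j \<in> lists S" if "p \<in> S" "q \<in> S" for p q j
    by (rule alt_lists) (use that in simp)
  define A where "A = alt a b (k - 1)"
  define B where "B = alt b a (k - 1)"
  have AB: "A \<in> lists S" "B \<in> lists S" using l d(3,4) by (simp_all add: A_def B_def)
  note step = last_step[OF d(11,9), folded A_def] last_step[OF d(12,10), folded B_def]
  have up: "E y A = ext Up y A" "E y B = ext Up y B"
  proof -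
    have "len (y + pr (A @ [x])) = len y + length (A @ [x])" "len (y + pr (B @ [rd z])) = len y + length (B @ [rd z])"
      using d(6,9,10,13) d(11,12)[symmetric] by (simp_all add: A_def B_def)
    then have "len (y + pr A) = len y + length A" "len (y + pr B) = len y + length B"
      using asc_prefix[of y] y(1) by blast+
    then show "E y A = ext Up y A" "E y B = ext Up y B" using E_Up y(1) by blast+
  qed
  have rS: "rd z \<in> S" "len (z + gn (rd z)) < len z" using r st desc[of "rd z"] by (auto simp: z_def)
  note V = Vert_simps[OF d(3,4,2,5)]
  have EA: "E y (alt a b k) = (E y B \<parallel> ide [rd z]) \<cdot> (ide (N y) \<parallel> cl (Vert a b))"
  proof -
    have "E y (alt a b k) = Phi z x \<cdot> (E y A \<parallel> ide [x])"
      unfolding d(11) A_def[symmetric] using E_snoc[OF y(1) AB(1) x(1)] x(3) step(1) by (simp add: gn_gn)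
    also have "\<dots> = ((E y B \<parallel> ide [rd z]) \<cdot> (ide (N y) \<parallel> cl (Vert a b)) \<cdot> iv (E y A \<parallel> ide [x])) \<cdot> (E y A \<parallel> ide [x])"
      by (simp only: d(14)[folded A_def B_def, folded up])
    also have "\<dots> = (E y B \<parallel> ide [rd z]) \<cdot> (ide (N y) \<parallel> cl (Vert a b))"
      using y(1) AB x(1) rS V[unfolded d(11,12), folded A_def B_def] by (simp add: comp_assoc)
    finally show ?thesis .
  qed
  have EB: "E y (alt b a k) = E y B \<parallel> ide [rd z]"
  proof -
    have "E y (alt b a k) = Phi z (rd z) \<cdot> (E y B \<parallel> ide [rd z])"
      unfolding d(12) B_def[symmetric] using E_snoc[OF y(1) AB(2) rS(1)] rS(2) step(2) by (simp add: gn_gn)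
    moreover have "z \<noteq> 0" using rS(2) by (metis len_0 not_less_zero)
    then have "N z = N (z + gn (rd z)) @ [rd z]"
      by (rule N_rd[OF zS])
    ultimately show ?thesis
      using y(1) AB(2) rS(1) step(2) zS by (simp add: Phi_rd)
  qed
  have "good y (cl (Vert a b))"
    unfolding good_def using EA EB V by simp
  then show ?thesis
    using ab good_vert_sym[OF y(1) d(3,4,2,5)] by (auto simp: doubleton_eq_iff)
qed

lemma alt_desc:
  assumes "s \<noteq> t" "mS s t = enat k" "x \<in> {s, t}"
  shows "len (pr (alt s t k) + gn x) < len (pr (alt s t k))"
proof -
  have k: "Suc (k - 1) = k" using m_ge2[OF assms(1)] assms(2) by (simp add: numeral_eq_enat)
  have *: "len (pr (alt p q k) + gn (if even (k - 1) then p else q)) < len (pr (alt p q k))"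
    if "p \<noteq> q" "mS p q = enat k" for p q
  proof -
    have "alt p q k = alt p q (k - 1) @ [if even (k - 1) then p else q]"
      using alt_Suc_snoc[of p q "k - 1"] k by (simp del: alt.simps)
    moreover have "red (alt p q k)" using red_alt[OF that(1)] that(2) by simp
    ultimately show ?thesis by (metis last_step red_snoc gn_gn add_0)
  qed
  have "mS t s = enat k" "pr (alt t s k) = pr (alt s t k)"
    using assms m_sym[OF assms(1)] pr_braid[OF assms(1,2)] by auto
  then show ?thesis using *[of s t] *[of t s] assms by (auto split: if_splits)
qed

section \<open>Braid paths as diagrams\<close>

lemma move_class:
  assumes "a \<in> lists S" "c \<in> lists S" "p \<in> S" "q \<in> S" "p \<noteq> q" "m p q = enat k"
  shows "cl (move_diag (a, p, q, c)) = ide a \<parallel> (cl (Vert p q) \<parallel> ide c)"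
    "dt (move_diag (a, p, q, c)) (move_src m (a, p, q, c)) (move_tgt m (a, p, q, c))"
proof -
  have mqp: "m q p = enat k" using assms m_sym_S by metis
  have t: "dt (Ident a) a a" "dt (Vert p q) (alt p q k) (alt q p k)" "dt (Ident c) c c"
    using assms by (auto intro: diag_type.intros)
  note tt = diag_type.Tensor[OF t(2,3)]
  show "cl (move_diag (a, p, q, c)) = ide a \<parallel> (cl (Vert p q) \<parallel> ide c)"
    unfolding ide_cl tensor_cl[OF t(2,3)] tensor_cl[OF t(1) tt] by simp
  show "dt (move_diag (a, p, q, c)) (move_src m (a, p, q, c)) (move_tgt m (a, p, q, c))"
    using diag_type.Tensor[OF t(1) tt] assms(6) mqp by simp
qed

lemma braid_path_Cons:
  assumes "braid_path I x u (e # es) v" "I \<subseteq> S"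
  obtains a p q c k where "e = (a, p, q, c)" "p \<in> I" "q \<in> I" "p \<noteq> q" "m p q = enat k" "u = a @ alt p q k @ c"
    "move_src m e = u" "move_tgt m e = a @ alt q p k @ c"
    "u \<in> red_words I x" "move_tgt m e \<in> red_words I x" "braid_path I x (move_tgt m e) es v"
    "dt (move_diag e) u (move_tgt m e)"
proof -
  obtain a p q c where e: "e = (a, p, q, c)" by (cases e) auto
  have pq: "p \<in> I" "q \<in> I" "p \<noteq> q" "mS p q \<noteq> \<infinity>" using assms(1) by (simp_all add: e)
  have S: "p \<in> S" "q \<in> S" using pq assms(2) by auto
  then obtain k where k: "m p q = enat k" using pq(4) by auto
  have k': "m q p = enat k" using k m_sym_S[OF S pq(3)] by simp
  have b: "u = a @ alt p q k @ c" "u \<in> red_words I x" "a @ alt q p k @ c \<in> red_words I x"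
    "braid_path I x (a @ alt q p k @ c) es v"
  proof -
    have mk: "mS p q = enat k" "mS q p = enat k" using S k k' by simp_all
    have "u = a @ alt p q k @ c \<and> u \<in> red_words I x \<and> a @ alt q p k @ c \<in> red_words I x \<and>
        braid_path I x (a @ alt q p k @ c) es v"
      using assms(1) unfolding e braid_path.simps move_src.simps move_tgt.simps mk the_enat.simps by blast
    then show "u = a @ alt p q k @ c" "u \<in> red_words I x" "a @ alt q p k @ c \<in> red_words I x"
      "braid_path I x (a @ alt q p k @ c) es v" by blast+
  qed
  then have "a \<in> lists S" "c \<in> lists S" using lists_mono[OF assms(2)] by (auto simp: red_words_def)
  then have "dt (move_diag e) (move_src m e) (move_tgt m e)" using move_class(2) S pq k e by blast
  then show ?thesis using that[OF e pq(1-3) k b(1)] b k k' by (simp add: e)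
qed

lemma path_diag_type:
  "\<lbrakk>braid_path I x u es v; I \<subseteq> S; u \<in> lists S\<rbrakk> \<Longrightarrow> dt (path_diag m u es) u v"
proof (induction es arbitrary: u)
  case Nil
  then show ?case by (simp add: diag_type.Ident)
next
  case (Cons e es)
  obtain a p q c k where b: "braid_path I x (move_tgt m e) es v" "dt (move_diag e) u (move_tgt m e)"
    by (rule braid_path_Cons[OF Cons.prems(1,2)])
  then have "dt (path_diag m (move_tgt m e) es) (move_tgt m e) v"
    using Cons.IH Cons.prems(2) diag_type_lists by blast
  then show ?case using b(2) by (simp add: diag_type.Comp)
qed

lemma path_class_Cons:
  assumes "braid_path I x u (e # es) v" "I \<subseteq> S"
  shows "cl (path_diag m u (e # es)) = cl (path_diag m (move_tgt m e) es) \<cdot> cl (move_diag e)"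
proof -
  obtain a p q c k where b: "braid_path I x (move_tgt m e) es v" "dt (move_diag e) u (move_tgt m e)"
    by (rule braid_path_Cons[OF assms])
  have "dt (path_diag m (move_tgt m e) es) (move_tgt m e) v"
    using path_diag_type[OF b(1) assms(2)] b(2) diag_type_lists by blast
  then show ?thesis using comp_cl[OF b(2)] by simp
qed

lemma path_good:
  assumes "w \<in> WS" "I \<subseteq> S"
  shows "\<lbrakk>braid_path I x u es v; u \<in> lists S; \<And>e. e \<in> set es \<Longrightarrow> good w (cl (move_diag e))\<rbrakk>
    \<Longrightarrow> good w (cl (path_diag m u es))"
proof (induction es arbitrary: u)
  case Nil
  then show ?case using good_ide[OF assms(1)] by (simp add: ide_cl)
next
  case (Cons e es)
  obtain a p q c k where b: "braid_path I x (move_tgt m e) es v" "dt (move_diag e) u (move_tgt m e)"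
    by (rule braid_path_Cons[OF Cons.prems(1) assms(2)])
  have tS: "move_tgt m e \<in> lists S" using b(2) diag_type_lists by blast
  note t = cl_simps[OF path_diag_type[OF b(1) assms(2) tS]] cl_simps[OF b(2)]
  have "good w (cl (path_diag m (move_tgt m e) es))" using Cons.IH[OF b(1) tS] Cons.prems(3) by simp
  then show ?case
    unfolding path_class_Cons[OF Cons.prems(1) assms(2)]
    using good_comp[OF assms(1)] t Cons.prems(3)[of e] by simp
qed

text \<open>Coherence satisfies two out of three. The edges before \<open>e\<close> are removed by
  \<open>good_cancel_right\<close>, and the rest of the path after \<open>e\<close> by
  \<open>good_cancel_left\<close>.\<close>

lemma exceptional_edge:
  assumes "w \<in> WS" "I \<subseteq> S"
  shows "\<lbrakk>braid_path I x u (es1 @ e # es2) v; u \<in> lists S; good w (cl (path_diag m u (es1 @ e # es2)));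
    \<And>e'. e' \<in> set es1 \<union> set es2 \<Longrightarrow> good w (cl (move_diag e'))\<rbrakk> \<Longrightarrow> good w (cl (move_diag e))"
proof (induction es1 arbitrary: u)
  case Nil
  then have bp: "braid_path I x u (e # es2) v" by simp
  obtain a p q c k where b: "braid_path I x (move_tgt m e) es2 v" "dt (move_diag e) u (move_tgt m e)"
    by (rule braid_path_Cons[OF bp assms(2)])
  have tS: "move_tgt m e \<in> lists S" using b(2) diag_type_lists by blast
  note t = cl_simps[OF path_diag_type[OF b(1) assms(2) tS]] cl_simps[OF b(2)]
  have "good w (cl (path_diag m (move_tgt m e) es2))"
    using path_good[OF assms b(1) tS] Nil.prems(4) by simp
  moreover have "good w (cl (path_diag m (move_tgt m e) es2) \<cdot> cl (move_diag e))"
    using Nil.prems(3) path_class_Cons[OF bp assms(2)] by simp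
  ultimately show ?case using good_cancel_left[OF assms(1)] t by simp
next
  case (Cons e1 es1)
  then have bp: "braid_path I x u (e1 # es1 @ e # es2) v" by simp
  obtain a p q c k where b: "braid_path I x (move_tgt m e1) (es1 @ e # es2) v" "dt (move_diag e1) u (move_tgt m e1)"
    by (rule braid_path_Cons[OF bp assms(2)])
  have tS: "move_tgt m e1 \<in> lists S" using b(2) diag_type_lists by blast
  note t = cl_simps[OF path_diag_type[OF b(1) assms(2) tS]] cl_simps[OF b(2)]
  have "good w (cl (path_diag m (move_tgt m e1) (es1 @ e # es2)) \<cdot> cl (move_diag e1))"
    using Cons.prems(3) path_class_Cons[OF bp assms(2)] by simp
  then have "good w (cl (path_diag m (move_tgt m e1) (es1 @ e # es2)))"
    using good_cancel_right[OF assms(1)] t Cons.prems(4)[of e1] by simp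
  then show ?case using Cons.IH[OF b(1) tS] Cons.prems(4) by simp
qed

lemma braid_path_edge:
  "\<lbrakk>braid_path I x u es v; e \<in> set es\<rbrakk> \<Longrightarrow> \<exists>u' es'. braid_path I x u' (e # es') v"
proof (induction es arbitrary: u)
  case (Cons f es)
  obtain a p q c where f: "f = (a, p, q, c)" by (cases f) auto
  show ?case
  proof (cases "e = f")
    case True
    then show ?thesis using Cons.prems by blast
  next
    case False
    then show ?thesis using Cons f by auto
  qed
qed simp

text \<open>Both sides of the braid move are reduced, so \<open>pr a\<close> is minimal in the coset
  crossed. Since \<open>w\<close> is minimal for \<open>I\<close>, translating by \<open>w\<close>
  preserves this and adds lengths.\<close>

lemma edge_data:
  assumes w: "w \<in> WS" "is_min I w" and IS: "I \<subseteq> S" and bp: "braid_path I x u es v" and e: "e \<in> set es"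
  obtains a p q b j where "e = (a, p, q, b)" "p \<in> I" "q \<in> I" "p \<in> S" "q \<in> S" "p \<noteq> q" "m p q = enat j"
    "a \<in> lists S" "b \<in> lists S" "pr (a @ alt p q j @ b) = x" "len x = length a + j + length b" "len (pr a) = length a"
    "is_min {p, q} (pr a)" "is_min {p, q} (w + pr a)" "len (w + pr a + pr (alt p q j)) = len w + length a + j"
proof -
  obtain u' es' where bp': "braid_path I x u' (e # es') v" using braid_path_edge[OF bp e] by blast
  obtain a p q b j where f: "e = (a, p, q, b)" "p \<in> I" "q \<in> I" "p \<noteq> q" "m p q = enat j" "u' = a @ alt p q j @ b"
    "move_src m e = u'" "move_tgt m e = a @ alt q p j @ b" "u' \<in> red_words I x" "move_tgt m e \<in> red_words I x"
    by (rule braid_path_Cons[OF bp' IS])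
  have pqS: "p \<in> S" "q \<in> S" using f(2,3) IS by auto
  obtain j' where j: "j = Suc j'" using m_ge2[OF f(4)] pqS f(5) by (cases j) (auto simp: numeral_eq_enat)
  have rw: "red (a @ alt p q j @ b)" "red (a @ alt q p j @ b)" "pr (a @ alt p q j @ b) = x"
    and aI: "a \<in> lists I" "b \<in> lists I"
    using f(6,8-10) by (auto simp: red_words_def)
  have abS: "a \<in> lists S" "b \<in> lists S" using aI lists_mono[OF IS] by blast+
  have asc: "len (pr a) < len (pr a + gn p)" "len (pr a) < len (pr a + gn q)"
    using rw(1,2) red_append[of "a @ [p]" "alt q p j' @ b"] red_append[of "a @ [q]" "alt p q j' @ b"]
    by (simp_all add: j red_snoc)
  have "is_min {p, q} (pr a)" using asc by (auto simp: is_min_def)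
  moreover have "is_min {p, q} (w + pr a)"
    unfolding is_min_def using min_asc_iff[OF w(2) WP_pr[OF aI(1)]] asc f(2,3) w(1) by auto
  moreover have "red (a @ alt p q j)" using rw(1) red_append[of "a @ alt p q j" b] by simp
  then have "len (w + pr a + pr (alt p q j)) = len w + length a + j"
    using min_add_red[OF w(2), of "a @ alt p q j"] aI(1) alt_lists[of p q I j] f(2,3) by (simp add: add.assoc)
  moreover have "len x = length a + j + length b" using rw(1,3) by (simp add: red_def)
  moreover have "len (pr a) = length a" using rw(1) red_append[of a "alt p q j @ b"] by (simp add: red_def)
  ultimately show ?thesis using that[OF f(1-3) pqS f(4,5) abS rw(3)] by blast
qed

lemma zam_class:
  assumes "distinct [r, s, t]" "{r, s, t} \<subseteq> S" "x \<in> WP {r, s, t}"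
    "\<And>a. a \<in> {r, s, t} \<Longrightarrow> len (x + gn a) < len x"
  obtains u es where "u \<in> lists S" "braid_path {r, s, t} x u es u" "distinct (map crossed es)"
    "set (map crossed es) = rank2_cosets {r, s, t}" "cl (path_diag m u es) = ide u"
proof -
  let ?I = "{r, s, t}"
  obtain u es where z: "u \<in> red_words ?I x" "braid_path ?I x u es u" "distinct (map crossed es)"
    "set (map crossed es) = rank2_cosets ?I"
    using ex_zam_cycle[OF assms(1,3,4)] by blast
  have uS: "u \<in> lists S" using z(1) assms(2) lists_mono[of ?I S] by (auto simp: red_words_def)
  have "zam_cycle S m ?I u es"
    using zam_cycle_braid_path[OF assms(2) z(1) assms(4) z(2-4)] by blast
  moreover have "finite (parabolic S m ?I)"
    using finite_parabolic[OF assms(2) longest_finite[OF assms(3,4)]] by simp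
  ultimately have "diag_rel S m (path_diag m u es) (Ident u)"
    using assms(1,2) by (intro diag_rel.zamolodzhikov) auto
  then have "cl (path_diag m u es) = ide u"
    unfolding ide_cl using path_diag_type[OF z(2) assms(2) uS] diag_type.Ident[OF uS] by (rule rel_cl)
  then show ?thesis using that uS z by blast
qed

lemma vert_min:
  "\<lbrakk>s \<in> S; t \<in> S; s \<noteq> t; m s t = enat k; y \<in> WS; is_min {s, t} y\<rbrakk> \<Longrightarrow> good y (cl (Vert s t))"
proof (induction "len (y + pr (alt s t k))" arbitrary: y s t k rule: less_induct)
  case less
  note st = less.prems(1-4) and y = less.prems(5,6)
  define z where "z = y + pr (alt s t k)"
  have mst: "mS s t = enat k" using st by simp
  have zS: "z \<in> WS" using y(1) alt_lists[of s t S k] st by (simp add: z_def)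
  have desc: "len (z + gn a) < len z" if "a \<in> {s, t}" for a
    using min_desc_iff[OF y(2) alt_WP that] alt_desc[OF st(3) mst that] by (simp add: z_def)
  have z0: "z \<noteq> 0" using desc[of s] by auto
  define r where "r = rd z"
  have r: "r \<in> S" "len (z + gn r) < len z" using rd[OF zS z0] by (simp_all add: r_def)
  show ?case
  proof (cases "r \<in> {s, t}")
    case True
    then show ?thesis using vert_base[OF st y] desc by (simp add: z_def r_def)
  next
    case False
    define I where "I = {r, s, t}"
    have dist: "distinct [r, s, t]" using False st(3) by auto
    have IS: "I \<subseteq> S" using r(1) st by (simp add: I_def)
    \<comment> \<open>The cycle runs between reduced words of the component \<open>x\<close>, which
      has all of \<open>I\<close> as descents; coherence is tested at the minimal element
      \<open>w\<close>.\<close>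
    obtain w x where wx: "is_min I w" "x \<in> WP I" "z = w + x" using min_decomp[OF WP_W[OF zS]] by blast
    have xS: "x \<in> WS" using WP_mono[OF IS wx(2)] .
    have "w = z + - x" using wx(3) by (simp add: add.assoc add.right_inverse del: add_uminus_conv_diff)
    then have wS: "w \<in> WS" using zS xS by (metis WP_add WP_uminus)
    have xdesc: "len (x + gn a) < len x" if "a \<in> I" for a
      using min_desc_iff[OF wx(1,2) that] desc[of a] r(2) that wx(3) by (auto simp: I_def)
    have zdesc: "len (z + gn a) < len z" if "a \<in> I" for a
      using that desc r(2) by (auto simp: I_def)
    have lz: "len z = len w + len x" using min_add[OF wx(1,2)] wx(3) by simp
    obtain u es where c: "u \<in> lists S" "braid_path I x u es u" "distinct (map crossed es)"
      "set (map crossed es) = rank2_cosets I" "cl (path_diag m u es) = ide u"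
      using zam_class[OF dist IS[unfolded I_def] wx(2)[unfolded I_def]] xdesc unfolding I_def by blast
    \<comment> \<open>If letters follow the braid move, the top of its coset is shorter than
      \<open>z\<close> and induction applies. If none follow, the top is \<open>z\<close>: with
      \<open>r\<close> among the labels \<open>vert_base\<close> applies, and otherwise the labels
      are \<open>s\<close> and \<open>t\<close> and the coset is the excluded one.\<close>
    have edge: "good w (cl (move_diag e))" if "e \<in> set es" "crossed e \<noteq> coset x {s, t}" for e
    proof -
      note ne = that(2) and ie = that(1)
      obtain a p q b j where e: "e = (a, p, q, b)" "p \<in> I" "q \<in> I" and pqS: "p \<in> S" "q \<in> S"
        and pq: "p \<noteq> q" "m p q = enat j" and abS: "a \<in> lists S" "b \<in> lists S"
        and x: "pr (a @ alt p q j @ b) = x" "len x = length a + j + length b" and la: "len (pr a) = length a"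
        and mina: "is_min {p, q} (pr a)" and y1': "is_min {p, q} (w + pr a)"
          "len (w + pr a + pr (alt p q j)) = len w + length a + j"
        by (rule edge_data[OF wS wx(1) IS c(2) ie])
      define y1 where "y1 = w + pr a"
      have y1S: "y1 \<in> WS" using wS abS by (simp add: y1_def)
      note y1 = y1'[folded y1_def]
      have "good y1 (cl (Vert p q))"
      proof (cases "b = []")
        case False
        then have "len (y1 + pr (alt p q j)) < len (y + pr (alt s t k))"
          using y1(2) x(2) lz by (simp add: z_def)
        then show ?thesis using less.hyps pqS pq y1S y1(1) by blast
      next
        case True
        then have z1: "y1 + pr (alt p q j) = z" using x(1) wx(3) by (simp add: y1_def add.assoc)
        show ?thesis
        proof (cases "r \<in> {p, q}")
          case r: True
          show ?thesis
            by (rule vert_base[OF pqS pq y1S y1(1)])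
              (use r z1 zdesc e(2,3) in \<open>auto simp: r_def\<close>)
        next
          case r: False
          then have "{p, q} = {s, t}" using e(2,3) pq(1) by (auto simp: I_def)
          moreover have "coset (pr a) {p, q} = coset x {p, q}"
            using coset_add[OF alt_WP[of p q j], of "pr a"] x(1) True by simp
          ultimately have "crossed e = coset x {s, t}" by (simp add: e(1))
          then show ?thesis using ne by blast
        qed
      qed
      then have "good y1 (cl (Vert p q) \<parallel> ide b)"
        using good_tensor[OF y1S] good_ide abS y1S Vert_simps[OF pqS pq] alt_lists[of p q S j] pqS by simp
      then show ?thesis
        unfolding e(1) move_class(1)[OF abS pqS pq]
        using good_tensor[OF wS] good_ide[OF wS] abS Vert_simps[OF pqS pq] by (simp add: y1_def)
    qed
    have "coset x {s, t} \<in> set (map crossed es)"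
      unfolding c(4) rank2_cosets_def
      by (intro CollectI exI[of _ x] exI[of _ "{s, t}"]) (use wx(2) st(3) in \<open>auto simp: I_def\<close>)
    then obtain e where e: "e \<in> set es" "crossed e = coset x {s, t}" by auto
    then obtain es1 es2 where es: "es = es1 @ e # es2" by (meson split_list)
    have others: "good w (cl (move_diag e'))" if "e' \<in> set es1 \<union> set es2" for e'
    proof (rule edge)
      show "e' \<in> set es" using that es by auto
      have "crossed e' \<noteq> crossed e" using c(3) that by (auto simp: es)
      then show "crossed e' \<noteq> coset x {s, t}" using e(2) by simp
    qed
    have "good w (cl (path_diag m u es))" using c(5) good_ide[OF wS c(1)] by simp
    then have ge: "good w (cl (move_diag e))"
      using exceptional_edge[OF wS IS c(2)[unfolded es] c(1)] others es by simp
    obtain a p q b j where f: "e = (a, p, q, b)" "p \<in> I" "q \<in> I" and pqS: "p \<in> S" "q \<in> S"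
      and pq: "p \<noteq> q" "m p q = enat j" and abS: "a \<in> lists S" "b \<in> lists S"
      and x: "pr (a @ alt p q j @ b) = x" "len x = length a + j + length b" and la: "len (pr a) = length a"
      and mina: "is_min {p, q} (pr a)" and y1': "is_min {p, q} (w + pr a)"
        "len (w + pr a + pr (alt p q j)) = len w + length a + j"
      by (rule edge_data[OF wS wx(1) IS c(2) e(1)])
    define y1 where "y1 = w + pr a"
    have y1S: "y1 \<in> WS" using wS abS by (simp add: y1_def)
    note y1 = y1'[folded y1_def]
    have "coset (pr a) {p, q} = coset x {s, t}" using e(2) f(1) by simp
    then obtain x' where x': "{p, q} = {s, t}" "x' \<in> WP {p, q}" "x = pr a + x'" by (rule coset_eqD)
    have mpq: "mS p q = enat j" using pqS pq by simp
    \<comment> \<open>The exceptional coset contains \<open>x\<close>, and the alternating word is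
      already longest in its dihedral subgroup, so no length is left for \<open>b\<close>: the move
      stands at the end of the word.\<close>
    have "len x' \<le> j"
      using longest_max(1)[OF alt_WP[of p q j] alt_desc[OF pq(1) mpq] x'(2)] len_alt[OF pq(1), of j] mpq by simp
    moreover have "len x = length a + len x'" using min_add[OF mina x'(2)] x'(3) la by simp
    moreover note x(2)
    ultimately have "length b = 0" by linarith
    then have b: "b = []" by simp
    note V = Vert_simps[OF pqS pq]
    have "good w (ide a \<parallel> cl (Vert p q))"
      using ge V(1) unfolding f(1) move_class(1)[OF abS pqS pq] unfolding b by simp
    then have gy1: "good y1 (cl (Vert p q))"
      using good_tensor_cancel[OF wS abS(1)] V by (simp add: y1_def)
    have z1: "y1 + pr (alt p q j) = y + pr (alt s t k)"
      using x(1) wx(3) b by (simp add: y1_def z_def add.assoc)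
    have "pr (alt p q j) \<in> WP {s, t}" using alt_WP[of p q j] x'(1) by simp
    then have "y1 = y"
      using min_unique[of "{s, t}" y1 y, OF _ y(2) _ alt_WP z1] y1(1) x'(1) by simp
    then show ?thesis
      using gy1 x'(1) good_vert_sym[OF y1S pqS pq] by (auto simp: doubleton_eq_iff)
  qed
qed

section \<open>Rotation and arbitrary vertices\<close>

lemma rotate:
  assumes st: "s \<in> S" "t \<in> S" "s \<noteq> t" "m s t = enat k"
  obtains x j where "x \<in> S" "alt t s k = alt t s j @ [x]" "k = Suc j"
    "cl (Vert t s) = (ide (s # alt t s j) \<parallel> cl (Cap x)) \<cdot>
      ((ide [s] \<parallel> (cl (Vert s t) \<parallel> ide [x])) \<cdot> (cl (Cup s) \<parallel> ide (alt t s j @ [x])))"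
proof -
  have mts: "m t s = enat k" using st m_sym_S by metis
  have "mS s t = enat k" using st by simp
  then obtain j where k: "k = Suc j" using m_ge2[OF st(3)] by (cases k) (auto simp: numeral_eq_enat)
  have l: "alt p q i \<in> lists S" if "p \<in> {s, t}" "q \<in> {s, t}" for p q i
    by (rule alt_lists) (use st that in auto)
  have V: "dt (Vert s t) (alt s t k) (alt t s k)" "dt (Vert t s) (alt t s k) (alt s t k)"
    using st mts by (auto intro: diag_type.Vert)
  define x where "x = (if even j then t else s)"
  have x: "x \<in> S" using st by (simp add: x_def)
  have snoc: "alt t s k = alt t s j @ [x]" unfolding k x_def by (rule alt_Suc_snoc)
  then have last: "x = last (alt t s k)" by simp
  have t: "dt (Cup s) [] [s, s]" "dt (Ident (alt t s j @ [x])) (alt t s j @ [x]) (alt t s j @ [x])"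
    "dt (Ident [s]) [s] [s]" "dt (Ident [x]) [x] [x]" "dt (Cap x) [x, x] []"
    "dt (Ident (s # alt t s j)) (s # alt t s j) (s # alt t s j)"
    using st x l by (simp_all add: diag_type.Ident diag_type.Cap diag_type.Cup)
  note T1 = diag_type.Tensor[OF t(1,2)] and T2 = diag_type.Tensor[OF V(1) t(4)]
  note T3 = diag_type.Tensor[OF t(3) T2] and T4 = diag_type.Tensor[OF t(6,5)]
  have e: "[] @ alt t s j @ [x] = alt t s k" "[s, s] @ alt t s j @ [x] = [s] @ alt s t k @ [x]"
    "[s] @ alt t s k @ [x] = (s # alt t s j) @ [x, x]" "(s # alt t s j) @ [] = alt s t k"
    by (simp_all add: snoc) (simp_all add: k)
  note T1' = T1[unfolded e] and T4' = T4[folded e(3), unfolded e(4)]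
  note T5 = diag_type.Comp[OF T1' T3]
  have "cl ((Ident (s # alt t s j) \<star> Cap x) \<bullet> (Ident [s] \<star> Vert s t \<star> Ident [x]) \<bullet>
      (Cup s \<star> Ident (alt t s j @ [x]))) = cl (Vert t s)"
    using rel_cl[OF diag_rel.rotate_cw[of s S t m k x, OF st last] _ V(2)] diag_type.Comp[OF T5 T4'] k by simp
  then have "cl (Vert t s) = (ide (s # alt t s j) \<parallel> cl (Cap x)) \<cdot>
      ((ide [s] \<parallel> (cl (Vert s t) \<parallel> ide [x])) \<cdot> (cl (Cup s) \<parallel> ide (alt t s j @ [x])))"
    unfolding ide_cl tensor_cl[OF t(1,2)] tensor_cl[OF V(1) t(4)] tensor_cl[OF t(3) T2] tensor_cl[OF t(6,5)]
      comp_cl[OF T1' T3] comp_cl[OF T5 T4'] by simp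
  then show ?thesis using that[of x j] x snoc k by blast
qed

text \<open>In the rotated diagram the vertex stands to the right of a strand coloured
  \<open>s\<close>, so its coherence is needed at \<open>w + gn s\<close>. The cups, caps and
  identities around it are coherent everywhere.\<close>

lemma rotate_good:
  assumes st: "s \<in> S" "t \<in> S" "s \<noteq> t" "m s t = enat k" and w: "w \<in> WS"
    and g: "good (w + gn s) (cl (Vert s t))"
  shows "good w (cl (Vert t s))"
proof -
  note V = Vert_simps[OF st]
  have ls: "alt s t i \<in> lists S" "alt t s i \<in> lists S" for i using st by (simp_all add: alt_lists)
  have WW: "w + (gn a + pr u) \<in> WS" if "a \<in> S" "u \<in> lists S" for a u
    by (intro WP_add WP_g WP_pr that w)
  obtain x j where x: "x \<in> S" "alt t s k = alt t s j @ [x]" and k: "k = Suc j"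
    and eq: "cl (Vert t s) = (ide (s # alt t s j) \<parallel> cl (Cap x)) \<cdot>
      ((ide [s] \<parallel> (cl (Vert s t) \<parallel> ide [x])) \<cdot> (cl (Cup s) \<parallel> ide (alt t s j @ [x])))"
    by (rule rotate[OF st])
  have "good w (cl (Cup s) \<parallel> ide (alt t s j @ [x]))"
    using st x(1) w ls by (intro good_tensor good_cup good_ide) (auto simp: WW)
  moreover have "good w (ide [s] \<parallel> (cl (Vert s t) \<parallel> ide [x]))"
    using st x(1) w V g ls by (intro good_tensor good_ide) (auto simp: WW)
  moreover have "good w (ide (s # alt t s j) \<parallel> cl (Cap x))"
    using st x(1) w ls by (intro good_tensor good_cap good_ide) (auto simp: WW)
  ultimately show ?thesis
    unfolding eq using st x(1) w ls V by (intro good_comp) (auto simp: x(2) k simp flip: x(2))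
qed

lemma good_vert:
  "\<lbrakk>w \<in> WS; s \<in> S; t \<in> S; s \<noteq> t; m s t = enat k\<rbrakk> \<Longrightarrow> good w (cl (Vert s t))"
proof (induction "len w" arbitrary: w s t rule: less_induct)
  case less
  have mts: "m t s = enat k" using less.prems m_sym_S by metis
  have desc: "len (w + gn a) < len w" if "\<not> len w < len (w + gn a)" for a
    using that len_add_g[OF WP_W[OF less.prems(1)], of a] by auto
  show ?case
  proof (cases "is_min {s, t} w")
    case True
    then show ?thesis using vert_min less.prems by blast
  next
    case False
    then consider "len (w + gn s) < len w" | "len (w + gn t) < len w"
      using desc less.prems(1) by (auto simp: is_min_def)
    then show ?thesis
    proof cases
      case 1
      then have "good w (cl (Vert t s))" using less rotate_good[of s t k w] by simp
      then show ?thesis using good_vert_sym[of w t s k] less.prems mts by simp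
    next
      case 2
      then show ?thesis using less rotate_good[of t s k w] mts by simp
    qed
  qed
qed

lemma good_all: "dt f u v \<Longrightarrow> w \<in> WS \<Longrightarrow> good w (cl f)"
proof (induction arbitrary: w rule: diag_type.induct)
  case (Ident u)
  then show ?case using good_ide by (simp add: ide_cl)
next
  case (Comp f u v g x)
  then show ?case
    using good_comp[of w "cl f" "cl g"] cl_simps[OF Comp(1)] cl_simps[OF Comp(2)]
    by (simp add: comp_cl[OF Comp(1,2), symmetric])
next
  case (Tensor f u v g u' v')
  then show ?case
    using good_tensor[of w "cl f" "cl g"] cl_simps[OF Tensor(1)] cl_simps[OF Tensor(2)] diag_type_lists[OF Tensor(1)]
    by (simp add: tensor_cl[OF Tensor(1,2), symmetric])
qed (auto intro: good_cap good_cup good_vert)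

theorem Hom_faithful: assumes "A \<in> Hom D u v" "B \<in> Hom D u v" shows "A = B"
proof -
  have uv: "u \<in> lists S" "v \<in> lists S" using Hom_lists[OF assms(1)] by auto
  have *: "E 0 v \<cdot> C = E 0 u" if C: "C \<in> Hom D u v" for C
  proof -
    obtain f where f: "dt f u v" "C = cl f" using C unfolding Hom_iff by blast
    then show ?thesis using good_all[OF f(1), of 0] HomD[OF C] by (simp add: good_def)
  qed
  show ?thesis
    using comp_left_cancel[of "E 0 v" A B] *[OF assms(1)] *[OF assms(2)] HomD[OF assms(1)] HomD[OF assms(2)] uv
    by simp
qed

text \<open>Both words map to the same normal form; go there from \<open>u\<close> and return to
  \<open>v\<close> by an inverse.\<close>

theorem Hom_full: assumes "u \<in> lists S" "v \<in> lists S" "wd u = wd v" shows "Hom D u v \<noteq> {}"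
proof -
  have "pr u = pr v" using assms word_elt_eq_iff by blast
  then have "iv (E 0 v) \<cdot> E 0 u \<in> Hom D u v" using assms by (intro HomI) simp_all
  then show ?thesis by blast
qed

lemma Hom_wd: assumes "A \<in> Hom D u v" shows "wd u = wd v"
proof -
  obtain f where "dt f u v" using assms unfolding Hom_iff by blast
  then show ?thesis using diag_type_pr diag_type_lists word_elt_eq_iff by blast
qed

section \<open>The functor and its quasi-inverse\<close>

abbreviation Om where "Om \<equiv> Omega G"

lemma strict_monoidal_Om: "strict_monoidal_category Om"
proof -
  interpret group G by (rule group_G)
  show ?thesis
    by unfold_locales (auto simp: Omega_def m_assoc split: if_splits)
qed

interpretation D: strict_monoidal_category D by (rule strict_monoidal_D)

interpretation Om: strict_monoidal_category Om by (rule strict_monoidal_Om)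

lemma functor_F: "strict_monoidal_functor D Om wd (\<lambda>u v f. Idn Om (wd u))"
proof unfold_locales
  fix a assume "a \<in> Obj D"
  then show "wd a \<in> Obj Om" by (simp add: Omega_def)
next
  fix a b f assume "f \<in> Hom D a b"
  then show "Idn Om (wd a) \<in> Hom Om (wd a) (wd b)" using Hom_wd by (simp add: Omega_def)
next
  fix a b c f g assume "f \<in> Hom D a b" "g \<in> Hom D b c"
  then show "Idn Om (wd a) = Cmp Om (Idn Om (wd b)) (Idn Om (wd a))" by (simp add: Omega_def)
next
  show "wd (Unit D) = Unit Om" by (simp add: Omega_def word_elt_Nil)
next
  fix a b assume "a \<in> Obj D" "b \<in> Obj D"
  then show "wd (TObj D a b) = TObj Om (wd a) (wd b)" by (simp add: Omega_def word_elt_append)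
next
  fix a b a' b' f g assume "a \<in> Obj D" "b \<in> Obj D" "a' \<in> Obj D" "b' \<in> Obj D" "f \<in> Hom D a b" "g \<in> Hom D a' b'"
  then show "Idn Om (wd (TObj D a a')) = TMor Om (Idn Om (wd a)) (Idn Om (wd a'))"
    by (simp add: Omega_def word_elt_append)
qed simp_all

definition word_of where "word_of x = (SOME u. u \<in> lists S \<and> wd u = x)"

lemma word_of: "x \<in> Obj Om \<Longrightarrow> word_of x \<in> lists S \<and> wd (word_of x) = x"
  unfolding word_of_def by (rule someI_ex) (auto simp: Omega_def carrier_eq)

definition mor where "mor u v = (SOME A. A \<in> Hom D u v)"

lemma mor: assumes "u \<in> lists S" "v \<in> lists S" "wd u = wd v" shows "mor u v \<in> Hom D u v"
proof -
  obtain A where "A \<in> Hom D u v" using Hom_full[OF assms] by blast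
  then show ?thesis unfolding mor_def by (rule someI)
qed

text \<open>Arbitrary choices of a word for each element and of a morphism between words suffice:
  parallel morphisms of \<open>D\<close> are equal, which yields functoriality of the quasi-inverse
  and the invertibility and naturality of the unit.\<close>

lemma equivalence_F: "equivalence_of_categories D Om wd (\<lambda>u v f. Idn Om (wd u))"
proof -
  interpret F: strict_monoidal_functor D Om wd "\<lambda>u v f. Idn Om (wd u)" by (rule functor_F)
  let ?G1 = "\<lambda>x y f. mor (word_of x) (word_of y)"
  have Hom_Om: "Hom Om x y = (if x = y then {x} else {})" for x y by (simp add: Omega_def)
  have G1: "?G1 x y f \<in> Hom D (word_of x) (word_of y)" if "x \<in> Obj Om" "y \<in> Obj Om" "f \<in> Hom Om x y" for x y f
    using that word_of mor by (auto simp: Hom_Om split: if_splits)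
  have G: "cat_functor Om D word_of ?G1"
  proof unfold_locales
    fix x assume "x \<in> Obj Om"
    then show "word_of x \<in> Obj D" using word_of by simp
    then show "mor (word_of x) (word_of x) = ide (word_of x)"
      using Hom_faithful[OF mor ide_Hom] by simp
  next
    fix x y f assume "x \<in> Obj Om" "y \<in> Obj Om" "f \<in> Hom Om x y"
    then show "mor (word_of x) (word_of y) \<in> Hom D (word_of x) (word_of y)" by (rule G1)
  next
    fix x y z f g assume o: "x \<in> Obj Om" "y \<in> Obj Om" "z \<in> Obj Om" and fg: "f \<in> Hom Om x y" "g \<in> Hom Om y z"
    have "mor (word_of y) (word_of z) \<cdot> mor (word_of x) (word_of y) \<in> Hom D (word_of x) (word_of z)"
      using D.Cmp_Hom[OF _ _ _ G1[OF o(1,2) fg(1)] G1[OF o(2,3) fg(2)]] o word_of by simp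
    moreover have "mor (word_of x) (word_of z) \<in> Hom D (word_of x) (word_of z)"
      using G1[of x z x] o fg by (auto simp: Hom_Om split: if_splits)
    ultimately show "mor (word_of x) (word_of z) = mor (word_of y) (word_of z) \<cdot> mor (word_of x) (word_of y)"
      using Hom_faithful by blast
  qed
  interpret G: cat_functor Om D word_of ?G1 by (rule G)
  have wO: "wd a \<in> Obj Om" if "a \<in> lists S" for a using that by (simp add: Omega_def)
  have Id_D: "cat_functor D D (\<lambda>a. a) (\<lambda>a b f. f)" by unfold_locales simp_all
  have Id_Om: "cat_functor Om Om (\<lambda>a. a) (\<lambda>a b f. f)" by unfold_locales simp_all
  have GF: "cat_functor D D (\<lambda>a. word_of (wd a)) (\<lambda>a b f. ?G1 (wd a) (wd b) (Idn Om (wd a)))"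
    by (rule cat_functor_comp[OF F.cat_functor_axioms G])
  have FG: "cat_functor Om Om (\<lambda>x. wd (word_of x)) (\<lambda>x y f. Idn Om (wd (word_of x)))"
    by (rule cat_functor_comp[OF G F.cat_functor_axioms])
  have eta: "natural_iso D D (\<lambda>a. a) (\<lambda>a b f. f) (\<lambda>a. word_of (wd a))
      (\<lambda>a b f. ?G1 (wd a) (wd b) (Idn Om (wd a))) (\<lambda>a. mor a (word_of (wd a)))"
    unfolding natural_iso_def natural_iso_axioms_def
  proof (intro conjI allI impI Id_D GF)
    fix a assume "a \<in> Obj D"
    then have a: "a \<in> lists S" "word_of (wd a) \<in> lists S" "wd (word_of (wd a)) = wd a" using word_of[OF wO] by auto
    note M = mor[OF a(1,2)] mor[OF a(2,1) a(3)]
    have "mor (word_of (wd a)) a \<cdot> mor a (word_of (wd a)) = ide a"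
      using Hom_faithful[OF D.Cmp_Hom[OF _ _ _ M(1) M(2)] ide_Hom] a by simp
    moreover have "mor a (word_of (wd a)) \<cdot> mor (word_of (wd a)) a = ide (word_of (wd a))"
      using Hom_faithful[OF D.Cmp_Hom[OF _ _ _ M(2) M(1)] ide_Hom] a by simp
    ultimately show "is_iso_mor D a (word_of (wd a)) (mor a (word_of (wd a)))"
      unfolding is_iso_mor_def using M a(3) by auto
  next
    fix a b f assume "a \<in> Obj D" "b \<in> Obj D" "f \<in> Hom D a b"
    then have a: "a \<in> lists S" "word_of (wd a) \<in> lists S" "wd (word_of (wd a)) = wd a"
      and b: "b \<in> lists S" "word_of (wd b) \<in> lists S" "wd (word_of (wd b)) = wd b"
      and f: "f \<in> Hom D a b" "wd a = wd b" using word_of[OF wO] Hom_wd by auto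
    have "mor b (word_of (wd b)) \<cdot> f \<in> Hom D a (word_of (wd b))"
      using D.Cmp_Hom[OF _ _ _ f(1) mor] a b by simp
    moreover have "mor (word_of (wd a)) (word_of (wd b)) \<cdot> mor a (word_of (wd a)) \<in> Hom D a (word_of (wd b))"
      using D.Cmp_Hom[OF _ _ _ mor mor] a b f(2) by simp
    ultimately show "mor b (word_of (wd b)) \<cdot> f = mor (word_of (wd a)) (word_of (wd b)) \<cdot> mor a (word_of (wd a))"
      by (rule Hom_faithful)
  qed
  have eps: "natural_iso Om Om (\<lambda>x. wd (word_of x)) (\<lambda>x y f. Idn Om (wd (word_of x)))
      (\<lambda>x. x) (\<lambda>x y f. f) (\<lambda>x. x)"
    unfolding natural_iso_def natural_iso_axioms_def
    by (intro conjI allI impI Id_Om FG)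
      (use word_of in \<open>auto simp: is_iso_mor_def Omega_def split: if_splits\<close>)
  show ?thesis
    unfolding equivalence_of_categories_def
    by (intro conjI exI) (rule F.cat_functor_axioms G eta eps)+
qed

end

theorem theorem1p20:
  fixes S :: "'a set" and m :: "'a \<Rightarrow> 'a \<Rightarrow> enat"
  assumes "coxeter_matrix S m"
  shows "strict_monoidal_functor (W_diag S m) (Omega (coxeter_group S m)) (word_elt S m)
           (\<lambda>u v f. Idn (Omega (coxeter_group S m)) (word_elt S m u))
       \<and> equivalence_of_categories (W_diag S m) (Omega (coxeter_group S m)) (word_elt S m)
           (\<lambda>u v f. Idn (Omega (coxeter_group S m)) (word_elt S m u))"
proof -
  interpret coxeter_system S m by unfold_locales (rule assms)
  show ?thesis using functor_F equivalence_F by blast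
qed

end
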